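(* Let $-2<\beta<0$. Then $$U_\beta(dx)=\eta_\beta\delta_0(dx)+\Bigl[\frac1{\mu_\beta}+\sum_{k\ge1}\frac{e^{s_{\beta,k}x}}{\phi_\beta'(s_{\beta,k})}\Bigr]dx .$$ The residues $1/\phi_\beta'(s_{\beta,k})$ are positive, and the series converges locally uniformly for $x>0$. Equivalently, for $\operatorname{Re} z>0$, $$\frac1{\phi_\beta(z)}=\eta_\beta+\frac1{\mu_\beta z}+\sum_{k\ge1}\frac1{\phi_\beta'(s_{\beta,k})(z-s_{\beta,k})}.$$ In particular, $$\eta_\beta-\sum_{k\ge1}\frac1{s_{\beta,k}\phi_\beta'(s_{\beta,k})}=-\frac{\phi_\beta''(0)}{2\mu_\beta^2}.$$
   Context: For $\beta>-2$ and $\operatorname{Re}z\ge0$ put $\phi_\beta(z)=\int_0^1(1-s^z)s^{\beta+1}(1-s)^\beta\,ds$, and let $\xi$ be the subordinator with $\mathsf E e^{-z\xi_t}=e^{-t\phi_\beta(z)}$. Its potential measure is $U_\beta(dx)=\int_0^\infty\mathsf P(\xi_t\in dx)\,dt$ on $[0,\infty)$, so that $\int_{[0,\infty)}e^{-zx}U_\beta(dx)=1/\phi_\beta(z)$ for $\operatorname{Re}z>0$. Put $\mu_\beta=\phi_\beta'(0)$ and $$\eta_\beta=U_\beta(\{0\})=\lim_{a\to\infty}\frac1{\phi_\beta(a)}=\begin{cases}B(\beta+2,\beta+1)^{-1},&\beta>-1,\\0,&-2<\beta\le-1,\end{cases}$$ with $B$ the beta function. For $-2<\beta<0$, $\phi_\beta$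 extends meromorphically to $\mathbb C$, with simple poles at $-(m+\beta+2)$, $m=0,1,2,\dots$, and its zeros are real and simple and interlace with the poles; the zeros are written as $0=s_{\beta,0}>s_{\beta,1}>s_{\beta,2}>\cdots$. *)

theory Defs
  imports "HOL-Probability.Probability" "HOL-Complex_Analysis.Complex_Analysis"
begin

definition phi :: "real \<Rightarrow> complex \<Rightarrow> complex" where
  "phi \<beta> z = (LBINT s:{0<..<1}. (1 - of_real s powr z) *
                 of_real (s powr (\<beta> + 1) * (1 - s) powr \<beta>))"

(* The meromorphic continuation of phi from the closed right half-plane, for -2 < \<beta> < 0.
   It is unique because nicely_meromorphic_on fixes the values at removable
   singularities and, as 0, at the poles. *)
definition phi_ext :: "real \<Rightarrow> complex \<Rightarrow> complex" where
  "phi_ext \<beta> = (THE f. f nicely_meromorphic_on UNIV \<and> (\<forall>z. Re z \<ge> 0 \<longrightarrow> f z = phi \<beta> z))"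

(* All zeros, in decreasing order. Poles are excluded explicitly, since phi_ext has the
   value 0 there. Equality with the set of all complex zeros makes this well defined only
   because every zero is real. *)
definition phi_zero :: "real \<Rightarrow> nat \<Rightarrow> real" where
  "phi_zero \<beta> = (THE s. s 0 = 0 \<and> (\<forall>k. s (Suc k) < s k) \<and>
     range (\<lambda>k. complex_of_real (s k)) = {z. \<not> is_pole (phi_ext \<beta>) z \<and> phi_ext \<beta> z = 0})"

definition mu :: "real \<Rightarrow> complex" where
  "mu \<beta> = deriv (phi_ext \<beta>) 0"

(* The mass at 0 of the potential measure of the subordinator with Laplace exponent phi \<beta>,
   i.e. the limit of 1 / phi \<beta> a as a tends to infinity. *)
definition eta :: "real \<Rightarrow> real" where
  "eta \<beta> = (if \<beta> > -1 then 1 / Beta (\<beta> + 2) (\<beta> + 1) else 0)"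

locale subordinator = prob_space M for M :: "'a measure" +
  fixes \<xi> :: "real \<Rightarrow> 'a \<Rightarrow> real"
  assumes measurable_subordinator: "t \<ge> 0 \<Longrightarrow> \<xi> t \<in> borel_measurable M"
    and paths: "AE \<omega> in M. \<xi> 0 \<omega> = 0 \<and> mono_on {0..} (\<lambda>t. \<xi> t \<omega>) \<and>
                  (\<forall>t\<ge>0. continuous (at_right t) (\<lambda>t. \<xi> t \<omega>))"
    and independent_increments:
      "0 \<le> \<tau> 0 \<Longrightarrow> (\<And>i. i < n \<Longrightarrow> \<tau> i \<le> \<tau> (Suc i)) \<Longrightarrow>
         indep_vars (\<lambda>_. borel) (\<lambda>i \<omega>. \<xi> (\<tau> (Suc i)) \<omega> - \<xi> (\<tau> i) \<omega>) {..<n :: nat}"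
    and stationary_increments:
      "s \<ge> 0 \<Longrightarrow> h \<ge> 0 \<Longrightarrow>
         distr M borel (\<lambda>\<omega>. \<xi> (s + h) \<omega> - \<xi> s \<omega>) = distr M borel (\<xi> h)"

definition has_laplace_exponent ::
    "'a measure \<Rightarrow> (real \<Rightarrow> 'a \<Rightarrow> real) \<Rightarrow> (complex \<Rightarrow> complex) \<Rightarrow> bool" where
  "has_laplace_exponent M \<xi> \<phi> \<longleftrightarrow>
     (\<forall>t\<ge>0. \<forall>z. Re z \<ge> 0 \<longrightarrow>
        (LINT \<omega>|M. exp (- z * of_real (\<xi> t \<omega>))) = exp (- of_real t * \<phi> z))"

(* A measure on the whole real line; for a subordinator it is carried by {0..}. *)
definition potential_measure :: "'a measure \<Rightarrow> (real \<Rightarrow> 'a \<Rightarrow> real) \<Rightarrow> real measure" where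
  "potential_measure M \<xi> = measure_of UNIV (sets borel)
     (\<lambda>A. \<integral>\<^sup>+ t\<in>{0..}. emeasure M {\<omega> \<in> space M. \<xi> t \<omega> \<in> A} \<partial>lborel)"

(* The coefficients of the expansion of 1 / phi; the zeroth one is 1 / mu. *)
definition phi_res :: "real \<Rightarrow> nat \<Rightarrow> complex" where
  "phi_res \<beta> k = 1 / deriv (phi_ext \<beta>) (of_real (phi_zero \<beta> k))"

(* Complex-valued only because phi_ext is: for x > 0 the values are real. *)
definition potential_density :: "real \<Rightarrow> real \<Rightarrow> complex" where
  "potential_density \<beta> x = 1 / mu \<beta> +
     (\<Sum>k. phi_res \<beta> (Suc k) * exp (of_real (phi_zero \<beta> (Suc k) * x)))"

end

theory Submission
  imports Defs
begin

text \<open>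
  Put \<open>c\<^sub>m = m + \<beta> + 2\<close> and let \<open>a\<^sub>m > 0\<close> be the coefficients of the binomial series of
  \<open>(1 - s)\<^sup>\<beta>\<close>; they are positive because \<open>\<beta> < 0\<close>. Integrating this series termwise gives, for
  \<open>Re z \<ge> 0\<close>, \<open>\<phi>(z) = \<Sum> a\<^sub>m (1 / c\<^sub>m - 1 / (z + c\<^sub>m))\<close> (\<open>phi_eq_pole_sum\<close>). As \<open>a\<^sub>m\<close> has the order of
  \<open>m\<close> to the power \<open>-\<beta> - 1\<close>, the sum \<open>\<Sum> a\<^sub>m / c\<^sub>m\<^sup>2\<close> converges for \<open>\<beta> > -2\<close>, whereas \<open>\<Sum> a\<^sub>m / c\<^sub>m\<close>
  converges only for \<open>\<beta> > -1\<close>; its value is then the Beta integral, which explains the two cases of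
  \<open>\<eta>\<close>. The zeros and the partial fractions depend only on the positivity of the weights, the
  growth of the \<open>c\<^sub>m\<close> and the first summability, and are treated for arbitrary series of that kind.

  \<^emph>\<open>Zeros.\<close> Every summand is increasing on each interval between poles and maps the upper
  half-plane to itself. Hence all zeros are real, \<open>0\<close> is one of them, and each gap
  \<open>(-c\<^sub>k\<^sub>+\<^sub>1, -c\<^sub>k)\<close> contains exactly one more, where the derivative is positive
  (\<open>pole_sum_gap_zero\<close>, \<open>F_eq_0_iff\<close>).

  \<^emph>\<open>Partial fractions.\<close> The sum of the first \<open>N\<close> terms is a rational function with \<open>N\<close> poles and
  \<open>N\<close> zeros, and its reciprocal is a constant plus \<open>N\<close> simple fractions, by comparison of two
  polynomials (\<open>partial_fraction_reciprocal\<close>). As \<open>N \<rightarrow> \<infinity>\<close> zeros and residues converge one by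
  one. Mass may escape to infinity in this limit, which only affects the constant; so one passes
  to the limit in the difference of the values at \<open>z\<close> and at some \<open>y > 0\<close>, whose tail beyond the
  \<open>K\<close>-th zero is at most a multiple of \<open>1 / (y + c\<^sub>K)\<close>, uniformly in \<open>N\<close>
  (\<open>reciprocal_difference_bound\<close>). Letting \<open>y \<rightarrow> \<infinity>\<close> identifies the constant as
  \<open>\<eta> = lim 1 / \<phi>(y)\<close> (\<open>reciprocal_partial_fraction\<close>). The identity at \<open>z = 0\<close> is the limit of the
  expansion along \<open>z \<down> 0\<close> (\<open>expansion_at_0\<close>).

  \<^emph>\<open>Potential measure.\<close> With \<open>q = \<phi>(1)\<close>, the measure \<open>q e\<^sup>-\<^sup>x U(dx)\<close> is a probability
  measure: it is the law obtained by running the subordinator under the measure tilted by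
  \<open>exp (- \<xi>\<^sub>t + q t)\<close> up to an independent exponential time of rate \<open>q\<close>, and its characteristic
  function is \<open>q / \<phi>(1 - i \<tau>)\<close> (\<open>tilted_potential_measure\<close>). The claimed right-hand side, weighted
  in the same way, is a mixture of the point mass at \<open>0\<close> and of exponential laws of rates
  \<open>1 - s\<^sub>k\<close> (\<open>exponential_mixture\<close>). The expansion of \<open>1 / \<phi>\<close> says that both have the same
  total mass and the same characteristic function, so they agree by Levy's uniqueness theorem.
\<close>

section \<open>Partial fractions of the reciprocal of a finite sum of simple poles\<close>

text \<open>
  If \<open>G\<close> has numerator \<open>B\<close> over the monic denominator \<open>A\<close>, the claim is the polynomial identity
  \<open>A = B / W + \<Sum> B / (D\<^sub>k (x - s\<^sub>k))\<close>. The quotients \<open>B / (x - s\<^sub>k)\<close> are explicit,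
  since \<open>G (s\<^sub>k) = 0\<close> gives \<open>G x / (x - s\<^sub>k) = \<Sum> a\<^sub>m / ((s\<^sub>k + c\<^sub>m) (x + c\<^sub>m))\<close>; that sum vanishes at
  the other zeros of \<open>G\<close> and equals \<open>D\<^sub>k\<close> at \<open>s\<^sub>k\<close>.
\<close>
lemma partial_fraction_reciprocal:
  fixes a c s D :: "nat \<Rightarrow> 'a :: field"
    and N :: nat
  defines "G \<equiv> (\<lambda>x. \<Sum>m<N. a m * (1 / c m - 1 / (x + c m)))"
  assumes inj: "inj_on s {..<N}"
    and c0: "\<And>m. m < N \<Longrightarrow> c m \<noteq> 0"
    and sc: "\<And>k m. k < N \<Longrightarrow> m < N \<Longrightarrow> s k + c m \<noteq> 0"
    and zero: "\<And>k. k < N \<Longrightarrow> G (s k) = 0"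
    and D: "\<And>k. k < N \<Longrightarrow> D k = (\<Sum>m<N. a m / (s k + c m)^2)"
    and D0: "\<And>k. k < N \<Longrightarrow> D k \<noteq> 0"
    and W: "W = (\<Sum>m<N. a m / c m)" and W0: "W \<noteq> 0"
    and z: "\<And>m. m < N \<Longrightarrow> z + c m \<noteq> 0" "\<And>k. k < N \<Longrightarrow> z \<noteq> s k"
  shows "G z * (1 / W + (\<Sum>k<N. 1 / D k / (z - s k))) = 1"
proof -
  define A where "A = (\<Prod>m<N. [:c m, 1:])"
  define A' where "A' = (\<lambda>m. \<Prod>j\<in>{..<N} - {m}. [:c j, 1:])"
  define B where "B = (\<Sum>m<N. smult (a m / c m) (pCons 0 (A' m)))"
  define B' where "B' = (\<lambda>k. \<Sum>m<N. smult (a m / (s k + c m)) (A' m))"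
  define E where "E = smult (1 / W) B + (\<Sum>k<N. smult (1 / D k) (B' k))"
  have N: "N > 0"
    using W W0 by (cases N) auto
  have monic: "lead_coeff (\<Prod>m\<in>M. [:c m, 1:]) = 1" for M :: "nat set"
    by (simp add: lead_coeff_prod)
  have degA: "degree A = N"
    unfolding A_def by (simp add: degree_prod_eq_sum_degree)
  have monicA: "lead_coeff A = 1"
    using monic[of "{..<N}"] unfolding A_def .
  have degA': "degree (A' m) = N - 1" if "m < N" for m
    unfolding A'_def using that by (simp add: degree_prod_eq_sum_degree)
  have monicA': "lead_coeff (A' m) = 1" for m
    using monic[of "{..<N} - {m}"] unfolding A'_def .
  have A': "poly (A' m) x = poly A x / (x + c m)" if "m < N" "x + c m \<noteq> 0" for m x
  proof -
    have "A = [:c m, 1:] * A' m"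
      unfolding A_def A'_def using that by (subst prod.remove[of _ m]) auto
    thus ?thesis using that by (simp add: field_simps)
  qed
  have B: "poly B x = poly A x * G x" if "\<And>m. m < N \<Longrightarrow> x + c m \<noteq> 0" for x
    unfolding B_def G_def poly_sum sum_distrib_left
  proof (intro sum.cong refl)
    fix m assume "m \<in> {..<N}"
    hence "m < N" "x + c m \<noteq> 0" "c m \<noteq> 0" using that c0 by auto
    thus "poly (smult (a m / c m) (pCons 0 (A' m))) x = poly A x * (a m * (1 / c m - 1 / (x + c m)))"
      by (simp add: A') (simp add: divide_simps)
  qed
  have B': "poly (B' k) x = poly A x * (\<Sum>m<N. a m / ((s k + c m) * (x + c m)))"
    if "\<And>m. m < N \<Longrightarrow> x + c m \<noteq> 0" for x k
    unfolding B'_def poly_sum sum_distrib_left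
    using that by (intro sum.cong) (auto simp: A')
  have B'_neq: "poly (B' k) x = poly A x * G x / (x - s k)"
    if "\<And>m. m < N \<Longrightarrow> x + c m \<noteq> 0" "k < N" "x \<noteq> s k" for x k
  proof -
    have "a m / ((s k + c m) * (x + c m)) =
          (a m * (1 / c m - 1 / (x + c m)) - a m * (1 / c m - 1 / (s k + c m))) / (x - s k)"
      if "m < N" for m
    proof -
      have "s k + c m \<noteq> 0" "x + c m \<noteq> 0" "x - s k \<noteq> 0" "c m \<noteq> 0"
        using sc[OF \<open>k < N\<close> that] that \<open>x \<noteq> s k\<close> \<open>\<And>m. m < N \<Longrightarrow> x + c m \<noteq> 0\<close> c0 by auto
      thus ?thesis by (simp add: divide_simps) (simp add: algebra_simps)
    qed
    hence "(\<Sum>m<N. a m / ((s k + c m) * (x + c m))) = (G x - G (s k)) / (x - s k)"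
      unfolding G_def sum_subtractf[symmetric] sum_divide_distrib by (intro sum.cong) auto
    thus ?thesis using B'[of x k] that zero by simp
  qed
  \<comment> \<open>Both sides have degree at most \<open>N\<close> and leading coefficient 1, and agree at the
      \<open>N\<close> zeros of \<open>G\<close>.\<close>
  have "A = E"
  proof (rule poly_eqI_degree_lead_coeff[where n = N and A = "s ` {..<N}"])
    have "poly.coeff (B' k) N = 0" for k
      unfolding B'_def coeff_sum
      using degA' N by (intro sum.neutral ballI) (auto intro!: coeff_eq_0)
    moreover have "poly.coeff (A' m) (N - 1) = 1" if "m < N" for m
      using degA'[OF that] monicA'[of m] by simp
    ultimately have "poly.coeff E N = 1"
      using N W W0 by (simp add: E_def B_def coeff_sum coeff_pCons' )
    thus "poly.coeff A N = poly.coeff E N"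
      using degA monicA by simp
    show "degree E \<le> N"
      unfolding E_def B_def B'_def
      by (intro degree_add_le degree_sum_le order_trans[OF degree_smult_le]
                order_trans[OF degree_pCons_le]) (use degA' N in auto)
    show "poly A x = poly E x" if x: "x \<in> s ` {..<N}" for x
    proof -
      obtain j where j: "j < N" "x = s j" using x by auto
      have "poly (B' k) (s j) = (if k = j then poly A (s j) * D j else 0)" if "k < N" for k
      proof (cases "k = j")
        case True
        thus ?thesis using B'[of "s j" k] sc D j by (simp add: power2_eq_square)
      next
        case False
        hence "s j \<noteq> s k" using inj j that by (auto simp: inj_on_def)
        thus ?thesis using B'_neq[of "s j" k] sc zero j that False by simp
      qed
      hence "poly E (s j) = (\<Sum>k<N. 1 / D k * (if k = j then poly A (s j) * D j else 0))"
        using B[of "s j"] sc zero j by (simp add: E_def poly_sum)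
      also have "\<dots> = poly A (s j)"
        using j D0[of j] by (simp add: if_distrib[of "\<lambda>x. _ * x"] sum.delta cong: if_cong)
      finally show ?thesis using j by simp
    qed
  qed (use degA inj in \<open>auto simp: card_image\<close>)
  hence "poly A z = poly E z" by simp
  also have "poly E z = poly A z * (G z * (1 / W + (\<Sum>k<N. 1 / D k / (z - s k))))"
    using B[of z] B'_neq[of z] z
    by (simp add: E_def poly_sum algebra_simps sum_distrib_left)
  finally show ?thesis
    using z by (auto simp: A_def poly_prod add.commute)
qed

section \<open>Series of simple poles with nonnegative weights\<close>

text \<open>
  The subtracted constants \<open>1 / c\<^sub>m\<close> make the sum vanish at \<open>0\<close> and reduce its convergence to that
  of \<open>\<Sum> a\<^sub>m / c\<^sub>m\<^sup>2\<close>. The function is polymorphic because the zeros are studied on the real line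
  and the partial fractions in the complex plane.
\<close>
definition pole_sum :: "(nat \<Rightarrow> real) \<Rightarrow> (nat \<Rightarrow> real) \<Rightarrow> 'b \<Rightarrow> 'b :: {real_normed_field, banach}" where
  "pole_sum a c z = (\<Sum>m. of_real (a m) * (1 / of_real (c m) - 1 / (z + of_real (c m))))"

definition pole_sum_deriv :: "(nat \<Rightarrow> real) \<Rightarrow> (nat \<Rightarrow> real) \<Rightarrow> 'b \<Rightarrow> 'b :: {real_normed_field, banach}" where
  "pole_sum_deriv a c z = (\<Sum>m. of_real (a m) / (z + of_real (c m))^2)"

text \<open>
  Weights may be zero, so that truncations of the series and the series with one pole removed are
  instances with the same \<open>c\<close>.
\<close>
locale pole_series =
  fixes a c :: "nat \<Rightarrow> real"
  assumes a_nonneg: "a m \<ge> 0"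
    and c_pos: "c m > 0"
    and c_strict_mono: "strict_mono c"
    and c_at_top: "filterlim c at_top sequentially"
    and summable_a_c2: "summable (\<lambda>m. a m / (c m)^2)"
begin

definition poles :: "'b :: real_normed_field set" where
  "poles = {- of_real (c m) |m. a m > 0}"

lemma not_pole: "z \<notin> poles \<Longrightarrow> a m > 0 \<Longrightarrow> z + of_real (c m) \<noteq> 0"
  by (force simp: poles_def eq_neg_iff_add_eq_0)

lemma of_real_pole_iff [simp]: "of_real x \<in> (poles :: 'b :: real_normed_field set) \<longleftrightarrow> x \<in> poles"
  by (simp add: poles_def flip: of_real_minus)

lemma nonneg_not_pole: "x \<ge> 0 \<Longrightarrow> (x :: real) \<notin> poles"
  using c_pos by (fastforce simp: poles_def dest: less_le_trans)

lemma Re_nonneg_not_pole: "Re z \<ge> 0 \<Longrightarrow> z \<notin> poles"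
  using c_pos by (fastforce simp: poles_def dest: less_le_trans)

text \<open>
  Near a point that is not a pole the distance to \<open>-c\<^sub>m\<close> is comparable to \<open>c\<^sub>m\<close>, uniformly in \<open>m\<close>:
  the ratio tends to \<open>1\<close> because \<open>c\<^sub>m \<rightarrow> \<infinity>\<close>. This estimate dominates the terms of the series and of
  its derivative by multiples of \<open>a\<^sub>m / c\<^sub>m\<^sup>2\<close>, uniformly near the point.
\<close>
lemma pole_separation:
  fixes z :: "'b :: real_normed_field"
  assumes "z \<notin> poles"
  obtains r C where "r > 0" "C > 0"
    "\<And>w m. dist w z \<le> r \<Longrightarrow> a m > 0 \<Longrightarrow> c m \<le> C * norm (w + of_real (c m))"
proof -
  have norm_top: "filterlim (\<lambda>m. norm (z + of_real (c m))) at_top sequentially"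
  proof (rule filterlim_at_top_mono)
    show "filterlim (\<lambda>m. - norm z + c m) at_top sequentially"
      by (intro filterlim_tendsto_add_at_top[OF tendsto_const] c_at_top)
    show "\<forall>\<^sub>F m in sequentially. - norm z + c m \<le> norm (z + of_real (c m))"
    proof (intro always_eventually allI)
      fix m
      have "norm (of_real (c m) :: 'b) - norm z \<le> norm (of_real (c m) + z)"
        by (rule norm_diff_ineq)
      thus "- norm z + c m \<le> norm (z + of_real (c m))"
        using c_pos[of m] by (simp add: add.commute)
    qed
  qed
  have "(\<lambda>m. 1 / norm (z + of_real (c m))) \<longlonglongrightarrow> 0"
    by (rule tendsto_divide_0[OF tendsto_const])
       (use norm_top in \<open>auto intro: filterlim_at_top_imp_at_infinity\<close>)
  hence "Bseq (\<lambda>m. 1 / norm (z + of_real (c m)))"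
    by (intro convergent_imp_Bseq) (auto simp: convergent_def)
  then obtain L where L: "L > 0" "\<And>m. 1 / norm (z + of_real (c m)) \<le> L"
    by (auto simp: Bseq_def)
  define r where "r = 1 / (2 * L)"
  define C where "C = 2 * (1 + norm z * L)"
  show ?thesis
  proof
    show "r > 0" "C > 0" using L by (auto simp: r_def C_def add_pos_nonneg)
    fix w m assume w: "dist w z \<le> r" and m: "a m > 0"
    have pos: "norm (z + of_real (c m)) > 0"
      using not_pole[OF assms m] by simp
    hence *: "1 \<le> L * norm (z + of_real (c m))"
      using L(2)[of m] by (simp add: field_simps)
    have "norm (z + of_real (c m)) \<le> norm (w + of_real (c m)) + dist w z"
      using norm_triangle_ineq4[of "w + of_real (c m)" "w - z"]
      by (simp add: dist_norm add.commute)
    also have "dist w z \<le> norm (z + of_real (c m)) / 2"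
    proof -
      have "L * (2 * dist w z) \<le> 1"
        using w L(1) by (simp add: r_def field_simps)
      also note *
      finally have "L * (2 * dist w z) \<le> L * norm (z + of_real (c m))" .
      hence "2 * dist w z \<le> norm (z + of_real (c m))"
        using L(1) by (rule mult_left_le_imp_le)
      thus ?thesis by simp
    qed
    finally have half: "norm (z + of_real (c m)) \<le> 2 * norm (w + of_real (c m))" by simp
    have "c m = norm (of_real (c m) :: 'b)" using c_pos[of m] by simp
    also have "\<dots> \<le> norm (z + of_real (c m)) + norm z"
      using norm_triangle_ineq4[of "z + of_real (c m)" z] by simp
    also have "\<dots> \<le> norm (z + of_real (c m)) + norm z * (L * norm (z + of_real (c m)))"
      using mult_left_mono[OF *, of "norm z"] by simp
    also have "\<dots> = (1 + norm z * L) * norm (z + of_real (c m))"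
      by (simp add: algebra_simps)
    also have "\<dots> \<le> (1 + norm z * L) * (2 * norm (w + of_real (c m)))"
      using half L(1) by (intro mult_left_mono) (auto intro: add_nonneg_nonneg)
    finally show "c m \<le> C * norm (w + of_real (c m))"
      by (simp add: C_def algebra_simps)
  qed
qed

lemma term_bound:
  fixes w :: "'b :: real_normed_field"
  assumes "a m > 0 \<Longrightarrow> c m \<le> C * norm (w + of_real (c m))"
  shows "norm (of_real (a m) / (w + of_real (c m))^2) \<le> C\<^sup>2 * (a m / (c m)\<^sup>2)" (is ?A)
    and "norm (of_real (a m) * (1 / of_real (c m) - 1 / (w + of_real (c m)))) \<le>
           norm w * C * (a m / (c m)\<^sup>2)" (is ?B)
proof -
  have "?A \<and> ?B"
  proof (cases "a m > 0")
    case False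
    thus ?thesis using a_nonneg[of m] by simp
  next
    case True
    define d where "d = norm (w + of_real (c m))"
    have d: "c m \<le> C * d" using assms True by (simp add: d_def)
    have dpos: "d > 0"
      using d c_pos[of m] unfolding d_def
      by (metis mult_zero_right norm_ge_zero not_le order_less_le)
    have Cpos: "C > 0"
      using d dpos c_pos[of m] by (smt (verit) mult_nonpos_nonneg)
    have nz: "w + of_real (c m) \<noteq> 0" "(of_real (c m) :: 'b) \<noteq> 0"
      using dpos c_pos[of m] by (auto simp: d_def)
    have "(c m)\<^sup>2 \<le> (C * d)\<^sup>2"
      using d c_pos[of m] by (intro power_mono) auto
    hence A: "a m / d\<^sup>2 \<le> C\<^sup>2 * (a m / (c m)\<^sup>2)"
      using True dpos c_pos[of m] by (simp add: field_simps power_mult_distrib)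
    have "c m * (a m * norm w) \<le> (C * d) * (a m * norm w)"
      using d True by (intro mult_right_mono) auto
    hence B: "a m * (norm w / (c m * d)) \<le> norm w * C * (a m / (c m)\<^sup>2)"
      using True dpos c_pos[of m] by (simp add: field_simps power2_eq_square)
    have "1 / of_real (c m) - 1 / (w + of_real (c m)) = w / (of_real (c m) * (w + of_real (c m)))"
      using nz by (simp add: field_simps)
    thus ?thesis
      using A B True c_pos[of m]
      by (auto simp: norm_divide norm_mult norm_power d_def)
  qed
  thus ?A ?B by blast+
qed

lemma summable_pole_sum:
  fixes z :: "'b :: {real_normed_field, banach}"
  assumes "z \<notin> poles"
  shows "summable (\<lambda>m. of_real (a m) * (1 / of_real (c m) - 1 / (z + of_real (c m))))"
    and "summable (\<lambda>m. of_real (a m) / (z + of_real (c m))^2)"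
proof -
  obtain r C where rC: "r > 0" "\<And>w m. dist w z \<le> r \<Longrightarrow> a m > 0 \<Longrightarrow> c m \<le> C * norm (w + of_real (c m))"
    using pole_separation[OF assms] by metis
  have "a m > 0 \<Longrightarrow> c m \<le> C * norm (z + of_real (c m))" for m
    using rC(2)[of z] rC(1) by simp
  note b = term_bound[OF this]
  show "summable (\<lambda>m. of_real (a m) * (1 / of_real (c m) - 1 / (z + of_real (c m))))"
    by (rule summable_comparison_test'[OF summable_mult[OF summable_a_c2] b(2)])
  show "summable (\<lambda>m. of_real (a m) / (z + of_real (c m))^2)"
    by (rule summable_comparison_test'[OF summable_mult[OF summable_a_c2] b(1)])
qed

lemma pole_sum_of_real:
  assumes "x \<notin> poles"
  shows "pole_sum a c (of_real x :: 'b :: {real_normed_field, banach}) = of_real (pole_sum a c x)"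
    and "pole_sum_deriv a c (of_real x :: 'b) = of_real (pole_sum_deriv a c x)"
  using suminf_of_real[OF summable_pole_sum(1)[OF assms], where 'a = 'b]
    suminf_of_real[OF summable_pole_sum(2)[OF assms], where 'a = 'b]
  by (simp_all add: pole_sum_def pole_sum_deriv_def)

lemma has_field_derivative_pole_sum:
  fixes z :: "'b :: {real_normed_field, banach}"
  assumes "z \<notin> poles"
  shows "(pole_sum a c has_field_derivative pole_sum_deriv a c z) (at z)"
proof -
  obtain r C where rC: "r > 0" "\<And>w m. dist w z \<le> r \<Longrightarrow> a m > 0 \<Longrightarrow> c m \<le> C * norm (w + of_real (c m))"
    using pole_separation[OF assms] by metis
  have ball: "dist w z \<le> r" if "w \<in> ball z r" for w
    using that by (simp add: dist_commute)
  have "((\<lambda>x. \<Sum>m. of_real (a m) * (1 / of_real (c m) - 1 / (x + of_real (c m))))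
          has_field_derivative (\<Sum>m. of_real (a m) / (z + of_real (c m))^2)) (at z)"
  proof (rule has_field_derivative_series'(2)[where S = "ball z r" and x0 = z])
    fix m w assume w: "w \<in> ball z r"
    show "((\<lambda>x. of_real (a m) * (1 / of_real (c m) - 1 / (x + of_real (c m))))
            has_field_derivative of_real (a m) / (w + of_real (c m))^2) (at w within ball z r)"
    proof (cases "a m > 0")
      case False
      thus ?thesis using a_nonneg[of m] by simp
    next
      case True
      have "w + of_real (c m) \<noteq> 0"
        using rC(2)[OF ball[OF w] True] c_pos[of m] by force
      thus ?thesis
        using c_pos[of m] by (auto intro!: derivative_eq_intros simp: power2_eq_square)
    qed
  next
    show "uniformly_convergent_on (ball z r) (\<lambda>n x. \<Sum>i<n. of_real (a i) / (x + of_real (c i))\<^sup>2)"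
      by (rule Weierstrass_m_test'[OF _ summable_mult[OF summable_a_c2]])
         (rule term_bound(1)[OF rC(2)[OF ball]])
  qed (use rC(1) summable_pole_sum(1)[OF assms] in auto)
  thus ?thesis unfolding pole_sum_deriv_def pole_sum_def[abs_def] .
qed

lemma open_compl_poles: "open (- poles :: 'b :: real_normed_field set)"
  unfolding open_dist
proof
  fix z :: 'b assume "z \<in> - poles"
  then obtain r C where "r > 0" 
    and rC: "\<And>w m. dist w z \<le> r \<Longrightarrow> a m > 0 \<Longrightarrow> c m \<le> C * norm (w + of_real (c m))"
    using pole_separation[of z] by (metis Compl_iff)
  have "w \<notin> poles" if "dist w z < r" for w
  proof
    assume "w \<in> poles"
    then obtain m where "a m > 0" "w + of_real (c m) = 0" by (auto simp: poles_def)
    thus False using rC[of w m] that c_pos[of m] by simp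
  qed
  thus "\<exists>e>0. \<forall>y. dist y z < e \<longrightarrow> y \<in> - poles"
    using \<open>r > 0\<close> by auto
qed

lemma isCont_pole_sum: "z \<notin> poles \<Longrightarrow> isCont (pole_sum a c) z"
  by (rule DERIV_isCont[OF has_field_derivative_pole_sum])

lemma holomorphic_pole_sum: "(pole_sum a c :: complex \<Rightarrow> complex) holomorphic_on - poles"
  using has_field_derivative_pole_sum
  by (intro holomorphic_onI) (auto simp: field_differentiable_def intro: DERIV_subset)

lemma pole_sum_0 [simp]: "pole_sum a c 0 = 0"
  by (simp add: pole_sum_def)

end

text \<open>
  Tannery's theorem in the form used below, with a dominating sequence that works for every index.
\<close>
lemma tannery:
  fixes a :: "nat \<Rightarrow> _ \<Rightarrow> 'a :: {real_normed_algebra, banach}"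
  assumes "\<And>k. ((\<lambda>n. a k n) \<longlongrightarrow> b k) F"
    and "eventually (\<lambda>n. \<forall>k. norm (a k n) \<le> M k) F"
    and "summable M" "F \<noteq> bot"
  shows "((\<lambda>n. \<Sum>k. a k n) \<longlongrightarrow> (\<Sum>k. b k)) F"
proof -
  have "eventually (\<lambda>(k, n). norm (a k n) \<le> M k) (at_top \<times>\<^sub>F F)"
    using eventually_prodI[OF eventually_True assms(2), of at_top]
    by (rule eventually_mono) auto
  thus ?thesis
    using tannerys_theorem[of a b F M] assms by blast
qed

section \<open>Zeros in the gaps between the poles\<close>

context pole_series
begin

text \<open>
  Between two points with no pole in between every summand increases, so the total increment
  is at least that of any single summand.
\<close>
lemma pole_sum_diff_ge:
  fixes x y :: real
  assumes xy: "x \<le> y" and gap: "\<And>m. a m > 0 \<Longrightarrow> - c m < x \<or> y < - c m"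
  shows "a j * (1 / (x + c j) - 1 / (y + c j)) \<le> pole_sum a c y - pole_sum a c x"
proof -
  have not_pole: "z \<notin> poles" if "x \<le> z" "z \<le> y" for z
  proof
    assume "z \<in> poles"
    then obtain m where "a m > 0" "z = - c m" by (auto simp: poles_def)
    thus False using gap[of m] that by auto
  qed
  have "x \<notin> poles" "y \<notin> poles" using not_pole[of x] not_pole[of y] xy by blast+
  note sm = summable_pole_sum(1)[OF this(1)] summable_pole_sum(1)[OF this(2)]
  define t where "t = (\<lambda>m. a m * (1 / (x + c m) - 1 / (y + c m)))"
  have t: "(\<lambda>m. a m * (1 / c m - 1 / (y + c m)) - a m * (1 / c m - 1 / (x + c m))) = t"
    by (auto simp: t_def algebra_simps)
  have "t m \<ge> 0" for m
  proof (cases "a m > 0")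
    case True
    have "1 / (y + c m) \<le> 1 / (x + c m)"
      using gap[OF True] xy by (auto intro: divide_left_mono simp: divide_simps mult_neg_neg)
    thus ?thesis using True by (simp add: t_def)
  qed (use a_nonneg[of m] in \<open>auto simp: t_def\<close>)
  moreover have "summable t"
    using summable_diff[OF sm(2) sm(1)] t by simp
  ultimately have "sum t {j} \<le> suminf t"
    by (intro sum_le_suminf) auto
  also have "suminf t = pole_sum a c y - pole_sum a c x"
    using suminf_diff[OF sm(2) sm(1)] t by (simp add: pole_sum_def)
  finally show ?thesis by (simp add: t_def)
qed

lemma pole_sum_less:
  fixes x y :: real
  assumes "x < y" and gap: "\<And>m. a m > 0 \<Longrightarrow> - c m < x \<or> y < - c m" and "a i > 0"
  shows "pole_sum a c x < pole_sum a c y"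
proof -
  have "1 / (y + c i) < 1 / (x + c i)"
    using gap[OF \<open>a i > 0\<close>] assms(1)
    by (auto intro: divide_strict_left_mono simp: divide_simps mult_neg_neg)
  hence "0 < a i * (1 / (x + c i) - 1 / (y + c i))"
    using \<open>a i > 0\<close> by simp
  also have "\<dots> \<le> pole_sum a c y - pole_sum a c x"
    using assms by (intro pole_sum_diff_ge) auto
  finally show ?thesis by simp
qed

lemma pole_sum_deriv_pos:
  assumes "(x :: real) \<notin> poles" "a i > 0"
  shows "pole_sum_deriv a c x > 0"
  unfolding pole_sum_deriv_def
proof (rule suminf_pos2[where i = i])
  show "0 < of_real (a i) / (x + of_real (c i))\<^sup>2"
    using assms not_pole[OF assms] by (simp add: zero_less_divide_iff)
qed (use summable_pole_sum(2)[OF assms(1)] a_nonneg in auto)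

lemma gap_interval:
  assumes "- c (Suc k) < x" "y < - c k"
  shows "- c m < x \<or> y < - c m"
proof (cases "m \<le> k")
  case True
  hence "c m \<le> c k" using c_strict_mono by (simp add: strict_mono_less_eq)
  thus ?thesis using assms by auto
next
  case False
  hence "c (Suc k) \<le> c m" using c_strict_mono by (simp add: strict_mono_less_eq)
  thus ?thesis using assms by auto
qed

lemma gap_not_pole:
  assumes "- c (Suc k) < x" "x < - c k"
  shows "x \<notin> poles"
  using gap_interval[OF assms] by (force simp: poles_def)

text \<open>
  The \<open>k\<close>-th summand tends to \<open>\<infinity>\<close> at the right end of the gap and the next one to \<open>-\<infinity>\<close>
  at the left end; by \<open>pole_sum_diff_ge\<close> either of them alone forces the sign of the whole sum
  there. The intermediate value theorem gives a zero and strict monotonicity makes it unique.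
\<close>
lemma pole_sum_gap_zero:
  assumes k: "a k > 0" "a (Suc k) > 0"
  shows "\<exists>!x. - c (Suc k) < x \<and> x < - c k \<and> pole_sum a c x = 0"
proof -
  let ?f = "pole_sum a c :: real \<Rightarrow> real"
  have cc: "c k < c (Suc k)" using c_strict_mono by (simp add: strict_mono_less)
  define x0 where "x0 = - (c k + c (Suc k)) / 2"
  define l where "l = x0 + c (Suc k)"
  define u where "u = - (x0 + c k)"
  have lu: "l > 0" "u > 0" using cc by (auto simp: l_def u_def x0_def field_simps)
  \<comment> \<open>\<open>S\<close> and \<open>T\<close> are the values of \<open>\<bar>1 / (z + c j)\<bar>\<close> at which the increment of a single summand
      from the midpoint on amounts to \<open>\<bar>f x0\<bar> + 1\<close>.\<close>
  define S where "S = 1 / l + (\<bar>?f x0\<bar> + 1) / a (Suc k)"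
  define T where "T = 1 / u + (\<bar>?f x0\<bar> + 1) / a k"
  have "S > 1 / l" "T > 1 / u" using k by (auto simp: S_def T_def)
  moreover have "1 / l > 0" "1 / u > 0" using lu by auto
  ultimately have ST0: "S > 0" "T > 0" "1 / l < S" "1 / u < T" by linarith+
  hence ST: "S > 0" "T > 0" "1 / S < l" "1 / T < u"
    using lu by (auto simp: field_simps)
  define x where "x = - c (Suc k) + 1 / S"
  define y where "y = - c k - 1 / T"
  have x: "- c (Suc k) < x" "x < x0" using ST by (auto simp: x_def l_def)
  have y: "y < - c k" "x0 < y" using ST by (auto simp: y_def u_def)
  have "a (Suc k) * (1 / (x + c (Suc k)) - 1 / (x0 + c (Suc k))) \<le> ?f x0 - ?f x"
    using x y by (intro pole_sum_diff_ge gap_interval[of k]) auto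
  also have "1 / (x + c (Suc k)) - 1 / (x0 + c (Suc k)) = (\<bar>?f x0\<bar> + 1) / a (Suc k)"
    by (simp add: x_def S_def l_def)
  finally have fx: "?f x < 0" using k by simp
  have "a k * (1 / (x0 + c k) - 1 / (y + c k)) \<le> ?f y - ?f x0"
    using x y by (intro pole_sum_diff_ge gap_interval[of k]) auto
  also have "1 / (x0 + c k) - 1 / (y + c k) = (\<bar>?f x0\<bar> + 1) / a k"
  proof -
    have "x0 + c k = - u" "y + c k = - (1 / T)" by (simp_all add: u_def y_def)
    thus ?thesis by (simp add: T_def)
  qed
  finally have fy: "?f y > 0" using k by simp
  have "\<exists>z\<ge>x. z \<le> y \<and> ?f z = 0"
  proof (intro IVT allI impI)
    show "isCont ?f z" if "x \<le> z \<and> z \<le> y" for z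
      using that x y by (intro isCont_pole_sum gap_not_pole[of k]) auto
  qed (use fx fy x y in auto)
  then obtain z where z: "x \<le> z" "z \<le> y" "?f z = 0" by blast
  hence "- c (Suc k) < z" "z < - c k" "?f z = 0" using x y by auto
  moreover have "z1 = z2"
    if "- c (Suc k) < z1" "z1 < - c k" "?f z1 = 0" "- c (Suc k) < z2" "z2 < - c k" "?f z2 = 0" for z1 z2
    using pole_sum_less[of z1 z2 k] pole_sum_less[of z2 z1 k] gap_interval[of k] that k
    by (metis linorder_neqE_linordered_idom order_less_irrefl)
  ultimately show ?thesis by blast
qed

end

text \<open>
  Zeros in decreasing order: index \<open>0\<close> is the zero at the origin, and index \<open>k + 1\<close> belongs to the
  gap between \<open>-c\<^sub>k\<^sub>+\<^sub>1\<close> and \<open>-c\<^sub>k\<close>.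
\<close>
definition pole_sum_zero :: "(nat \<Rightarrow> real) \<Rightarrow> (nat \<Rightarrow> real) \<Rightarrow> nat \<Rightarrow> real" where
  "pole_sum_zero a c k = (case k of 0 \<Rightarrow> 0 | Suc j \<Rightarrow>
     (THE x. - c (Suc j) < x \<and> x < - c j \<and> pole_sum a c x = 0))"

lemma pole_sum_zero_0 [simp]: "pole_sum_zero a c 0 = 0"
  by (simp add: pole_sum_zero_def)

lemma (in pole_series) pole_sum_zero_gap:
  assumes "a k > 0" "a (Suc k) > 0"
  shows "- c (Suc k) < pole_sum_zero a c (Suc k)" "pole_sum_zero a c (Suc k) < - c k"
    and "pole_sum a c (pole_sum_zero a c (Suc k)) = 0"
  using theI'[OF pole_sum_gap_zero[OF assms]] by (auto simp: pole_sum_zero_def)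

locale positive_pole_series = pole_series +
  assumes a_pos: "a m > 0"
begin

abbreviation F :: "'b :: {real_normed_field, banach} \<Rightarrow> 'b" where "F \<equiv> pole_sum a c"
abbreviation F' :: "'b :: {real_normed_field, banach} \<Rightarrow> 'b" where "F' \<equiv> pole_sum_deriv a c"
abbreviation s :: "nat \<Rightarrow> real" where "s \<equiv> pole_sum_zero a c"

lemma poles_eq: "poles = range (\<lambda>m. - of_real (c m))"
  using a_pos by (auto simp: poles_def)

lemma s_gap: "- c (Suc k) < s (Suc k)" "s (Suc k) < - c k"
  using pole_sum_zero_gap a_pos by auto

lemma s_upper: "s (Suc k) < - c k" and s_lower: "- c k < s k"
proof -
  show "s (Suc k) < - c k" by (rule s_gap)
  show "- c k < s k" using s_gap c_pos[of 0] by (cases k) auto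
qed

lemma s_decreasing: "s (Suc k) < s k"
  using s_upper[of k] s_lower[of k] by linarith

lemma s_neg: "s (Suc k) < 0"
  using s_upper[of k] c_pos[of k] by linarith

lemma s_nonpos: "s k \<le> 0"
  using s_neg by (cases k) (auto intro: less_imp_le)

lemma s_not_pole: "s k \<notin> poles"
proof (cases k)
  case 0
  thus ?thesis using nonneg_not_pole[of 0] by simp
next
  case (Suc j)
  thus ?thesis using gap_not_pole[OF s_gap, of j] by simp
qed

lemma F_s: "F (s k) = 0"
  using pole_sum_zero_gap(3) a_pos by (cases k) auto

lemma F'_s_pos: "F' (s k) > 0"
  using pole_sum_deriv_pos[OF s_not_pole a_pos] .

lemma F_pos: "x > 0 \<Longrightarrow> F (x :: real) > 0"
  using pole_sum_less[of 0 x 0] a_pos c_pos by simp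

text \<open>
  The imaginary part of every summand has the sign of \<open>Im z\<close>.
\<close>
lemma F_zero_real:
  assumes "z \<notin> poles" "F z = 0"
  shows "Im z = 0"
proof (rule ccontr)
  assume Im: "Im z \<noteq> 0"
  define t where "t = (\<lambda>m. of_real (a m) * (1 / of_real (c m) - 1 / (z + of_real (c m))))"
  have t: "Im z * Im (t m) = a m * (Im z)\<^sup>2 / (cmod (z + of_real (c m)))\<^sup>2" for m
    unfolding t_def cmod_power2
    by (simp add: Im_divide power2_eq_square)
  have sm: "summable t"
    using summable_pole_sum(1)[OF assms(1)] by (simp add: t_def)
  \<comment> \<open>The factor \<open>Im z\<close> covers both half-planes at once.\<close>
  have "0 < (\<Sum>m. Im z * Im (t m))"
  proof (rule suminf_pos2[where i = 0])
    show "summable (\<lambda>m. Im z * Im (t m))"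
      by (intro summable_mult summable_Im sm)
    show "0 < Im z * Im (t 0)"
      using Im a_pos[of 0] not_pole[OF assms(1) a_pos, of 0] by (simp add: t)
  qed (auto simp: t a_nonneg)
  also have "\<dots> = Im z * (\<Sum>m. Im (t m))"
    by (rule suminf_mult[OF summable_Im[OF sm]])
  also have "(\<Sum>m. Im (t m)) = Im (F z)"
    unfolding bounded_linear.suminf[OF bounded_linear_Im sm, symmetric]
    by (simp add: pole_sum_def t_def)
  finally show False using assms(2) by simp
qed

lemma exists_gap:
  assumes "x \<notin> poles" "x < - c 0"
  obtains k where "- c (Suc k) < x" "x < - c k"
proof -
  obtain n where "- x < c n"
    using c_at_top unfolding filterlim_at_top_dense eventually_sequentially by (metis order_refl)
  define k where "k = (LEAST n. - x < c n)"
  have k: "- x < c k" unfolding k_def using \<open>- x < c n\<close> by (rule LeastI)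
  have "k \<noteq> 0" using k assms(2) by (metis minus_less_iff not_less_iff_gr_or_eq)
  then obtain j where j: "k = Suc j" by (cases k) auto
  have "\<not> - x < c j" using not_less_Least[of j "\<lambda>n. - x < c n"] j unfolding k_def by auto
  moreover have "x \<noteq> - c j" using assms(1) by (auto simp: poles_eq)
  ultimately show ?thesis using that[of j] k j by auto
qed

lemma F_eq_0_iff:
  assumes "z \<notin> poles"
  shows "F z = 0 \<longleftrightarrow> z \<in> range (\<lambda>k. complex_of_real (s k))"
proof
  assume zero: "F z = 0"
  define x where "x = Re z"
  have z: "z = of_real x"
    using F_zero_real[OF assms zero] by (simp add: x_def complex_eq_iff)
  have x: "x \<notin> poles" "F x = 0"
    using assms zero pole_sum_of_real(1)[of x, where 'b = complex] unfolding z by auto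
  have "x \<in> range s"
  proof (cases "x > - c 0")
    case True
    have "- c m < x \<and> - c m < 0" for m
      using True c_pos[of m] c_strict_mono strict_mono_less_eq[of c 0 m] by auto
    hence "x = 0"
      using pole_sum_less[of x 0 0] pole_sum_less[of 0 x 0] x a_pos
      by (metis linorder_neqE_linordered_idom order_less_irrefl pole_sum_0)
    thus ?thesis by (metis pole_sum_zero_0 rangeI)
  next
    case False
    hence "x < - c 0" using x by (auto simp: poles_eq not_less le_less)
    then obtain k where "- c (Suc k) < x" "x < - c k"
      using exists_gap[OF x(1)] by blast
    hence "x = s (Suc k)"
      using pole_sum_gap_zero[OF a_pos a_pos, of k] s_gap F_s x by blast
    thus ?thesis by blast
  qed
  thus "z \<in> range (\<lambda>k. complex_of_real (s k))" using z by auto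
next
  assume "z \<in> range (\<lambda>k. complex_of_real (s k))"
  thus "F z = 0" using pole_sum_of_real(1)[OF s_not_pole, where 'b = complex] F_s by auto
qed

section \<open>Truncation of the series\<close>

definition trunc :: "nat \<Rightarrow> nat \<Rightarrow> real" where
  "trunc N m = (if m < N then a m else 0)"

lemma trunc_pole_series: "pole_series (trunc N) c"
proof
  show "summable (\<lambda>m. trunc N m / (c m)\<^sup>2)"
    by (rule summable_comparison_test'[OF summable_a_c2, of 0])
       (auto simp: trunc_def a_nonneg)
qed (use a_nonneg c_pos c_strict_mono c_at_top in \<open>auto simp: trunc_def\<close>)

lemma pole_sum_trunc:
  "pole_sum (trunc N) c z = (\<Sum>m<N. of_real (a m) * (1 / of_real (c m) - 1 / (z + of_real (c m))))"
  "pole_sum_deriv (trunc N) c z = (\<Sum>m<N. of_real (a m) / (z + of_real (c m))^2)"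
  unfolding pole_sum_def pole_sum_deriv_def
  by (subst suminf_finite[of "{..<N}"]; auto simp: trunc_def)+

lemma trunc_LIMSEQ:
  assumes "z \<notin> poles"
  shows "(\<lambda>N. pole_sum (trunc N) c z) \<longlonglongrightarrow> F z"
  unfolding pole_sum_trunc unfolding pole_sum_def
  by (rule summable_LIMSEQ[OF summable_pole_sum(1)[OF assms]])

abbreviation s_trunc :: "nat \<Rightarrow> nat \<Rightarrow> real" where
  "s_trunc N \<equiv> pole_sum_zero (trunc N) c"

lemma s_trunc_gap:
  assumes "Suc k < N"
  shows "- c (Suc k) < s_trunc N (Suc k)" "s_trunc N (Suc k) < - c k"
    and "pole_sum (trunc N) c (s_trunc N (Suc k)) = 0"
  using pole_series.pole_sum_zero_gap[OF trunc_pole_series, of N k] a_pos assms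
  by (auto simp: trunc_def)

lemma s_trunc_zero:
  assumes "k < N"
  shows "pole_sum (trunc N) c (s_trunc N k) = 0"
  using s_trunc_gap(3) assms pole_series.pole_sum_0[OF trunc_pole_series] by (cases k) auto

text \<open>
  A zero of an increasing function is pinned between two points where the signs differ, and
  these signs survive pointwise approximation by the truncated sums.
\<close>
lemma s_trunc_tendsto: "(\<lambda>N. s_trunc N k) \<longlonglongrightarrow> s k"
proof (cases k)
  case (Suc j)
  let ?f = "\<lambda>N. pole_sum (trunc N) c :: real \<Rightarrow> real"
  have mono: "?f N x < ?f N y" if "- c (Suc j) < x" "x < y" "y < - c j" "Suc j < N" for N x y
    using that gap_interval[of j x y] a_pos[of j]
    by (intro pole_series.pole_sum_less[OF trunc_pole_series, where i = j]) (auto simp: trunc_def)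
  have mono': "F x < F y" if "- c (Suc j) < x" "x < y" "y < - c j" for x y :: real
    using that gap_interval[of j x y] a_pos by (intro pole_sum_less[where i = j]) auto
  show ?thesis unfolding Suc
  proof (rule order_tendstoI)
    fix u assume u: "u < s (Suc j)"
    define x where "x = max u ((- c (Suc j) + s (Suc j)) / 2)"
    have x: "- c (Suc j) < x" "x < s (Suc j)" "x < - c j" "u \<le> x"
      using s_gap[of j] u by (auto simp: x_def less_max_iff_disj)
    have "F x < 0" using mono'[of x "s (Suc j)"] x s_gap[of j] F_s by simp
    hence "eventually (\<lambda>N. ?f N x < 0) sequentially"
      using order_tendstoD(2)[OF trunc_LIMSEQ[OF gap_not_pole[OF x(1,3)]]] by blast
    moreover have "eventually (\<lambda>N. Suc j < N) sequentially"
      by (rule eventually_gt_at_top)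
    ultimately show "eventually (\<lambda>N. u < s_trunc N (Suc j)) sequentially"
    proof eventually_elim
      case (elim N)
      show ?case
      proof (rule ccontr)
        assume "\<not> u < s_trunc N (Suc j)"
        hence "s_trunc N (Suc j) < x \<or> s_trunc N (Suc j) = x" using x by auto
        thus False
          using mono[of "s_trunc N (Suc j)" x N] s_trunc_gap[OF elim(2)] x elim by auto
      qed
    qed
  next
    fix u assume u: "s (Suc j) < u"
    define x where "x = min u ((- c j + s (Suc j)) / 2)"
    have x: "x < - c j" "s (Suc j) < x" "- c (Suc j) < x" "x \<le> u"
      using s_gap[of j] u by (auto simp: x_def min_less_iff_disj)
    have "F x > 0" using mono'[of "s (Suc j)" x] x s_gap[of j] F_s by simp
    hence "eventually (\<lambda>N. ?f N x > 0) sequentially"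
      using order_tendstoD(1)[OF trunc_LIMSEQ[OF gap_not_pole[OF x(3,1)]]] by blast
    moreover have "eventually (\<lambda>N. Suc j < N) sequentially"
      by (rule eventually_gt_at_top)
    ultimately show "eventually (\<lambda>N. s_trunc N (Suc j) < u) sequentially"
    proof eventually_elim
      case (elim N)
      show ?case
      proof (rule ccontr)
        assume "\<not> s_trunc N (Suc j) < u"
        hence "x < s_trunc N (Suc j) \<or> s_trunc N (Suc j) = x" using x by auto
        thus False
          using mono[of x "s_trunc N (Suc j)" N] s_trunc_gap[OF elim(2)] x elim by auto
      qed
    qed
  qed
qed simp

text \<open>
  Series and evaluation point vary together here; \<open>pole_separation\<close> at the limit point dominates all
  the terms at once.
\<close>
lemma deriv_trunc_tendsto:
  "(\<lambda>N. pole_sum_deriv (trunc N) c (s_trunc N k)) \<longlonglongrightarrow> F' (s k)"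
proof -
  obtain r C where rC: "r > 0"
      "\<And>w m. dist w (s k) \<le> r \<Longrightarrow> a m > 0 \<Longrightarrow> c m \<le> C * norm (w + of_real (c m))"
    using pole_separation[OF s_not_pole[of k]] by metis
  have "eventually (\<lambda>N. dist (s_trunc N k) (s k) < r) sequentially"
    using s_trunc_tendsto[of k] rC(1) by (auto simp: tendsto_iff)
  hence bound: "eventually (\<lambda>N. \<forall>m. norm (trunc N m / (s_trunc N k + c m)^2) \<le> C\<^sup>2 * (a m / (c m)\<^sup>2)) sequentially"
  proof eventually_elim
    case (elim N)
    show ?case
    proof
      fix m
      have "norm (trunc N m / (s_trunc N k + c m)^2) \<le> norm (of_real (a m) / (s_trunc N k + of_real (c m))^2)"
        by (auto simp: trunc_def)
      also have "\<dots> \<le> C\<^sup>2 * (a m / (c m)\<^sup>2)"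
        using rC(2)[of "s_trunc N k" m] elim by (intro term_bound) auto
      finally show "norm (trunc N m / (s_trunc N k + c m)^2) \<le> C\<^sup>2 * (a m / (c m)\<^sup>2)" .
    qed
  qed
  have "(\<lambda>N. trunc N m / (s_trunc N k + c m)^2) \<longlonglongrightarrow> a m / (s k + c m)^2" for m
  proof (intro tendsto_intros s_trunc_tendsto)
    show "(\<lambda>N. trunc N m) \<longlonglongrightarrow> a m"
      by (rule tendsto_eventually, rule eventually_mono[OF eventually_gt_at_top[of m]])
         (auto simp: trunc_def)
    show "(s k + c m)\<^sup>2 \<noteq> 0"
      using not_pole[OF s_not_pole a_pos, of k m] by simp
  qed
  from tannery[OF this bound summable_mult[OF summable_a_c2]]
  show ?thesis by (simp add: pole_sum_deriv_def)
qed


lemma s_trunc_nonpos: "k < N \<Longrightarrow> s_trunc N k \<le> 0"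
  using s_trunc_gap(2)[of "k - 1" N] c_pos[of "k - 1"] by (cases k) auto

lemma s_trunc_not_pole:
  assumes "k < N"
  shows "s_trunc N k \<noteq> - c m"
proof (cases k)
  case 0
  thus ?thesis using c_pos[of m] by simp
next
  case (Suc j)
  thus ?thesis using s_trunc_gap(1,2)[of j N] gap_interval[of j "s_trunc N k" "s_trunc N k" m] assms by auto
qed

lemma s_trunc_inj: "inj_on (s_trunc N) {..<N}"
proof -
  have less: "s_trunc N j < s_trunc N i" if ij: "i < j" "j < N" for i j
  proof -
    obtain l where j: "j = Suc l" using ij by (cases j) auto
    have "s_trunc N j < - c l" using s_trunc_gap[of l N] ij j by simp
    also have "- c l \<le> - c i" using ij j c_strict_mono by (simp add: strict_mono_less_eq)
    also have "- c i \<le> s_trunc N i"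
    proof (cases i)
      case (Suc h)
      thus ?thesis using s_trunc_gap(1)[of h N] ij by simp
    qed (use c_pos[of 0] in auto)
    finally show ?thesis .
  qed
  show ?thesis
    by (rule inj_onI) (metis less lessThan_iff linorder_neqE_nat order_less_irrefl)
qed

abbreviation r_trunc :: "nat \<Rightarrow> nat \<Rightarrow> real" where
  "r_trunc N k \<equiv> 1 / pole_sum_deriv (trunc N) c (s_trunc N k)"

abbreviation r :: "nat \<Rightarrow> real" where
  "r k \<equiv> 1 / F' (s k)"

lemma r_pos: "r k > 0"
  using F'_s_pos by simp

lemma r_trunc_pos:
  assumes "k < N"
  shows "r_trunc N k > 0"
proof -
  have "s_trunc N k \<notin> pole_series.poles (trunc N) c"
    using s_trunc_not_pole[OF assms] by (auto simp: pole_series.poles_def[OF trunc_pole_series])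
  thus ?thesis
    using pole_series.pole_sum_deriv_pos[OF trunc_pole_series, of "s_trunc N k" N 0] a_pos assms
    by (auto simp: trunc_def)
qed

lemma r_trunc_tendsto: "(\<lambda>N. r_trunc N k) \<longlonglongrightarrow> r k"
  using F'_s_pos[of k] by (intro tendsto_divide tendsto_const deriv_trunc_tendsto) auto

lemma reciprocal_trunc:
  assumes "N > 0" "Re z > 0"
  shows "1 / pole_sum (trunc N) c z =
           1 / of_real (\<Sum>m<N. a m / c m) + (\<Sum>k<N. of_real (r_trunc N k) / (z - of_real (s_trunc N k)))"
proof -
  have W: "(\<Sum>m<N. a m / c m) > 0"
    using assms a_pos c_pos by (intro sum_pos) auto
  have not_pole: "s_trunc N k \<notin> pole_series.poles (trunc N) c" if "k < N" for k
    using s_trunc_not_pole[OF that] by (auto simp: pole_series.poles_def[OF trunc_pole_series])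
  note ofr = pole_series.pole_sum_of_real[OF trunc_pole_series not_pole, where 'b = complex]
  have "pole_sum (trunc N) c z * (1 / of_real (\<Sum>m<N. a m / c m) +
          (\<Sum>k<N. 1 / pole_sum_deriv (trunc N) c (of_real (s_trunc N k)) / (z - of_real (s_trunc N k)))) = 1"
    unfolding pole_sum_trunc
  proof (rule partial_fraction_reciprocal)
    show "inj_on (\<lambda>k. complex_of_real (s_trunc N k)) {..<N}"
      using s_trunc_inj[of N] by (auto simp: inj_on_def)
    show "complex_of_real (c m) \<noteq> 0" for m using c_pos[of m] by simp
    show "complex_of_real (s_trunc N k) + of_real (c m) \<noteq> 0" if "k < N" "m < N" for k m
      using s_trunc_not_pole[OF that(1), of m] by (metis eq_neg_iff_add_eq_0 of_real_add of_real_eq_0_iff)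
    show "(\<Sum>m<N. complex_of_real (a m) * (1 / of_real (c m) - 1 / (of_real (s_trunc N k) + of_real (c m)))) = 0"
      if "k < N" for k
    proof -
      have "pole_sum (trunc N) c (complex_of_real (s_trunc N k)) = 0"
        using ofr(1)[OF that] s_trunc_zero[OF that] by simp
      thus ?thesis unfolding pole_sum_trunc .
    qed
    show "(\<Sum>m<N. complex_of_real (a m) / (complex_of_real (s_trunc N k) + complex_of_real (c m))\<^sup>2) \<noteq> 0"
      if "k < N" for k
    proof -
      have "pole_sum_deriv (trunc N) c (complex_of_real (s_trunc N k)) \<noteq> 0"
        using ofr(2)[OF that] r_trunc_pos[OF that] by simp
      thus ?thesis by (simp add: pole_sum_trunc)
    qed
    show "complex_of_real (\<Sum>m<N. a m / c m) = (\<Sum>m<N. of_real (a m) / of_real (c m))"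
      by simp
    show "complex_of_real (\<Sum>m<N. a m / c m) \<noteq> 0"
      using W by (simp only: of_real_eq_0_iff)
    show "z + of_real (c m) \<noteq> 0" for m
      using assms c_pos[of m] by (auto simp: complex_eq_iff)
    show "z \<noteq> of_real (s_trunc N k)" if "k < N" for k
      using assms s_trunc_nonpos[OF that] by auto
  qed simp
  also have "(\<Sum>k<N. 1 / pole_sum_deriv (trunc N) c (of_real (s_trunc N k)) / (z - of_real (s_trunc N k))) =
             (\<Sum>k<N. of_real (r_trunc N k) / (z - of_real (s_trunc N k)))"
    using ofr(2) by (intro sum.cong) auto
  finally show ?thesis
    using inverse_unique by (simp only: inverse_eq_divide)
qed

lemma reciprocal_trunc_real:
  assumes "N > 0" "x > 0"
  shows "1 / pole_sum (trunc N) c x =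
           1 / (\<Sum>m<N. a m / c m) + (\<Sum>k<N. r_trunc N k / (x - s_trunc N k))"
proof -
  have "x \<notin> pole_series.poles (trunc N) c"
    using pole_series.nonneg_not_pole[OF trunc_pole_series] assms by simp
  hence "complex_of_real (1 / pole_sum (trunc N) c x) = 1 / pole_sum (trunc N) c (of_real x)"
    using pole_series.pole_sum_of_real(1)[OF trunc_pole_series, where 'b = complex] by simp
  also have "\<dots> = of_real (1 / (\<Sum>m<N. a m / c m) + (\<Sum>k<N. r_trunc N k / (x - s_trunc N k)))"
    using reciprocal_trunc[of N "of_real x"] assms by simp
  finally show ?thesis by (simp only: of_real_eq_iff)
qed

text \<open>
  All terms of the partial fraction decomposition are positive to the right of the poles of the
  reciprocal, so a value of the reciprocal bounds the residues uniformly in \<open>N\<close>.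
\<close>
lemma sum_trunc_le:
  assumes "N > 0" "x > 0" "K \<subseteq> {..<N}"
  shows "(\<Sum>k\<in>K. r_trunc N k / (x - s_trunc N k)) \<le> 1 / pole_sum (trunc N) c x"
proof -
  have nonneg: "0 \<le> r_trunc N k / (x - s_trunc N k)" if "k < N" for k
    using r_trunc_pos[OF that] s_trunc_nonpos[OF that] assms(2)
    by (intro divide_nonneg_nonneg) (auto intro: less_imp_le)
  have "(\<Sum>k\<in>K. r_trunc N k / (x - s_trunc N k)) \<le> (\<Sum>k<N. r_trunc N k / (x - s_trunc N k))"
    using assms nonneg by (intro sum_mono2) auto
  also have "\<dots> \<le> 1 / pole_sum (trunc N) c x"
    using reciprocal_trunc_real[OF assms(1,2)] a_pos c_pos by (simp add: sum_nonneg less_imp_le)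
  finally show ?thesis .
qed

lemma summable_residues:
  assumes "x > 0"
  shows "summable (\<lambda>k. r k / (x - s k))"
proof (rule summableI_nonneg_bounded)
  show "0 \<le> r k / (x - s k)" for k
    using r_pos[of k] s_nonpos[of k] assms by (intro divide_nonneg_nonneg) (auto intro: less_imp_le)
  show "(\<Sum>k<K. r k / (x - s k)) \<le> 1 / F x" for K
  proof (rule LIMSEQ_le)
    show "(\<lambda>N. \<Sum>k<K. r_trunc N k / (x - s_trunc N k)) \<longlonglongrightarrow> (\<Sum>k<K. r k / (x - s k))"
      using s_nonpos assms
      by (intro tendsto_sum tendsto_divide r_trunc_tendsto tendsto_diff tendsto_const s_trunc_tendsto)
         (smt (verit, best))
    show "(\<lambda>N. 1 / pole_sum (trunc N) c x) \<longlonglongrightarrow> 1 / F x"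
      using F_pos[OF assms] nonneg_not_pole[of x] assms
      by (intro tendsto_divide tendsto_const trunc_LIMSEQ) auto
    show "\<exists>N. \<forall>n\<ge>N. (\<Sum>k<K. r_trunc n k / (x - s_trunc n k)) \<le> 1 / pole_sum (trunc n) c x"
      using sum_trunc_le[OF _ assms] by (intro exI[of _ "Suc K"]) auto
  qed
qed

lemma F_nonzero:
  assumes "Re z > 0"
  shows "F z \<noteq> 0"
proof
  assume "F z = 0"
  then obtain k where "z = of_real (s k)"
    using F_eq_0_iff[OF Re_nonneg_not_pole, of z] assms by auto
  thus False using assms s_nonpos[of k] by simp
qed

text \<open>
  In the difference of the values at \<open>z\<close> and \<open>y\<close> the \<open>k\<close>-th fraction becomes
  \<open>r\<^sub>k (y - z) / ((z - s\<^sub>k) (y - s\<^sub>k))\<close>. For \<open>k > K\<close> the factor \<open>1 / (y - s\<^sub>k)\<close> is at most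
  \<open>1 / (y + c\<^sub>K)\<close>, and what remains is summed by \<open>sum_trunc_le\<close> at \<open>Re z\<close>. The
  bound is proved for the truncations and inherited in the limit.
\<close>
lemma reciprocal_difference_bound:
  assumes "Re z > 0" "y > 0"
  shows "cmod (1 / F z - 1 / F (of_real y) -
            (\<Sum>k\<le>K. of_real (r k) * (1 / (z - of_real (s k)) - 1 / (of_real y - of_real (s k)))))
         \<le> cmod (of_real y - z) / (y + c K) * (1 / F (Re z))"
proof -
  define G where "G = (\<lambda>N. pole_sum (trunc N) c :: complex \<Rightarrow> complex)"
  define h where "h = (\<lambda>\<rho> \<sigma>. of_real \<rho> * (1 / (z - of_real \<sigma>) - 1 / (of_real y - complex_of_real \<sigma>)))"
  define S where "S = (\<lambda>N. 1 / G N z - 1 / G N (of_real y) - (\<Sum>k\<le>K. h (r_trunc N k) (s_trunc N k)))"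
  define B where "B = cmod (of_real y - z) / (y + c K)"
  have B: "B \<ge> 0" using assms c_pos[of K] by (simp add: B_def)
  have bound: "cmod (S N) \<le> B * (1 / pole_sum (trunc N) c (Re z))" if N: "N > Suc K" for N
  proof -
    have "1 / G N z - 1 / G N (of_real y) = (\<Sum>k<N. h (r_trunc N k) (s_trunc N k))"
      using reciprocal_trunc[of N z] reciprocal_trunc[of N "of_real y"] assms N
      by (simp add: G_def h_def sum_subtractf right_diff_distrib)
    also have "{..<N} = {..K} \<union> {Suc K..<N}" using N by auto
    also have "(\<Sum>k\<in>\<dots>. h (r_trunc N k) (s_trunc N k)) =
        (\<Sum>k\<le>K. h (r_trunc N k) (s_trunc N k)) + (\<Sum>k\<in>{Suc K..<N}. h (r_trunc N k) (s_trunc N k))"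
      by (intro sum.union_disjoint) auto
    finally have "S N = (\<Sum>k\<in>{Suc K..<N}. h (r_trunc N k) (s_trunc N k))"
      by (simp add: S_def)
    hence "cmod (S N) \<le> (\<Sum>k\<in>{Suc K..<N}. cmod (h (r_trunc N k) (s_trunc N k)))"
      by (simp add: norm_sum)
    also have "\<dots> \<le> (\<Sum>k\<in>{Suc K..<N}. B * (r_trunc N k / (Re z - s_trunc N k)))"
    proof (rule sum_mono)
      fix k assume k: "k \<in> {Suc K..<N}"
      define \<rho> \<sigma> where "\<rho> = r_trunc N k" and "\<sigma> = s_trunc N k"
      have \<rho>: "\<rho> > 0" using r_trunc_pos[of k N] k by (simp add: \<rho>_def)
      obtain j where j: "k = Suc j" "K \<le> j" using k by (cases k) auto
      have "\<sigma> < - c j" using s_trunc_gap(2)[of j N] k j by (simp add: \<sigma>_def)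
      also have "\<dots> \<le> - c K" using j c_strict_mono by (simp add: strict_mono_less_eq)
      finally have \<sigma>: "\<sigma> < - c K" .
      have d: "0 < Re z - \<sigma>" "Re z - \<sigma> \<le> cmod (z - of_real \<sigma>)" "y + c K \<le> y - \<sigma>" "0 < y + c K"
        using \<sigma> assms c_pos[of K] complex_Re_le_cmod[of "z - of_real \<sigma>"] by auto
      hence nz: "z - of_real \<sigma> \<noteq> 0" "complex_of_real y - of_real \<sigma> \<noteq> 0"
        by (auto simp: complex_eq_iff)
      have "h \<rho> \<sigma> = of_real \<rho> * (of_real y - z) / ((z - of_real \<sigma>) * (of_real y - of_real \<sigma>))"
        using nz unfolding h_def by (simp add: divide_simps)
      also have "cmod \<dots> = \<rho> * cmod (of_real y - z) / (cmod (z - of_real \<sigma>) * (y - \<sigma>))"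
        using \<rho> d by (simp add: norm_divide norm_mult flip: of_real_diff)
      also have "\<dots> \<le> \<rho> * cmod (of_real y - z) / ((Re z - \<sigma>) * (y + c K))"
        using \<rho> d by (intro divide_left_mono mult_mono mult_pos_pos) auto
      also have "\<dots> = B * (\<rho> / (Re z - \<sigma>))" by (simp add: B_def mult.commute)
      finally show "cmod (h (r_trunc N k) (s_trunc N k)) \<le> B * (r_trunc N k / (Re z - s_trunc N k))"
        by (simp add: \<rho>_def \<sigma>_def)
    qed
    also have "\<dots> \<le> B * (1 / pole_sum (trunc N) c (Re z))"
      unfolding sum_distrib_left[symmetric]
      using N assms by (intro mult_left_mono[OF sum_trunc_le B]) auto
    finally show ?thesis .
  qed
  have s_neq: "z \<noteq> of_real (s k)" "complex_of_real y \<noteq> of_real (s k)" for k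
    using assms s_nonpos[of k] by (auto simp: complex_eq_iff)
  have not_pole: "z \<notin> poles" "complex_of_real y \<notin> poles" "Re z \<notin> poles"
    using assms Re_nonneg_not_pole[of z] nonneg_not_pole[of y] nonneg_not_pole[of "Re z"] by simp_all
  have "cmod (1 / F z - 1 / F (of_real y) - (\<Sum>k\<le>K. h (r k) (s k))) \<le> B * (1 / F (Re z))"
  proof (rule LIMSEQ_le)
    have lim: "(\<lambda>N. G N w) \<longlonglongrightarrow> F w" if "w \<notin> poles" for w
      unfolding G_def by (rule trunc_LIMSEQ[OF that])
    show "(\<lambda>N. cmod (S N)) \<longlonglongrightarrow> cmod (1 / F z - 1 / F (of_real y) - (\<Sum>k\<le>K. h (r k) (s k)))"
      unfolding S_def h_def
      using s_neq F_nonzero assms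
      by (intro tendsto_norm tendsto_diff tendsto_sum tendsto_mult tendsto_of_real tendsto_divide
            tendsto_const lim not_pole r_trunc_tendsto s_trunc_tendsto) auto
    show "(\<lambda>N. B * (1 / pole_sum (trunc N) c (Re z))) \<longlonglongrightarrow> B * (1 / F (Re z))"
      using F_pos[OF assms(1)] not_pole
      by (intro tendsto_mult tendsto_divide tendsto_const trunc_LIMSEQ) auto
    show "\<exists>N. \<forall>n\<ge>N. cmod (S n) \<le> B * (1 / pole_sum (trunc n) c (Re z))"
      using bound by (intro exI[of _ "Suc (Suc K)"]) auto
  qed
  thus ?thesis by (simp add: h_def B_def)
qed

lemma reciprocal_difference_sums:
  assumes "Re z > 0" "y > 0"
  shows "(\<lambda>k. of_real (r k) * (1 / (z - of_real (s k)) - 1 / (of_real y - of_real (s k)))) sums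
           (1 / F z - 1 / F (of_real y))"
proof -
  define t where "t = (\<lambda>k. of_real (r k) * (1 / (z - of_real (s k)) - 1 / (complex_of_real y - of_real (s k))))"
  have "(\<lambda>K. 1 / F z - 1 / F (of_real y) - (\<Sum>k\<le>K. t k)) \<longlonglongrightarrow> 0"
  proof (rule Lim_null_comparison)
    show "\<forall>\<^sub>F K in sequentially. cmod (1 / F z - 1 / F (of_real y) - (\<Sum>k\<le>K. t k)) \<le>
              cmod (of_real y - z) / (y + c K) * (1 / F (Re z))"
      using reciprocal_difference_bound[OF assms] by (simp add: t_def)
    have "filterlim (\<lambda>K. y + c K) at_top sequentially"
      by (intro filterlim_tendsto_add_at_top[OF tendsto_const] c_at_top)
    hence "(\<lambda>K. cmod (of_real y - z) / (y + c K)) \<longlonglongrightarrow> 0"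
      by (intro tendsto_divide_0[OF tendsto_const] filterlim_at_top_imp_at_infinity)
    thus "(\<lambda>K. cmod (of_real y - z) / (y + c K) * (1 / F (Re z))) \<longlonglongrightarrow> 0"
      by (rule tendsto_mult_left_zero)
  qed
  hence "(\<lambda>K. \<Sum>k\<le>K. t k) \<longlonglongrightarrow> 1 / F z - 1 / F (of_real y)"
    using tendsto_diff[OF tendsto_const[of "1 / F z - 1 / F (of_real y)"]] by fastforce
  thus ?thesis by (simp add: sums_def_le t_def)
qed

lemma summable_residues_complex:
  assumes "Re z > 0"
  shows "summable (\<lambda>k. of_real (r k) / (z - of_real (s k)))"
proof (rule summable_comparison_test'[OF summable_residues[OF assms]])
  fix k
  define \<rho> where "\<rho> = r k"
  have "0 < Re z - s k" "Re z - s k \<le> cmod (z - of_real (s k))"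
    using s_nonpos[of k] assms complex_Re_le_cmod[of "z - of_real (s k)"] by auto
  hence "cmod (of_real \<rho> / (z - of_real (s k))) \<le> \<rho> / (Re z - s k)"
    using r_pos[of k] unfolding \<rho>_def[symmetric]
    by (auto simp: norm_divide intro!: divide_left_mono mult_pos_pos)
  thus "cmod (of_real (r k) / (z - of_real (s k))) \<le> r k / (Re z - s k)"
    by (simp only: \<rho>_def)
qed

lemma norm_residue_term:
  assumes "y > 0"
  shows "cmod (of_real (r k) / (of_real y - of_real (s k))) = r k / (y - s k)"
proof -
  have "cmod (of_real \<rho> / (of_real y - of_real \<sigma>)) = \<rho> / (y - \<sigma>)" if "\<rho> > 0" "y > \<sigma>" for \<rho> \<sigma>
    using that by (simp add: norm_divide flip: of_real_diff)
  moreover have "s k < y" using s_nonpos[of k] assms by linarith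
  ultimately show ?thesis using r_pos by blast
qed

text \<open>
  By \<open>reciprocal_difference_sums\<close>, the difference between \<open>1 / F\<close> and the sum of fractions takes
  the same value at \<open>z\<close> and at every \<open>y > 0\<close>. As \<open>y \<rightarrow> \<infinity>\<close> the fractions disappear, dominated by
  their values at \<open>1\<close>.
\<close>
theorem reciprocal_partial_fraction:
  assumes lim: "(\<lambda>n. 1 / F (real (Suc n))) \<longlonglongrightarrow> \<eta>" and z: "Re z > 0"
  shows "1 / F z = of_real \<eta> + (\<Sum>k. of_real (r k) / (z - of_real (s k)))"
proof -
  define R where "R = (\<lambda>w. \<Sum>k. of_real (r k) / (w - complex_of_real (s k)))"
  have eq: "1 / F z - R z = of_real (1 / F (real (Suc n))) - R (of_real (real (Suc n)))" for n
  proof -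
    let ?y = "real (Suc n)"
    have "(\<lambda>k. of_real (r k) / (z - of_real (s k)) - of_real (r k) / (of_real ?y - of_real (s k))) sums
            (R z - R (of_real ?y))"
      unfolding R_def using z
      by (intro sums_diff summable_sums summable_residues_complex) auto
    moreover have "(\<lambda>k. of_real (r k) / (z - of_real (s k)) - of_real (r k) / (of_real ?y - of_real (s k))) sums
        (1 / F z - 1 / F (of_real ?y))"
      using reciprocal_difference_sums[OF z, of ?y] by (simp add: right_diff_distrib)
    ultimately have "R z - R (of_real ?y) = 1 / F z - 1 / F (of_real ?y)"
      by (rule sums_unique2)
    thus ?thesis
      using pole_sum_of_real(1)[OF nonneg_not_pole[of ?y], where 'b = complex]
      by (simp add: algebra_simps)
  qed
  have "(\<lambda>n. R (of_real (real (Suc n)))) \<longlonglongrightarrow> (\<Sum>k. 0)"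
    unfolding R_def
  proof (rule tannery)
    show "(\<lambda>n. of_real (r k) / (of_real (real (Suc n)) - complex_of_real (s k))) \<longlonglongrightarrow> 0" for k
    proof (rule tendsto_norm_zero_cancel, rule Lim_null_comparison)
      show "\<forall>\<^sub>F n in sequentially. norm (norm (of_real (r k) / (of_real (real (Suc n)) - complex_of_real (s k))))
              \<le> r k / real (Suc n)"
      proof (intro always_eventually allI)
        fix n
        have "norm (of_real (r k) / (of_real (real (Suc n)) - complex_of_real (s k))) = r k / (real (Suc n) - s k)"
          by (rule norm_residue_term) simp
        also have "\<dots> \<le> r k / real (Suc n)"
          using r_pos[of k] s_nonpos[of k] by (intro divide_left_mono mult_pos_pos) auto
        finally show "norm (norm (of_real (r k) / (of_real (real (Suc n)) - complex_of_real (s k)))) \<le> r k / real (Suc n)"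
          by simp
      qed
      show "(\<lambda>n. r k / real (Suc n)) \<longlonglongrightarrow> 0"
        using LIMSEQ_Suc[OF lim_const_over_n[of "r k"]] by simp
    qed
    show "\<forall>\<^sub>F n in sequentially. \<forall>k. norm (of_real (r k) / (of_real (real (Suc n)) - complex_of_real (s k))) \<le> r k / (1 - s k)"
    proof (intro always_eventually allI)
      fix n k
      have "norm (of_real (r k) / (of_real (real (Suc n)) - complex_of_real (s k))) = r k / (real (Suc n) - s k)"
        by (rule norm_residue_term) simp
      also have "\<dots> \<le> r k / (1 - s k)"
        using r_pos[of k] s_nonpos[of k] by (intro divide_left_mono mult_pos_pos) auto
      finally show "norm (of_real (r k) / (of_real (real (Suc n)) - complex_of_real (s k))) \<le> r k / (1 - s k)" .
    qed
    show "summable (\<lambda>k. r k / (1 - s k))" by (rule summable_residues) simp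
  qed auto
  hence "(\<lambda>n. of_real (1 / F (real (Suc n))) - R (of_real (real (Suc n)))) \<longlonglongrightarrow> of_real \<eta> - 0"
    by (intro tendsto_diff tendsto_of_real lim) simp
  hence "(\<lambda>n::nat. 1 / F z - R z) \<longlonglongrightarrow> of_real \<eta> - 0"
    using eq by (simp only: flip: eq)
  hence "1 / F z - R z = of_real \<eta>"
    using LIMSEQ_unique[OF tendsto_const] by fastforce
  thus ?thesis by (simp add: R_def algebra_simps)
qed

end

section \<open>Meromorphic continuation\<close>

text \<open>
  The identity theorem gives equality near every point, and the normalisation in
  \<open>nicely_meromorphic_on\<close> then determines the values at the exceptional points as well.
\<close>
lemma nicely_meromorphic_eqI:
  assumes f: "f nicely_meromorphic_on UNIV" and g: "g nicely_meromorphic_on UNIV"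
    and "open U" "U \<noteq> {}" and eq: "\<And>z. z \<in> U \<Longrightarrow> f z = g z"
  shows "f = g"
proof -
  define h where "h = remove_sings (\<lambda>z. f z - g z)"
  have mero: "(\<lambda>z. f z - g z) meromorphic_on UNIV"
    using f g by (auto intro!: meromorphic_intros simp: nicely_meromorphic_on_def)
  have h: "h nicely_meromorphic_on UNIV"
    unfolding h_def by (rule remove_sings_nicely_meromorphic[OF mero])
  obtain u where u: "u \<in> U" using assms by auto
  have "h w = 0" if "w \<in> U" for w
    unfolding h_def
  proof (rule remove_sings_eqI, rule tendsto_eventually)
    show "\<forall>\<^sub>F z in at w. f z - g z = 0"
      using eventually_at_in_open'[OF \<open>open U\<close> that] by eventually_elim (simp add: eq)
  qed
  hence "\<forall>\<^sub>F z in at u. h z = 0"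
    using eventually_at_in_open'[OF \<open>open U\<close> u] by (auto elim: eventually_mono)
  hence "\<exists>\<^sub>F z in at u. h z = 0"
    by (intro eventually_frequently) auto
  hence h0: "h w = 0" for w
    using frequently_eq_meromorphic_imp_constant[OF _ h, of 0 u] by auto
  have ev: "\<forall>\<^sub>F z in at w. f z = g z" for w
  proof -
    have "\<forall>\<^sub>F z in at w. (\<lambda>z. f z - g z) analytic_on {z}"
      using meromorphic_on_imp_analytic_cosparse[OF mero]
      by (auto simp: eventually_cosparse_open_eq)
    thus ?thesis
    proof eventually_elim
      case (elim z)
      thus ?case using h0[of z] by (simp add: h_def)
    qed
  qed
  show "f = g"
  proof
    fix w
    have "is_pole f w \<longleftrightarrow> is_pole g w"
      by (intro is_pole_cong ev refl)
    moreover have "f \<midarrow>w\<rightarrow> L \<longleftrightarrow> g \<midarrow>w\<rightarrow> L" for L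
      by (intro tendsto_cong ev)
    moreover have "(is_pole f w \<and> f w = 0) \<or> f \<midarrow>w\<rightarrow> f w" "(is_pole g w \<and> g w = 0) \<or> g \<midarrow>w\<rightarrow> g w"
      using f g by (auto simp: nicely_meromorphic_on_def)
    ultimately show "f w = g w"
      by (metis LIM_unique at_neq_bot is_pole_def not_tendsto_and_filterlim_at_infinity)
  qed
qed

text \<open>
  Write \<open>f z = z g z\<close>. Then the expression is the difference quotient of \<open>1 / g\<close> at \<open>0\<close>, and
  \<open>f'' 0 = 2 g' 0\<close>.
\<close>
lemma reciprocal_simple_zero_limit:
  fixes f :: "complex \<Rightarrow> complex"
  assumes f: "f holomorphic_on S" "open S" "0 \<in> S" "f 0 = 0" and d: "deriv f 0 \<noteq> 0"
  shows "((\<lambda>z. 1 / f z - 1 / (deriv f 0 * z)) \<longlongrightarrow> - ((deriv ^^ 2) f 0) / (2 * (deriv f 0)\<^sup>2)) (at 0)"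
proof -
  define g where "g = (\<lambda>z. if z = 0 then deriv f 0 else (f z - f 0) / (z - 0))"
  have g: "g holomorphic_on S"
    unfolding g_def using pole_lemma[OF f(1), of 0] f by (simp add: interior_open)
  have fg: "f z = z * g z" for z
    by (simp add: g_def f)
  have dg: "(g has_field_derivative deriv g z) (at z)" if "z \<in> S" for z
    using g f(2) that by (rule holomorphic_derivI)
  have df: "deriv f z = g z + z * deriv g z" if "z \<in> S" for z
  proof (rule DERIV_imp_deriv)
    have "((\<lambda>z. z * g z) has_field_derivative 1 * g z + deriv g z * z) (at z)"
      by (intro DERIV_mult DERIV_ident dg that)
    thus "(f has_field_derivative g z + z * deriv g z) (at z)"
      by (simp add: fg[abs_def, symmetric] mult.commute flip: fg)
  qed
  have ddg: "(deriv g has_field_derivative deriv (deriv g) 0) (at 0)"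
    by (rule holomorphic_derivI[OF holomorphic_deriv[OF g f(2)] f(2,3)])
  have "((\<lambda>z. g z + z * deriv g z) has_field_derivative deriv g 0 + (1 * deriv g 0 + deriv (deriv g) 0 * 0)) (at 0)"
    by (intro DERIV_add DERIV_mult DERIV_ident dg f ddg)
  hence "((\<lambda>z. g z + z * deriv g z) has_field_derivative 2 * deriv g 0) (at 0)"
    by simp
  moreover have "\<forall>\<^sub>F z in nhds 0. g z + z * deriv g z = deriv f z"
    using eventually_nhds_in_open[OF f(2,3)] by eventually_elim (simp add: df)
  ultimately have "(deriv f has_field_derivative 2 * deriv g 0) (at 0)"
    using DERIV_cong_ev[of 0 0 "\<lambda>z. g z + z * deriv g z" "deriv f" "2 * deriv g 0" "2 * deriv g 0"]
    by blast
  hence ddf: "(deriv ^^ 2) f 0 = 2 * deriv g 0"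
    by (simp add: numeral_2_eq_2 DERIV_imp_deriv)
  have g0: "g 0 = deriv f 0" by (simp add: g_def)
  have "((\<lambda>z. inverse (g z)) has_field_derivative - (deriv g 0 / (g 0)\<^sup>2)) (at 0)"
    using DERIV_inverse_fun[OF dg[OF f(3)]] g0 d
    by (simp add: power2_eq_square divide_inverse mult_ac)
  hence "((\<lambda>z. (inverse (g z) - inverse (g 0)) / z) \<longlongrightarrow> - (deriv g 0 / (g 0)\<^sup>2)) (at 0)"
    by (simp add: DERIV_def)
  moreover have "\<forall>\<^sub>F z in at 0. (inverse (g z) - inverse (g 0)) / z = 1 / f z - 1 / (deriv f 0 * z)"
  proof (intro always_eventually allI)
    fix z
    have "1 / f z = inverse (g z) / z" by (simp add: fg divide_inverse)
    moreover have "1 / (deriv f 0 * z) = inverse (g 0) / z" by (simp add: g0 divide_inverse)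
    ultimately show "(inverse (g z) - inverse (g 0)) / z = 1 / f z - 1 / (deriv f 0 * z)"
      by (simp add: diff_divide_distrib)
  qed
  ultimately have "((\<lambda>z. 1 / f z - 1 / (deriv f 0 * z)) \<longlongrightarrow> - (deriv g 0 / (g 0)\<^sup>2)) (at 0)"
    by (rule Lim_transform_eventually)
  thus ?thesis by (simp add: ddf g_def)
qed

context positive_pole_series
begin

text \<open>
  Setting the \<open>k\<close>-th weight to zero turns \<open>-c\<^sub>k\<close> into a regular point of the remaining series.
\<close>
lemma pole_neighbourhood:
  obtains U where "open U" "- of_real (c k) \<in> U" "\<And>z. z \<in> U \<Longrightarrow> z \<noteq> - of_real (c k) \<Longrightarrow> z \<notin> poles"
    and "pole_sum (a(k := 0)) c holomorphic_on U"
    and "\<And>z. z \<in> U \<Longrightarrow> z \<noteq> - of_real (c k) \<Longrightarrow>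
      F z = of_real (a k) * (1 / of_real (c k) - 1 / (z + of_real (c k))) + pole_sum (a(k := 0)) c z"
proof -
  interpret R: pole_series "a(k := 0)" c
  proof
    show "summable (\<lambda>m. (a(k := 0)) m / (c m)\<^sup>2)"
      by (rule summable_comparison_test'[OF summable_a_c2, of 0]) (auto simp: a_nonneg)
  qed (use a_nonneg c_pos c_strict_mono c_at_top in auto)
  define U where "U = (- R.poles :: complex set)"
  have c_inj: "c m = c n \<longleftrightarrow> m = n" for m n
    using c_strict_mono strict_mono_eq by blast
  have poles: "poles = insert (- of_real (c k)) (R.poles :: complex set)"
    using a_pos by (auto simp: poles_def R.poles_def c_inj)
  show ?thesis
  proof (rule that[of U])
    show "open U" unfolding U_def by (rule R.open_compl_poles)
    show "- of_real (c k) \<in> U" by (auto simp: U_def R.poles_def c_inj)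
    show "z \<notin> poles" if "z \<in> U" "z \<noteq> - of_real (c k)" for z
      using that poles by (auto simp: U_def)
    show "pole_sum (a(k := 0)) c holomorphic_on U"
      unfolding U_def by (rule R.holomorphic_pole_sum)
    fix z assume z: "z \<in> U" "z \<noteq> - of_real (c k)"
    let ?t = "\<lambda>b m. complex_of_real (b m) * (1 / of_real (c m) - 1 / (z + of_real (c m)))"
    have "?t (a(k := 0)) sums pole_sum (a(k := 0)) c z"
      unfolding pole_sum_def using R.summable_pole_sum(1)[of z] z by (simp add: U_def summable_sums)
    from sums_add[OF sums_single[of k "?t a"] this]
    have "(\<lambda>m. (if m = k then ?t a m else 0) + ?t (a(k := 0)) m) sums
            (?t a k + pole_sum (a(k := 0)) c z)" .
    moreover have "(\<lambda>m. (if m = k then ?t a m else 0) + ?t (a(k := 0)) m) = ?t a"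
      by auto
    ultimately have "?t a sums (?t a k + pole_sum (a(k := 0)) c z)" by simp
    thus "F z = ?t a k + pole_sum (a(k := 0)) c z"
      unfolding pole_sum_def by (simp add: sums_iff)
  qed
qed

lemma is_pole_F: "is_pole F (- complex_of_real (c k))"
proof -
  let ?p = "- complex_of_real (c k)"
  obtain U where U: "open U" "?p \<in> U" "pole_sum (a(k := 0)) c holomorphic_on U"
      "\<And>z. z \<in> U \<Longrightarrow> z \<noteq> ?p \<Longrightarrow>
        F z = of_real (a k) * (1 / of_real (c k) - 1 / (z + of_real (c k))) + pole_sum (a(k := 0)) c z"
    using pole_neighbourhood[of k] by metis
  have cont: "isCont (pole_sum (a(k := 0)) c) ?p"
    using U by (meson continuous_on_eq_continuous_at holomorphic_on_imp_continuous_on)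
  \<comment> \<open>the regular part of \<open>F\<close>\<close>
  define g where "g = (\<lambda>z. of_real (a k) / complex_of_real (c k) + pole_sum (a(k := 0)) c z)"
  have "is_pole (\<lambda>z. - of_real (a k) / (z + of_real (c k))) ?p"
  proof (rule is_pole_divide)
    show "filterlim (\<lambda>z. z + complex_of_real (c k)) (at 0) (at ?p)"
      unfolding filterlim_at
      by (auto intro!: tendsto_eq_intros simp: eventually_at_filter eq_neg_iff_add_eq_0)
  qed (use a_pos[of k] in auto)
  hence "filterlim (\<lambda>z. g z + - of_real (a k) / (z + of_real (c k))) at_infinity (at ?p)"
    unfolding is_pole_def
  proof (rule tendsto_add_filterlim_at_infinity[rotated])
    show "g \<midarrow>?p\<rightarrow> g ?p"
      unfolding g_def using cont by (intro tendsto_intros) (simp add: isCont_def)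
  qed
  moreover have "\<forall>\<^sub>F z in at ?p. g z + - of_real (a k) / (z + of_real (c k)) = F z"
    using eventually_at_in_open[OF U(1,2)]
    by eventually_elim (use U(4) in \<open>auto simp: g_def algebra_simps\<close>)
  ultimately show ?thesis
    unfolding is_pole_def by (simp cong: filterlim_cong)
qed

text \<open>
  The value \<open>0\<close> at the poles is the convention of \<open>nicely_meromorphic_on\<close>; the value of the
  series itself need not vanish there, since \<open>1 / 0 = 0\<close> only removes the singular fraction.
\<close>
definition F_ext :: "complex \<Rightarrow> complex" where
  "F_ext z = (if z \<in> poles then 0 else F z)"

lemma eventually_F_ext:
  "z \<notin> poles \<Longrightarrow> \<forall>\<^sub>F w in nhds z. F_ext w = F w"
  using eventually_nhds_in_open[OF open_compl_poles, of z]
  by (auto simp: F_ext_def elim!: eventually_mono)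

lemma F_ext_analytic: "F_ext analytic_on - poles"
proof -
  have "F_ext holomorphic_on - poles"
    by (rule holomorphic_transform[OF holomorphic_pole_sum]) (simp add: F_ext_def)
  thus ?thesis using analytic_on_open[OF open_compl_poles] by blast
qed

lemma is_pole_F_ext_iff: "is_pole F_ext z \<longleftrightarrow> z \<in> poles"
proof
  assume "is_pole F_ext z"
  thus "z \<in> poles"
    using F_ext_analytic analytic_at_imp_no_pole analytic_on_analytic_at by (metis ComplI)
next
  assume "z \<in> poles"
  then obtain k where z: "z = - of_real (c k)" by (auto simp: poles_eq)
  obtain U where U: "open U" "z \<in> U" "\<And>w. w \<in> U \<Longrightarrow> w \<noteq> z \<Longrightarrow> w \<notin> poles"
    using pole_neighbourhood[of k] unfolding z by metis
  have "\<forall>\<^sub>F w in at z. F w = F_ext w"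
    using eventually_at_in_open[OF U(1,2)]
    by eventually_elim (use U(3) in \<open>auto simp: F_ext_def\<close>)
  thus "is_pole F_ext z"
    using is_pole_F[of k] is_pole_cong[of F F_ext z z] unfolding z by simp
qed

lemma F_ext_nicely_meromorphic: "F_ext nicely_meromorphic_on UNIV"
proof (rule nicely_meromorphic_onI_open[where pts = poles])
  show "F_ext analytic_on UNIV - poles"
    using F_ext_analytic by (simp add: Compl_eq_Diff_UNIV)
  show "is_pole F_ext z \<and> F_ext z = 0" if "z \<in> poles" for z
    using that by (simp add: is_pole_F_ext_iff F_ext_def)
  show "isolated_singularity_at F_ext z" for z
  proof (cases "z \<in> poles")
    case False
    thus ?thesis
      using F_ext_analytic by (intro isolated_singularity_at_analytic) (auto elim: analytic_on_subset)
  next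
    case True
    then obtain k where z: "z = - of_real (c k)" by (auto simp: poles_eq)
    obtain U where U: "open U" "z \<in> U" "\<And>w. w \<in> U \<Longrightarrow> w \<noteq> z \<Longrightarrow> w \<notin> poles"
      using pole_neighbourhood[of k] unfolding z by metis
    obtain e where e: "e > 0" "ball z e \<subseteq> U"
      using U(1,2) by (auto simp: open_contains_ball)
    have "F_ext analytic_on ball z e - {z}"
      by (rule analytic_on_subset[OF F_ext_analytic]) (use e(2) U(3) in auto)
    thus ?thesis using e(1) unfolding isolated_singularity_at_def by blast
  qed
qed simp

lemma F_ext_of_real:
  assumes "x \<notin> poles"
  shows "F_ext (of_real x) = of_real (F x)" "deriv F_ext (of_real x) = of_real (F' x)"
proof -
  show "F_ext (of_real x) = of_real (F x)"
    using assms by (simp add: F_ext_def pole_sum_of_real)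
  have "(F_ext has_field_derivative F' (of_real x)) (at (of_real x))"
    using has_field_derivative_pole_sum[of "of_real x :: complex"] eventually_F_ext[of "of_real x"] assms
    by (subst DERIV_cong_ev[OF refl _ refl]) auto
  thus "deriv F_ext (of_real x) = of_real (F' x)"
    using assms by (simp add: DERIV_imp_deriv pole_sum_of_real)
qed

lemma F_ext_zeros: "{z. \<not> is_pole F_ext z \<and> F_ext z = 0} = range (\<lambda>k. of_real (s k))"
proof (intro set_eqI iffI)
  fix z assume "z \<in> {z. \<not> is_pole F_ext z \<and> F_ext z = 0}"
  thus "z \<in> range (\<lambda>k. of_real (s k))"
    using F_eq_0_iff[of z] by (auto simp: is_pole_F_ext_iff F_ext_def)
next
  fix z assume "z \<in> range (\<lambda>k. complex_of_real (s k))"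
  then obtain k where z: "z = of_real (s k)" by auto
  have "z \<notin> poles" using s_not_pole[of k] z by simp
  thus "z \<in> {z. \<not> is_pole F_ext z \<and> F_ext z = 0}"
    using F_ext_of_real(1)[OF s_not_pole] F_s z by (simp add: is_pole_F_ext_iff)
qed

lemma residue_reciprocal: "residue (\<lambda>z. 1 / F_ext z) (of_real (s k)) = of_real (r k)"
proof -
  let ?z = "complex_of_real (s k)"
  have np: "?z \<notin> poles" using s_not_pole by simp
  obtain e where e: "e > 0" "ball ?z e \<subseteq> - poles"
    using np open_contains_ball[THEN iffD1, OF open_compl_poles[where 'b = complex]] by blast
  have "residue (\<lambda>w. (\<lambda>_. 1) w / F_ext w) ?z = 1 / deriv F_ext ?z"
  proof (rule residue_simple_pole_deriv)
    show "(\<lambda>_. 1) holomorphic_on ball ?z e" "open (ball ?z e)" "connected (ball ?z e)" "?z \<in> ball ?z e"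
      using e by auto
    show "F_ext holomorphic_on ball ?z e"
      using F_ext_analytic e(2) by (meson analytic_imp_holomorphic holomorphic_on_subset)
    show "(F_ext has_field_derivative deriv F_ext ?z) (at ?z)"
      using F_ext_analytic np by (intro analytic_derivI) (auto elim: analytic_on_subset)
    show "deriv F_ext ?z \<noteq> 0" "F_ext ?z = 0"
      using F_ext_of_real[OF s_not_pole] F'_s_pos[of k] F_s by simp_all
  qed auto
  thus ?thesis using F_ext_of_real(2)[OF s_not_pole] by simp
qed

section \<open>The limit of the reciprocal at infinity\<close>

lemma reciprocal_limit_summable:
  assumes "summable (\<lambda>m. a m / c m)"
  shows "(\<lambda>n. 1 / F (real (Suc n))) \<longlonglongrightarrow> 1 / (\<Sum>m. a m / c m)"
proof -
  have "(\<lambda>n. F (real (Suc n))) \<longlonglongrightarrow> (\<Sum>m. a m / c m)"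
    unfolding pole_sum_def
  proof (rule tannery[where M = "\<lambda>m. a m / c m"])
    show "(\<lambda>n. of_real (a m) * (1 / of_real (c m) - 1 / (real (Suc n) + of_real (c m)))) \<longlonglongrightarrow> a m / c m" for m
    proof -
      have "filterlim (\<lambda>n. c m + real (Suc n)) at_top sequentially"
        by (intro filterlim_tendsto_add_at_top[OF tendsto_const] filterlim_compose[OF filterlim_real_sequentially] filterlim_Suc)
      hence "(\<lambda>n. 1 / (c m + real (Suc n))) \<longlonglongrightarrow> 0"
        by (intro tendsto_divide_0[OF tendsto_const] filterlim_at_top_imp_at_infinity)
      hence "(\<lambda>n. a m * (1 / c m - 1 / (c m + real (Suc n)))) \<longlonglongrightarrow> a m * (1 / c m - 0)"
        by (intro tendsto_intros)
      thus ?thesis by (simp add: add.commute)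
    qed
    show "\<forall>\<^sub>F n in sequentially. \<forall>m. norm (of_real (a m) * (1 / of_real (c m) - 1 / (real (Suc n) + of_real (c m)))) \<le> a m / c m"
    proof (intro always_eventually allI)
      fix n m
      have "0 \<le> 1 / c m - 1 / (real (Suc n) + c m)" "1 / c m - 1 / (real (Suc n) + c m) \<le> 1 / c m"
        using c_pos[of m] by (auto intro!: divide_left_mono mult_pos_pos add_nonneg_pos)
      hence "\<bar>a m * (1 / c m - 1 / (real (Suc n) + c m))\<bar> \<le> a m * (1 / c m)"
        using a_nonneg[of m] by (simp only: abs_mult abs_of_nonneg mult_left_mono)
      thus "norm (of_real (a m) * (1 / of_real (c m) - 1 / (real (Suc n) + of_real (c m)))) \<le> a m / c m"
        by simp
    qed
  qed (use assms in auto)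
  moreover have "(\<Sum>m. a m / c m) > 0"
    using assms a_pos c_pos by (intro suminf_pos) auto
  ultimately show ?thesis by (intro tendsto_divide tendsto_const) auto
qed

text \<open>
  Each truncation tends to a partial sum of \<open>\<Sum> a\<^sub>m / c\<^sub>m\<close>, and these are unbounded.
\<close>
lemma reciprocal_limit_not_summable:
  assumes "\<not> summable (\<lambda>m. a m / c m)"
  shows "(\<lambda>n. 1 / F (real (Suc n))) \<longlonglongrightarrow> 0"
proof -
  have large: "\<exists>M. (\<Sum>m<M. a m / c m) > B" for B
  proof (rule ccontr)
    assume "\<nexists>M. (\<Sum>m<M. a m / c m) > B"
    hence "summable (\<lambda>m. a m / c m)"
      using a_nonneg c_pos by (intro summableI_nonneg_bounded[of _ B]) (auto simp: not_less less_imp_le)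
    thus False using assms by simp
  qed
  have "filterlim (\<lambda>n. F (real (Suc n))) at_top sequentially"
    unfolding filterlim_at_top_dense
  proof
    fix B
    obtain M where M: "(\<Sum>m<M. a m / c m) > B" using large by blast
    let ?g = "\<lambda>n. \<Sum>m<M. a m * (1 / c m - 1 / (c m + real (Suc n)))"
    have lim: "(\<lambda>n. 1 / (c m + real (Suc n))) \<longlonglongrightarrow> 0" for m
      by (intro tendsto_divide_0[OF tendsto_const] filterlim_at_top_imp_at_infinity
            filterlim_tendsto_add_at_top[OF tendsto_const] filterlim_compose[OF filterlim_real_sequentially] filterlim_Suc)
    have "?g \<longlonglongrightarrow> (\<Sum>m<M. a m * (1 / c m - 0))"
      by (intro tendsto_intros lim)
    hence "\<forall>\<^sub>F n in sequentially. ?g n > B"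
      using M by (intro order_tendstoD(1)) auto
    thus "\<forall>\<^sub>F n in sequentially. B < F (real (Suc n))"
    proof eventually_elim
      case (elim n)
      have "?g n \<le> (\<Sum>m. a m * (1 / c m - 1 / (c m + real (Suc n))))"
      proof (rule sum_le_suminf)
        show "summable (\<lambda>m. a m * (1 / c m - 1 / (c m + real (Suc n))))"
          using summable_pole_sum(1)[OF nonneg_not_pole[of "real (Suc n)"]] by (simp add: add.commute)
        show "0 \<le> a m * (1 / c m - 1 / (c m + real (Suc n)))" for m
          using a_nonneg[of m] c_pos[of m]
          by (intro mult_nonneg_nonneg) (auto intro!: divide_left_mono mult_pos_pos add_pos_nonneg)
      qed auto
      thus ?case using elim by (simp add: pole_sum_def add.commute)
    qed
  qed
  thus ?thesis
    by (intro tendsto_divide_0[OF tendsto_const] filterlim_at_top_imp_at_infinity)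
qed

end

section \<open>The Laplace exponent as a series of simple poles\<close>

lemma set_integral_powr:
  assumes "u > (0 :: real)"
  shows "set_integrable lborel {0<..<1} (\<lambda>s. s powr (u - 1))"
    and "(LBINT s:{0<..<1}. s powr (u - 1)) = 1 / u"
proof -
  have lim: "((\<lambda>s. s powr u / u) \<longlongrightarrow> 0) (at_right 0)" "((\<lambda>s. s powr u / u) \<longlongrightarrow> 1 / u) (at_left 1)"
  proof -
    have "((\<lambda>s. s powr u) \<longlongrightarrow> 0) (at_right 0)"
      using assms by (intro tendsto_zero_powrI[OF tendsto_ident_at tendsto_const])
        (auto simp: eventually_at_filter)
    thus "((\<lambda>s. s powr u / u) \<longlongrightarrow> 0) (at_right 0)"
      using tendsto_divide[OF _ tendsto_const] assms by fastforce
    have "isCont (\<lambda>s. s powr u / u) 1"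
      using assms by (intro continuous_intros) auto
    hence "((\<lambda>s. s powr u / u) \<longlongrightarrow> 1 powr u / u) (at 1)"
      by (simp add: isCont_def)
    thus "((\<lambda>s. s powr u / u) \<longlongrightarrow> 1 / u) (at_left 1)"
      by (intro tendsto_mono[of "at_left 1" "at 1"]) (auto intro: at_le)
  qed
  have deriv: "((\<lambda>s. s powr u / u) has_field_derivative x powr (u - 1)) (at x)" if "x > 0" for x
    using that assms by (auto intro!: derivative_eq_intros)
  have cont: "isCont (\<lambda>s. s powr (u - 1)) x" if "x > 0" for x
    using that by (intro continuous_intros) auto
  note FTC = interval_integral_FTC_nonneg[where a = 0 and b = 1 and F = "\<lambda>s. s powr u / u"
      and f = "\<lambda>s. s powr (u - 1)" and A = 0 and B = "1 / u"]
  show "set_integrable lborel {0<..<1} (\<lambda>s. s powr (u - 1))"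
    using FTC(1) lim deriv cont
    by (auto simp: zero_ereal_def one_ereal_def ereal_tendsto_simps)
  show "(LBINT s:{0<..<1}. s powr (u - 1)) = 1 / u"
    using FTC(2) lim deriv cont
    by (auto simp: zero_ereal_def one_ereal_def ereal_tendsto_simps interval_integral_Ioo)
qed

lemma set_integral_powr_complex:
  assumes "Re w > 0"
  shows "set_integrable lborel {0<..<1} (\<lambda>s. of_real s powr (w - 1))"
    and "(LBINT s:{0<..<1}. of_real s powr (w - 1)) = 1 / w"
proof -
  have w: "w \<noteq> 0" using assms by auto
  show int: "set_integrable lborel {0<..<1} (\<lambda>s. of_real s powr (w - 1))"
  proof (rule set_integrable_bound[OF set_integral_powr(1)[OF assms]])
    show "set_borel_measurable lborel {0<..<1} (\<lambda>s. complex_of_real s powr (w - 1))"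
      using set_measurable_continuous_on[of "{0<..<1}" "\<lambda>s. complex_of_real s powr (w - 1)"]
      by (auto simp: set_borel_measurable_def intro!: continuous_intros)
  qed (auto simp: norm_powr_real_powr)
  define P where "P = (\<lambda>s. complex_of_real s powr w / w)"
  have dP: "(P has_vector_derivative (of_real x powr (w - 1))) (at x)" if "x > 0" for x
    unfolding P_def using that w
    by (intro has_vector_derivative_real_field) (auto intro!: derivative_eq_intros)
  have cont: "isCont (\<lambda>s. complex_of_real s powr (w - 1)) x" if "x > 0" for x
    using that by (intro continuous_intros) auto
  have lim0: "(P \<longlongrightarrow> 0) (at_right 0)"
  proof (rule tendsto_norm_zero_cancel)
    have "((\<lambda>s. s powr Re w / cmod w) \<longlongrightarrow> 0 / cmod w) (at_right 0)"
      using w assms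
      by (intro tendsto_divide tendsto_const tendsto_zero_powrI[OF tendsto_ident_at tendsto_const])
        (auto simp: eventually_at_filter)
    moreover have "\<forall>\<^sub>F s in at_right 0. s powr Re w / cmod w = norm (P s)"
      by (auto simp: P_def eventually_at_filter norm_divide norm_powr_real_powr intro!: always_eventually)
    ultimately show "((\<lambda>s. norm (P s)) \<longlongrightarrow> 0) (at_right 0)"
      by (simp add: tendsto_cong)
  qed
  have lim1: "(P \<longlongrightarrow> 1 / w) (at_left 1)"
  proof -
    have "isCont P 1" unfolding P_def using w by (intro continuous_intros) auto
    hence "(P \<longlongrightarrow> P 1) (at 1)" by (simp add: isCont_def)
    thus ?thesis
      unfolding P_def by (intro tendsto_mono[of "at_left 1" "at 1"]) (auto intro: at_le)
  qed
  show "(LBINT s:{0<..<1}. of_real s powr (w - 1)) = 1 / w"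
    using interval_integral_FTC_integrable[of 0 1 P "\<lambda>s. of_real s powr (w - 1)" 0 "1 / w"] int dP cont lim0 lim1
    by (auto simp: zero_ereal_def one_ereal_def ereal_tendsto_simps interval_integral_Ioo)
qed

lemma norm_one_minus_exp_le:
  fixes w :: complex
  assumes "Re w \<le> 0"
  shows "cmod (1 - exp w) \<le> cmod w"
proof -
  have "cmod (exp 0 - exp w) \<le> 1 * cmod (0 - w)"
  proof (rule field_differentiable_bound[where S = "{z. Re z \<le> 0}" and f' = exp])
    show "convex {z. Re z \<le> 0}" by (rule convex_halfspace_Re_le)
    show "(exp has_field_derivative exp z) (at z within {z. Re z \<le> 0})" for z :: complex
      by (rule DERIV_subset[OF DERIV_exp]) simp
  qed (use assms in auto)
  thus ?thesis by simp
qed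

locale beta_kernel =
  fixes \<beta> :: real
  assumes beta_gt: "-2 < \<beta>" and beta_neg: "\<beta> < 0"
begin

text \<open>
  These are the coefficients of \<open>(1 - s)\<^sup>\<beta>\<close>, that is \<open>(-1)\<^sup>m\<close> times the binomial coefficient;
  \<open>-pt m\<close> is the pole that the term \<open>s\<^sup>m\<close> contributes.
\<close>
definition wt :: "nat \<Rightarrow> real" where "wt m = pochhammer (-\<beta>) m / fact m"
definition pt :: "nat \<Rightarrow> real" where "pt m = real m + \<beta> + 2"

lemma wt_pos: "wt m > 0"
  unfolding wt_def using beta_neg by (intro divide_pos_pos pochhammer_pos) auto

lemma pt_pos: "pt m > 0"
  using beta_gt by (simp add: pt_def)

lemma wt_sums:
  assumes "0 < s" "s < 1"
  shows "(\<lambda>m. wt m * s ^ m) sums (1 - s) powr \<beta>"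
proof -
  have "(\<lambda>m. (\<beta> gchoose m) * (-s) ^ m) sums (1 + (-s)) powr \<beta>"
    by (rule Generalised_Binomial_Theorem.gen_binomial_real) (use assms in auto)
  moreover have "(\<beta> gchoose m) * (-s) ^ m = wt m * s ^ m" for m
    by (cases "even m") (simp_all add: gbinomial_pochhammer wt_def)
  ultimately show ?thesis by simp
qed

text \<open>
  Up to the power of \<open>m\<close> this is the reciprocal of the sequence \<open>Gamma_series'\<close>, which converges to
  the Gamma function.
\<close>
lemma wt_asymptotic: "(\<lambda>m. wt m * real m powr (\<beta> + 1)) \<longlonglongrightarrow> 1 / Gamma (-\<beta>)"
proof -
  have "Gamma (-\<beta>) \<noteq> 0" using Gamma_real_pos[of "-\<beta>"] beta_neg by linarith
  hence "(\<lambda>m. 1 / Gamma_series' (-\<beta>) m) \<longlonglongrightarrow> 1 / Gamma (-\<beta>)"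
    by (intro tendsto_divide tendsto_const Gamma_series'_LIMSEQ)
  moreover have "\<forall>\<^sub>F m in sequentially. 1 / Gamma_series' (-\<beta>) m = wt m * real m powr (\<beta> + 1)"
    using eventually_gt_at_top[of 0]
  proof eventually_elim
    case (elim m)
    have "exp (- (\<beta> * ln (real m))) = inverse (real m powr \<beta>)"
      using elim by (simp add: powr_def exp_minus)
    moreover have "fact m = real m * fact (m - 1)"
      using elim by (simp add: fact_reduce)
    ultimately show ?case
      using elim by (simp add: Gamma_series'_def wt_def powr_add divide_simps mult_ac)
  qed
  ultimately show ?thesis by (rule Lim_transform_eventually)
qed

lemma wt_upper: obtains B where "B > 0" "\<And>m. m > 0 \<Longrightarrow> wt m \<le> B * real m powr (- \<beta> - 1)"
proof -
  have "Bseq (\<lambda>m. wt m * real m powr (\<beta> + 1))"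
    using wt_asymptotic by (intro convergent_imp_Bseq) (auto simp: convergent_def)
  then obtain B where B: "B > 0" "\<And>m. \<bar>wt m * real m powr (\<beta> + 1)\<bar> \<le> B"
    by (auto simp: Bseq_def)
  have "wt m \<le> B * real m powr (- \<beta> - 1)" if "m > 0" for m
  proof -
    have "wt m = (wt m * real m powr (\<beta> + 1)) * real m powr (- \<beta> - 1)"
      using that by (simp add: powr_add[symmetric])
    also have "\<dots> \<le> B * real m powr (- \<beta> - 1)"
      using B(2)[of m] by (intro mult_right_mono) auto
    finally show ?thesis .
  qed
  with B(1) show ?thesis using that by blast
qed

lemma wt_lower:
  obtains b M where "b > 0" "\<And>m. m > M \<Longrightarrow> wt m \<ge> b * real m powr (- \<beta> - 1)"
proof -
  define b where "b = 1 / (2 * Gamma (-\<beta>))"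
  have b: "b > 0" using Gamma_real_pos[of "-\<beta>"] beta_neg by (simp add: b_def)
  have "\<forall>\<^sub>F m in sequentially. wt m * real m powr (\<beta> + 1) > b"
    using wt_asymptotic b unfolding b_def by (intro order_tendstoD(1)[OF wt_asymptotic]) (auto simp: field_simps)
  then obtain M where M: "\<And>m. m \<ge> M \<Longrightarrow> wt m * real m powr (\<beta> + 1) > b"
    by (auto simp: eventually_sequentially)
  have "wt m \<ge> b * real m powr (- \<beta> - 1)" if "m > M" for m
  proof -
    have "b * real m powr (- \<beta> - 1) \<le> (wt m * real m powr (\<beta> + 1)) * real m powr (- \<beta> - 1)"
      using M[of m] that by (intro mult_right_mono) auto
    also have "\<dots> = wt m" using that by (simp add: powr_add[symmetric])
    finally show ?thesis .
  qed
  with b show ?thesis using that by blast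
qed

lemma summable_wt_pt2: "summable (\<lambda>m. wt m / (pt m)\<^sup>2)"
proof -
  obtain B where B: "B > 0" "\<And>m. m > 0 \<Longrightarrow> wt m \<le> B * real m powr (- \<beta> - 1)"
    using wt_upper by blast
  have "summable (\<lambda>m. B * real m powr (- \<beta> - 3))"
    using beta_gt by (intro summable_mult) (simp add: summable_real_powr_iff)
  thus ?thesis
  proof (rule summable_comparison_test'[of _ 1])
    fix m :: nat assume m: "m \<ge> 1"
    have "wt m / (pt m)\<^sup>2 \<le> (B * real m powr (- \<beta> - 1)) / (real m)\<^sup>2"
      using B m wt_pos[of m] beta_gt by (intro frac_le power_mono) (auto simp: pt_def)
    also have "\<dots> = B * real m powr (- \<beta> - 3)"
      using m by (simp add: powr_diff powr_numeral powr_add field_simps power_numeral_reduce)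
    finally show "norm (wt m / (pt m)\<^sup>2) \<le> B * real m powr (- \<beta> - 3)"
      using wt_pos[of m] by simp
  qed
qed

lemma summable_wt_pt_iff: "summable (\<lambda>m. wt m / pt m) \<longleftrightarrow> \<beta> > -1"
proof
  assume *: "\<beta> > -1"
  obtain B where B: "B > 0" "\<And>m. m > 0 \<Longrightarrow> wt m \<le> B * real m powr (- \<beta> - 1)"
    using wt_upper by blast
  have "summable (\<lambda>m. B * real m powr (- \<beta> - 2))"
    using * by (intro summable_mult) (simp add: summable_real_powr_iff)
  thus "summable (\<lambda>m. wt m / pt m)"
  proof (rule summable_comparison_test'[of _ 1])
    fix m :: nat assume m: "m \<ge> 1"
    have "wt m / pt m \<le> (B * real m powr (- \<beta> - 1)) / real m"
      using B m wt_pos[of m] beta_gt by (intro frac_le) (auto simp: pt_def)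
    also have "\<dots> = B * real m powr (- \<beta> - 2)"
      using m by (simp add: powr_diff powr_numeral powr_add field_simps power2_eq_square)
    finally show "norm (wt m / pt m) \<le> B * real m powr (- \<beta> - 2)"
      using wt_pos[of m] pt_pos[of m] by simp
  qed
next
  assume sm: "summable (\<lambda>m. wt m / pt m)"
  obtain b M where b: "b > 0" "\<And>m. m > M \<Longrightarrow> wt m \<ge> b * real m powr (- \<beta> - 1)"
    using wt_lower by blast
  have "summable (\<lambda>m. real m powr (- \<beta> - 2))"
  proof (rule summable_comparison_test'[OF summable_mult[OF sm, of "3 / b"], of "Suc M"])
    fix m assume m: "m \<ge> Suc M"
    have "b / 3 * real m powr (- \<beta> - 2) = (b * real m powr (- \<beta> - 1)) / (3 * real m)"
      using m by (simp add: powr_diff powr_numeral powr_add field_simps power2_eq_square)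
    also have "\<dots> \<le> wt m / pt m"
      using b m wt_pos[of m] pt_pos[of m] beta_neg by (intro frac_le) (auto simp: pt_def)
    finally have "3 / b * (b / 3 * real m powr (- \<beta> - 2)) \<le> 3 / b * (wt m / pt m)"
      using b(1) by (intro mult_left_mono) auto
    thus "norm (real m powr (- \<beta> - 2)) \<le> 3 / b * (wt m / pt m)"
      using b(1) by simp
  qed
  thus "\<beta> > -1" by (simp add: summable_real_powr_iff)
qed

sublocale positive_pole_series wt pt
proof
  show "filterlim pt at_top sequentially"
  proof -
    have "filterlim (\<lambda>m. (\<beta> + 2) + real m) at_top sequentially"
      by (intro filterlim_tendsto_add_at_top[OF tendsto_const] filterlim_real_sequentially)
    thus ?thesis unfolding pt_def[abs_def] by (simp add: algebra_simps)
  qed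
  show "strict_mono pt" by (auto simp: strict_mono_def pt_def)
qed (use pt_pos wt_pos less_imp_le summable_wt_pt2 in auto)

lemma wt_powr_sums:
  assumes "0 < x" "x < 1"
  shows "(\<lambda>m. wt m * x powr (pt m - 1)) sums (x powr (\<beta> + 1) * (1 - x) powr \<beta>)"
proof -
  have "x powr (pt m - 1) = x powr (\<beta> + 1) * x ^ m" for m
    using assms by (simp add: pt_def powr_realpow[symmetric] powr_add[symmetric] algebra_simps)
  thus ?thesis
    using sums_mult[OF wt_sums[OF assms], of "x powr (\<beta> + 1)"] by (simp add: mult_ac)
qed

text \<open>
  The binomial series of \<open>(1 - s)\<^sup>\<beta>\<close> may be integrated termwise because
  \<open>|1 - s\<^sup>z| \<le> |z| ln (1 / s) \<le> |z| (s powr (-\<delta>) - 1) / \<delta>\<close>: the factor \<open>1 - s\<^sup>z\<close> costs only the small power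
  \<open>s powr (-\<delta>)\<close> at \<open>0\<close>, and gains the second factor \<open>1 / c\<^sub>m\<close> in the bound \<open>2 |z| a\<^sub>m / c\<^sub>m\<^sup>2\<close> of
  the \<open>m\<close>-th integral.
\<close>
lemma phi_eq_pole_sum:
  assumes z: "Re z \<ge> 0"
  shows "phi \<beta> z = F z"
proof -
  define f where "f = (\<lambda>m s. of_real (wt m) * (indicator {0<..<1} s *\<^sub>R
     (of_real s powr (of_real (pt m) - 1) - of_real s powr (z + of_real (pt m) - 1))))"
  \<comment> \<open>Half of the smallest \<open>pt m\<close>, so that all \<open>pt m - \<delta>\<close> stay comparable to \<open>pt m\<close>.\<close>
  define \<delta> where "\<delta> = (\<beta> + 2) / 2"
  have \<delta>: "\<delta> > 0" "\<delta> \<le> pt m / 2" for m using beta_gt by (auto simp: \<delta>_def pt_def)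
  have f_alt: "f m s = of_real (wt m * s powr (pt m - 1)) * (1 - of_real s powr z)"
    if s: "0 < s" "s < 1" for m s
  proof -
    have "of_real s powr (of_real (pt m) - 1) = complex_of_real (s powr (pt m - 1))"
      using s by (simp flip: powr_of_real)
    moreover have "of_real s powr (z + of_real (pt m) - 1) = 
                     complex_of_real s powr z * of_real s powr (of_real (pt m) - 1)"
      by (simp add: powr_add[symmetric] algebra_simps)
    ultimately show ?thesis using s by (simp add: f_def algebra_simps)
  qed
  have int1: "set_integrable lborel {0<..<1} (\<lambda>s. complex_of_real s powr (of_real (pt m) - 1))"
    and int2: "set_integrable lborel {0<..<1} (\<lambda>s. complex_of_real s powr (z + of_real (pt m) - 1))" for m
    using z pt_pos[of m] set_integral_powr_complex(1)[of "of_real (pt m)"] 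
       set_integral_powr_complex(1)[of "z + of_real (pt m)"] by auto
  have f_int: "integrable lborel (f m)" for m
    using set_integral_diff(1)[OF int1[of m] int2[of m]]
    unfolding f_def set_integrable_def by (intro integrable_mult_right)
  have f_integral: "integral\<^sup>L lborel (f m) = of_real (wt m) * (1 / of_real (pt m) - 1 / (z + of_real (pt m)))" for m
  proof -
    have "integral\<^sup>L lborel (f m) = of_real (wt m) * (LBINT s:{0<..<1}.
            of_real s powr (of_real (pt m) - 1) - of_real s powr (z + of_real (pt m) - 1))"
      unfolding set_lebesgue_integral_def f_def by (rule integral_mult_right_zero)
    also have "\<dots> = of_real (wt m) * (1 / of_real (pt m) - 1 / (z + of_real (pt m)))"
      using set_integral_diff(2)[OF int1[of m] int2[of m]] z pt_pos[of m] set_integral_powr_complex(2)[of "of_real (pt m)"] 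
       set_integral_powr_complex(2)[of "z + of_real (pt m)"] by simp
    finally show ?thesis .
  qed
  have key: "norm (f m s) \<le> wt m * (cmod z / \<delta>) * (indicator {0<..<1} s *\<^sub>R (s powr (pt m - \<delta> - 1) - s powr (pt m - 1)))"
    for m s
  proof (cases "0 < s \<and> s < 1")
    case True
    hence s: "0 < s" "s < 1" by auto
    have "cmod (1 - of_real s powr z) \<le> cmod (z * ln s)"
      using norm_one_minus_exp_le[of "z * ln s"] s z
      by (simp add: powr_def Ln_of_real mult_nonneg_nonpos)
    also have "\<dots> = cmod z * (- ln s)" using s by (simp add: norm_mult)
    also have "- ln s = ln (s powr (-\<delta>)) / \<delta>" using s \<delta>(1) by (simp add: ln_powr)
    also have "\<dots> \<le> (s powr (-\<delta>) - 1) / \<delta>"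
      using s \<delta>(1) by (intro divide_right_mono ln_le_minus_one) auto
    finally have *: "cmod (1 - of_real s powr z) \<le> cmod z * ((s powr (-\<delta>) - 1) / \<delta>)"
      by (simp add: mult_left_mono)
    have "norm (f m s) = wt m * s powr (pt m - 1) * cmod (1 - of_real s powr z)"
      using s wt_pos[of m] by (simp add: f_alt norm_mult)
    also have "\<dots> \<le> wt m * s powr (pt m - 1) * (cmod z * ((s powr (-\<delta>) - 1) / \<delta>))"
      using wt_pos[of m] by (intro mult_left_mono *) auto
    also have "\<dots> = wt m * (cmod z / \<delta>) * (s powr (pt m - \<delta> - 1) - s powr (pt m - 1))"
    proof -
      have "s powr (pt m - 1) * s powr (-\<delta>) = s powr (pt m - \<delta> - 1)"
        by (simp add: powr_add[symmetric] algebra_simps)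
      hence "s powr (pt m - 1) * (s powr (-\<delta>) - 1) = s powr (pt m - \<delta> - 1) - s powr (pt m - 1)"
        by (simp add: right_diff_distrib)
      thus ?thesis by (metis (no_types, opaque_lifting) mult.assoc mult.left_commute times_divide_eq_left times_divide_eq_right)
    qed
    finally show ?thesis using s by simp
  qed (auto simp: f_def)
  have pt\<delta>: "pt m - \<delta> > 0" for m using \<delta>(2)[of m] pt_pos[of m] by linarith
  have g: "integrable lborel (\<lambda>s. wt m * (cmod z / \<delta>) * (indicator {0<..<1} s *\<^sub>R (s powr (pt m - \<delta> - 1) - s powr (pt m - 1))))"
       "(\<integral>s. wt m * (cmod z / \<delta>) * (indicator {0<..<1} s *\<^sub>R (s powr (pt m - \<delta> - 1) - s powr (pt m - 1))) \<partial>lborel) =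
          wt m * (cmod z / \<delta>) * (1 / (pt m - \<delta>) - 1 / pt m)" for m
    using set_integral_diff[OF set_integral_powr(1)[OF pt\<delta>[of m]] set_integral_powr(1)[OF pt_pos[of m]]]
      set_integral_powr(2)[OF pt\<delta>[of m]] set_integral_powr(2)[OF pt_pos[of m]]
    unfolding set_integrable_def set_lebesgue_integral_def by auto
  have "(\<lambda>m. integral\<^sup>L lborel (f m)) sums (\<integral>s. (\<Sum>m. f m s) \<partial>lborel)"
  proof (rule sums_integral[OF f_int])
    show "AE s in lborel. summable (\<lambda>m. norm (f m s))"
    proof (intro AE_I2)
      fix s :: real
      show "summable (\<lambda>m. norm (f m s))"
      proof (cases "0 < s \<and> s < 1")
        case True
        hence s: "0 < s" "s < 1" by auto
        have "norm (f m s) = wt m * s powr (pt m - 1) * cmod (1 - of_real s powr z)" for m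
          using s wt_pos[of m] by (simp add: f_alt norm_mult)
        thus ?thesis using sums_summable[OF wt_powr_sums[OF s]] by (simp add: summable_mult2)
      qed (auto simp: f_def)
    qed
    show "summable (\<lambda>m. \<integral>s. norm (f m s) \<partial>lborel)"
    proof (rule summable_comparison_test'[OF summable_mult[OF summable_wt_pt2]])
      fix m
      have "(\<integral>s. norm (f m s) \<partial>lborel) \<le> wt m * (cmod z / \<delta>) * (1 / (pt m - \<delta>) - 1 / pt m)"
        unfolding g(2)[symmetric] by (intro integral_mono key g(1) integrable_norm f_int)
      also have "\<dots> \<le> wt m * (cmod z / \<delta>) * (\<delta> / (pt m * (pt m / 2)))"
      proof (rule mult_left_mono)
        have "1 / (pt m - \<delta>) - 1 / pt m = \<delta> / (pt m * (pt m - \<delta>))"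
          using pt\<delta>[of m] pt_pos[of m] by (simp add: field_simps)
        also have "\<dots> \<le> \<delta> / (pt m * (pt m / 2))"
          using pt_pos[of m] \<delta>(1) \<delta>(2)[of m] pt\<delta>[of m]
          by (intro divide_left_mono mult_left_mono mult_pos_pos) auto
        finally show "1 / (pt m - \<delta>) - 1 / pt m \<le> \<delta> / (pt m * (pt m / 2))" .
      qed (use wt_pos[of m] \<delta>(1) in auto)
      also have "\<dots> = 2 * cmod z * (wt m / (pt m)\<^sup>2)"
        using \<delta>(1) by (simp add: power2_eq_square)
      finally show "norm (\<integral>s. norm (f m s) \<partial>lborel) \<le> 2 * cmod z * (wt m / (pt m)\<^sup>2)"
        by simp
    qed
  qed
  also have "(\<integral>s. (\<Sum>m. f m s) \<partial>lborel) = phi \<beta> z"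
    unfolding phi_def set_lebesgue_integral_def
  proof (intro Bochner_Integration.integral_cong refl)
    fix s :: real
    show "(\<Sum>m. f m s) = indicator {0<..<1} s *\<^sub>R
        ((1 - of_real s powr z) * of_real (s powr (\<beta> + 1) * (1 - s) powr \<beta>))"
    proof (cases "0 < s \<and> s < 1")
      case True
      hence s: "0 < s" "s < 1" by auto
      have "(\<lambda>m. of_real (wt m * s powr (pt m - 1)) * (1 - of_real s powr z)) sums
              (of_real (s powr (\<beta> + 1) * (1 - s) powr \<beta>) * (1 - of_real s powr z))"
        by (intro sums_mult2 sums_of_real wt_powr_sums s)
      thus ?thesis using s by (simp add: f_alt sums_iff mult_ac)
    qed (auto simp: f_def)
  qed
  finally show ?thesis
    unfolding f_integral pole_sum_def by (simp add: sums_iff)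
qed

text \<open>
  Termwise integration of the binomial series against \<open>s powr (\<beta> + 1)\<close>.
\<close>
lemma sum_wt_pt_eq_Beta:
  assumes "\<beta> > -1"
  shows "(\<Sum>m. wt m / pt m) = Beta (\<beta> + 2) (\<beta> + 1)"
proof -
  define f where "f = (\<lambda>m s. wt m * (indicator {0<..<1} s *\<^sub>R s powr (pt m - 1)))"
  define g where "g = (\<lambda>s. s powr (\<beta> + 1) * (1 - s) powr \<beta>)"
  have f_int: "integrable lborel (f m)" for m
    using set_integral_powr(1)[OF pt_pos[of m]] unfolding f_def set_integrable_def
    by (intro integrable_mult_right)
  have f_integral: "integral\<^sup>L lborel (f m) = wt m / pt m" for m
    using set_integral_powr(2)[OF pt_pos[of m]] unfolding f_def set_lebesgue_integral_def
    by simp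
  have f_nonneg: "norm (f m s) = f m s" for m s
    using wt_pos[of m] by (simp add: f_def indicator_def)
  have sum_f: "(\<Sum>m. f m s) = indicator {0<..<1} s *\<^sub>R g s" "summable (\<lambda>m. f m s)" for s
  proof -
    have "(\<lambda>m. f m s) sums (indicator {0<..<1} s *\<^sub>R g s)"
    proof (cases "0 < s \<and> s < 1")
      case True
      thus ?thesis using wt_powr_sums[of s] by (simp add: f_def g_def)
    qed (auto simp: f_def)
    thus "(\<Sum>m. f m s) = indicator {0<..<1} s *\<^sub>R g s" "summable (\<lambda>m. f m s)"
      by (auto simp: sums_iff)
  qed
  have sm: "summable (\<lambda>m. wt m / pt m)" using summable_wt_pt_iff assms by simp
  have "AE s in lborel. summable (\<lambda>m. norm (f m s))" "summable (\<lambda>m. \<integral>s. norm (f m s) \<partial>lborel)"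
    unfolding f_nonneg f_integral using sum_f sm by auto
  note * = integrable_suminf[OF f_int this] integral_suminf[OF f_int this]
  have g_int: "set_integrable lborel {0<..<1} g"
    using *(1) by (simp add: sum_f set_integrable_def)
  have "(\<Sum>m. wt m / pt m) = (LBINT s:{0<..<1}. g s)"
    using *(2) by (simp add: sum_f f_integral set_lebesgue_integral_def)
  also have "\<dots> = integral {0<..<1} g"
    by (rule set_borel_integral_eq_integral(2)[OF g_int])
  also have "\<dots> = Beta (\<beta> + 2) (\<beta> + 1)"
    using has_integral_Beta_real[of "\<beta> + 2" "\<beta> + 1"] assms
    by (intro integral_unique) (simp add: has_integral_Icc_iff_Ioo g_def[abs_def] add.commute)
  finally show ?thesis .
qed

lemma reciprocal_limit: "(\<lambda>n. 1 / F (real (Suc n))) \<longlonglongrightarrow> eta \<beta>"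
  using reciprocal_limit_summable reciprocal_limit_not_summable summable_wt_pt_iff sum_wt_pt_eq_Beta
  by (auto simp: eta_def)

lemma phi_ext_eq: "phi_ext \<beta> = F_ext"
  unfolding phi_ext_def
proof (rule the_equality)
  have eq: "F_ext z = phi \<beta> z" if "Re z \<ge> 0" for z
    using that Re_nonneg_not_pole[OF that] by (simp add: F_ext_def phi_eq_pole_sum)
  thus "F_ext nicely_meromorphic_on UNIV \<and> (\<forall>z. Re z \<ge> 0 \<longrightarrow> F_ext z = phi \<beta> z)"
    using F_ext_nicely_meromorphic by blast
  fix f assume f: "f nicely_meromorphic_on UNIV \<and> (\<forall>z. Re z \<ge> 0 \<longrightarrow> f z = phi \<beta> z)"
  show "f = F_ext"
  proof (rule nicely_meromorphic_eqI[where U = "{z. Re z > 0}"])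
    show "{z. Re z > 0} \<noteq> {}" by (auto intro!: exI[of _ 1])
    show "f z = F_ext z" if "z \<in> {z. Re z > 0}" for z using f eq that by auto
  qed (use f F_ext_nicely_meromorphic open_halfspace_Re_gt in auto)
qed

text \<open>
  Two strictly decreasing sequences with the same range agree: expressing one through the other
  by an index map \<open>h\<close> makes \<open>h\<close> strictly increasing, hence \<open>n \<le> h n\<close>, and this holds in both
  directions.
\<close>
lemma phi_zero_eq: "phi_zero \<beta> = s"
  unfolding phi_zero_def phi_ext_eq F_ext_zeros
proof (rule the_equality)
  show "s 0 = 0 \<and> (\<forall>k. s (Suc k) < s k) \<and> range (\<lambda>k. complex_of_real (s k)) = range (\<lambda>k. of_real (s k))"
    using s_decreasing by simp
  fix t :: "nat \<Rightarrow> real"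
  assume t: "t 0 = 0 \<and> (\<forall>k. t (Suc k) < t k) \<and> range (\<lambda>k. complex_of_real (t k)) = range (\<lambda>k. of_real (s k))"
  have range: "range t = range s"
  proof -
    have "Re ` range (\<lambda>k. complex_of_real (t k)) = Re ` range (\<lambda>k. complex_of_real (s k))"
      using t by simp
    thus ?thesis by (simp add: image_image)
  qed
  have mono: "strict_mono (\<lambda>k. - u k)" if "\<forall>k. u (Suc k) < u k" for u :: "nat \<Rightarrow> real"
    using that by (simp add: strict_mono_Suc_iff)
  have dec: "u i > u j \<longleftrightarrow> i < j" if "\<forall>k. u (Suc k) < u k" for u :: "nat \<Rightarrow> real" and i j
    using strict_mono_less[OF mono[OF that]] by simp
  have ge: "v n \<le> u n" if u: "\<forall>k. u (Suc k) < u k" and v: "\<forall>k. v (Suc k) < v k" and r: "range v = range u"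
    for u v :: "nat \<Rightarrow> real" and n
  proof -
    have "\<forall>n. \<exists>m. v n = u m" using r by auto
    then obtain h where h: "\<And>n. v n = u (h n)" by metis
    have "strict_mono h"
      using v dec[OF u] by (auto simp: strict_mono_Suc_iff h)
    hence "n \<le> h n" by (rule strict_mono_imp_increasing)
    thus ?thesis using dec[OF u, of n "h n"] by (auto simp: h le_less)
  qed
  show "t = s"
    using ge[of s t] ge[of t s] t range s_decreasing by (intro ext antisym) auto
qed

end

section \<open>Mixtures of laws and the potential measure\<close>

lemma set_integral_exp:
  assumes "Re w > 0"
  shows "set_integrable lborel {0<..} (\<lambda>t. exp (- (w * of_real t)))"
    and "(LBINT t:{0<..}. exp (- (w * of_real t))) = 1 / w"
proof -
  have w: "w \<noteq> 0" using assms by auto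
  define u where "u = Re w"
  have u: "u > 0" using assms by (simp add: u_def)
  have lim_exp: "((\<lambda>t. exp (- (u * t))) \<longlongrightarrow> 0) at_top"
    using u by (intro filterlim_compose[OF exp_at_bot] filterlim_uminus_at_bot[THEN iffD2])
      (simp add: filterlim_tendsto_pos_mult_at_top[OF tendsto_const _ filterlim_ident])
  have "set_integrable lborel (einterval 0 \<infinity>) (\<lambda>t. exp (- (u * t)))"
  proof (rule interval_integral_FTC_nonneg(1)[where F = "\<lambda>t. - exp (- (u * t)) / u" and A = "- 1 / u" and B = 0])
    show "((\<lambda>t. - exp (- (u * t)) / u) has_field_derivative exp (- (u * x))) (at x)" for x
      using u by (auto intro!: derivative_eq_intros)
    show "(((\<lambda>t. - exp (- (u * t)) / u) \<circ> real_of_ereal) \<longlongrightarrow> - 1 / u) (at_right 0)"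
      unfolding zero_ereal_def ereal_tendsto_simps using u by (auto intro!: tendsto_eq_intros)
    show "(((\<lambda>t. - exp (- (u * t)) / u) \<circ> real_of_ereal) \<longlongrightarrow> 0) (at_left \<infinity>)"
      unfolding ereal_tendsto_simps using tendsto_divide[OF tendsto_minus[OF lim_exp] tendsto_const[of u]] u by simp
  qed auto
  hence int_u: "set_integrable lborel {0<..} (\<lambda>t. exp (- (u * t)))"
    by (simp add: zero_ereal_def)
  show int: "set_integrable lborel {0<..} (\<lambda>t. exp (- (w * of_real t)))"
  proof (rule set_integrable_bound[OF int_u])
    show "set_borel_measurable lborel {0<..} (\<lambda>t. exp (- (w * complex_of_real t)))"
      using set_measurable_continuous_on[of "{0<..}" "\<lambda>t. exp (- (w * complex_of_real t))"]
      by (auto simp: set_borel_measurable_def intro!: continuous_intros)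
  qed (auto simp: u_def)
  define P where "P = (\<lambda>t. - exp (- (w * complex_of_real t)) / w)"
  have "interval_lebesgue_integral lborel 0 \<infinity> (\<lambda>t. exp (- (w * of_real t))) = 0 - (- 1 / w)"
  proof (rule interval_integral_FTC_integrable[where F = P])
    show "(P has_vector_derivative exp (- (w * of_real x))) (at x)" for x
      unfolding P_def using w
      by (intro has_vector_derivative_real_field) (auto intro!: derivative_eq_intros)
    show "((P \<circ> real_of_ereal) \<longlongrightarrow> - 1 / w) (at_right 0)"
      unfolding zero_ereal_def ereal_tendsto_simps P_def using w by (auto intro!: tendsto_eq_intros)
    show "((P \<circ> real_of_ereal) \<longlongrightarrow> 0) (at_left \<infinity>)"
      unfolding ereal_tendsto_simps
    proof (rule tendsto_norm_zero_cancel)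
      have "norm (P t) = exp (- (u * t)) / cmod w" for t
        by (simp add: P_def norm_divide u_def)
      thus "((\<lambda>t. norm (P t)) \<longlongrightarrow> 0) at_top"
        using tendsto_divide[OF lim_exp tendsto_const[of "cmod w"]] w by simp
    qed
  qed (use int in \<open>auto simp: zero_ereal_def\<close>)
  thus "(LBINT t:{0<..}. exp (- (w * of_real t))) = 1 / w"
    by (simp add: interval_lebesgue_integral_le_eq zero_ereal_def)
qed

text \<open>
  The integrand is only prescribed for positive times, since the kernels below are cut off at time
  \<open>0\<close>.
\<close>
lemma exponential_integral:
  fixes g :: "real \<Rightarrow> complex"
  assumes l: "l > 0" and w: "Re w > 0"
    and g [measurable]: "g \<in> borel_measurable borel"
    and eq: "\<And>t. t > 0 \<Longrightarrow> of_real (exp (- (l * t))) * g t = exp (- (w * of_real t))"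
  shows "(\<integral>t. g t \<partial>density lborel (exponential_density l)) = of_real l / w"
proof -
  have "(\<integral>t. g t \<partial>density lborel (exponential_density l)) = (\<integral>t. exponential_density l t *\<^sub>R g t \<partial>lborel)"
    using l by (subst integral_density) (auto simp: exponential_density_def)
  also have "\<dots> = (\<integral>t. of_real l * (indicator {0<..} t *\<^sub>R exp (- (w * of_real t))) \<partial>lborel)"
  proof (rule integral_cong_AE)
    show "AE t in lborel. exponential_density l t *\<^sub>R g t = of_real l * (indicator {0<..} t *\<^sub>R exp (- (w * of_real t)))"
      using AE_lborel_singleton[of 0]
    proof eventually_elim
      case (elim t)
      show ?case
      proof (cases "t > 0")
        case True
        have "exponential_density l t *\<^sub>R g t = of_real l * (of_real (exp (- (l * t))) * g t)"
          using True by (simp add: exponential_density_def scaleR_conv_of_real mult.commute)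
        thus ?thesis using True eq by simp
      next
        case False
        thus ?thesis using elim by (simp add: exponential_density_def)
      qed
    qed
  qed auto
  also have "\<dots> = of_real l * (LBINT t:{0<..}. exp (- (w * of_real t)))"
    unfolding set_lebesgue_integral_def by (rule integral_mult_right_zero)
  finally show ?thesis using set_integral_exp(2)[OF w] by simp
qed

lemma char_bind:
  assumes "prob_space M" and N: "N \<in> M \<rightarrow>\<^sub>M subprob_algebra borel" and prob: "\<And>x. x \<in> space M \<Longrightarrow> prob_space (N x)"
  shows "char (M \<bind> N) \<tau> = (\<integral>x. char (N x) \<tau> \<partial>M)"
proof -
  interpret M: prob_space M by fact
  interpret MN: prob_space "M \<bind> N"
    by (rule M.prob_space_bind[OF _ N]) (use prob in auto)
  have sets_N: "sets (N x) = sets borel" if "x \<in> space M" for x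
    using sets_kernel[OF N that] .
  have sets_MN: "sets (M \<bind> N) = sets borel"
    by (rule sets_bind) (use sets_N M.not_empty in auto)
  have integrable_iexp: "integrable L (\<lambda>x. iexp (\<tau> * x))" if "prob_space L" "sets L = sets borel" for L :: "real measure"
  proof -
    interpret L: prob_space L by fact
    show ?thesis
      by (rule L.integrable_const_bound[where B = 1]) (auto simp: measurable_cong_sets[OF that(2) refl])
  qed
  have char_parts: "Re (char L \<tau>) = (\<integral>x. cos (\<tau> * x) \<partial>L)" "Im (char L \<tau>) = (\<integral>x. sin (\<tau> * x) \<partial>L)"
    if "prob_space L" "sets L = sets borel" for L :: "real measure"
    unfolding char_def using integral_Re[OF integrable_iexp[OF that]] integral_Im[OF integrable_iexp[OF that]]
    by (simp_all add: Re_exp Im_exp)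
  have bind: "(\<integral>x. f x \<partial>(M \<bind> N)) = (\<integral>x. (\<integral>y. f y \<partial>N x) \<partial>M)"
    and meas: "(\<lambda>x. \<integral>y. f y \<partial>N x) \<in> borel_measurable M"
    if [measurable]: "f \<in> borel_measurable borel" and bound: "\<And>x. \<bar>f x\<bar> \<le> 1" for f :: "real \<Rightarrow> real"
  proof -
    show "(\<integral>x. f x \<partial>(M \<bind> N)) = (\<integral>x. (\<integral>y. f y \<partial>N x) \<partial>M)"
    proof (rule integral_bind[where K = borel and B = 1 and B' = 1])
      show "finite_measure M" by unfold_locales
      show "AE x in M. emeasure (N x) (space (N x)) \<le> ennreal 1"
        using prob_space.emeasure_space_1[OF prob] by (intro AE_I2) simp
    qed (use N bound in auto)
    show "(\<lambda>x. \<integral>y. f y \<partial>N x) \<in> borel_measurable M"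
      by (rule measurable_compose[OF N integral_measurable_subprob_algebra]) simp
  qed
  have cos_sin: "(\<lambda>x. Re (char (N x) \<tau>)) \<in> borel_measurable M" "(\<lambda>x. Im (char (N x) \<tau>)) \<in> borel_measurable M"
    using meas[of "\<lambda>x. cos (\<tau> * x)"] meas[of "\<lambda>x. sin (\<tau> * x)"] char_parts[OF prob sets_N]
    by (simp_all cong: measurable_cong_simp)
  have integrable: "integrable M (\<lambda>x. char (N x) \<tau>)"
  proof (rule M.integrable_const_bound[where B = 1])
    show "AE x in M. norm (char (N x) \<tau>) \<le> 1"
    proof (rule AE_I2)
      fix x assume x: "x \<in> space M"
      interpret real_distribution "N x"
        using prob[OF x] sets_N[OF x] sets_eq_imp_space_eq[OF sets_N[OF x]]
        by (auto simp: real_distribution_def real_distribution_axioms_def)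
      show "norm (char (N x) \<tau>) \<le> 1" by (rule cmod_char_le_1)
    qed
    show "(\<lambda>x. char (N x) \<tau>) \<in> borel_measurable M"
      using cos_sin by (simp add: borel_measurable_complex_iff)
  qed
  have "(\<integral>x. Re (char (N x) \<tau>) \<partial>M) = (\<integral>x. (\<integral>y. cos (\<tau> * y) \<partial>N x) \<partial>M)"
    "(\<integral>x. Im (char (N x) \<tau>) \<partial>M) = (\<integral>x. (\<integral>y. sin (\<tau> * y) \<partial>N x) \<partial>M)"
    by (intro Bochner_Integration.integral_cong refl char_parts prob sets_N; assumption)+
  thus ?thesis
    using integral_Re[OF integrable] integral_Im[OF integrable]
      char_parts[OF MN.prob_space_axioms sets_MN] bind[of "\<lambda>x. cos (\<tau> * x)"] bind[of "\<lambda>x. sin (\<tau> * x)"]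
    by (intro complex_eqI) simp_all
qed

context subordinator
begin

text \<open>
  Extended to negative times by the law at time \<open>0\<close>, so that it is a kernel on the whole line.
\<close>
definition law :: "real \<Rightarrow> real measure" where
  "law t = distr M borel (\<xi> (max 0 t))"

lemma subordinator_mono: "0 \<le> t \<Longrightarrow> t \<le> u \<Longrightarrow> AE \<omega> in M. \<xi> t \<omega> \<le> \<xi> u \<omega>"
  using paths by eventually_elim (auto simp: mono_on_def)

lemma xi_measurable [measurable]: "\<xi> (max 0 t) \<in> borel_measurable M"
  by (rule measurable_subordinator) simp

lemma prob_space_law: "prob_space (law t)"
  unfolding law_def by (rule prob_space_distr) simp

lemma sets_law [simp, measurable_cong]: "sets (law t) = sets borel"
  by (simp add: law_def)

lemma space_law [simp]: "space (law t) = UNIV"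
  by (simp add: law_def)

text \<open>
  For a half-line \<open>{..a}\<close> the probability \<open>P(\<xi>\<^sub>t \<le> a)\<close> is monotone in \<open>t\<close>, hence measurable, and
  half-lines generate the Borel sets.
\<close>
lemma law_measurable: "law \<in> borel \<rightarrow>\<^sub>M subprob_algebra borel"
proof (rule measurable_subprob_algebra_generated[where G = "range (\<lambda>a. {..a})" and \<Omega> = UNIV])
  show "sets (borel :: real measure) = sigma_sets UNIV (range (\<lambda>a. {..a}))"
    by (subst borel_eq_atMost) simp
  show "Int_stable (range (\<lambda>a::real. {..a}))"
    by (auto simp: Int_stable_def)
  show "subprob_space (law t)" for t
    using prob_space_law by (rule prob_space_imp_subprob_space)
  show "(\<lambda>t. emeasure (law t) A) \<in> borel_measurable borel" if A: "A \<in> range (\<lambda>a. {..a})" for A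
  proof -
    obtain a where A: "A = {..a}" using A by auto
    have "mono (\<lambda>t. - measure (law t) A)"
    proof (rule monoI)
      fix t u :: real assume "t \<le> u"
      hence ae: "AE \<omega> in M. \<xi> (max 0 t) \<omega> \<le> \<xi> (max 0 u) \<omega>"
        by (intro subordinator_mono) auto
      have "measure (law u) A \<le> measure (law t) A"
        unfolding law_def A
        by (simp add: measure_distr, intro finite_measure_mono_AE) (use ae in auto)
      thus "- measure (law t) A \<le> - measure (law u) A" by simp
    qed
    hence "(\<lambda>t. - measure (law t) A) \<in> borel_measurable borel"
      by (rule borel_measurable_mono)
    hence "(\<lambda>t. measure (law t) A) \<in> borel_measurable borel"
      by simp
    moreover have "emeasure (law t) A = ennreal (measure (law t) A)" for t
      using prob_space_law[of t] by (simp add: finite_measure.emeasure_eq_measure prob_space_def)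
    ultimately show ?thesis by simp
  qed
  show "(\<lambda>t. emeasure (law t) UNIV) \<in> borel_measurable borel"
    using prob_space.emeasure_space_1[OF prob_space_law] by (simp add: law_def)
qed auto

text \<open>
  Since \<open>E exp (-\<xi>\<^sub>t) = exp (- q t)\<close>, weighting the law of \<open>\<xi>\<^sub>t\<close> by \<open>exp (q t - x)\<close> gives a
  probability measure \<open>H t\<close>. Averaging \<open>H\<close> over an exponential time of rate \<open>q\<close> cancels the
  factor \<open>exp (q t)\<close> and leaves \<open>q e\<^sup>-\<^sup>x U(dx)\<close>. Working with a probability measure makes
  characteristic functions available, although \<open>U\<close> itself is infinite.
\<close>
lemma tilted_potential_measure:
  assumes lap: "has_laplace_exponent M \<xi> \<phi>" and \<phi>1: "\<phi> 1 = of_real q" and q: "q > 0"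
  obtains P where "real_distribution P"
    and "\<And>\<tau>. char P \<tau> = of_real q / \<phi> (1 - \<i> * of_real \<tau>)"
    and "\<And>A. A \<in> sets borel \<Longrightarrow>
           emeasure (potential_measure M \<xi>) A = (\<integral>\<^sup>+x. ennreal (exp x / q) * indicator A x \<partial>P)"
proof -
  define T :: "real \<Rightarrow> real" where "T = (\<lambda>t. max 0 t)"
  define H where "H = (\<lambda>t. density (law t) (\<lambda>x. ennreal (exp (T t * q) * exp (- x))))"
  define E where "E = density lborel (exponential_density q)"
  define P where "P = E \<bind> H"
  have T: "T t \<ge> 0" "t \<ge> 0 \<Longrightarrow> T t = t" for t by (auto simp: T_def)
  have lap_z: "(\<integral>x. exp (- z * of_real x) \<partial>law t) = exp (- of_real (T t) * \<phi> z)" if "Re z \<ge> 0" for z t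
    using lap that T(1)[of t] unfolding has_laplace_exponent_def law_def T_def
    by (subst integral_distr) auto
  have lap_1: "integrable (law t) (\<lambda>x. exp (- x))" "(\<integral>x. exp (- x) \<partial>law t) = exp (- (T t * q))" for t
  proof -
    have "complex_of_real (\<integral>x. exp (- x) \<partial>law t) = (\<integral>x. exp (- 1 * of_real x) \<partial>law t)"
    proof (subst integral_complex_of_real[symmetric], intro Bochner_Integration.integral_cong refl)
      fix x
      show "complex_of_real (exp (- x)) = exp (- 1 * of_real x)"
        using exp_of_real[of "- x", where 'a = complex] by simp
    qed
    also have "\<dots> = of_real (exp (- (T t * q)))"
      by (subst lap_z) (simp_all add: \<phi>1 exp_of_real flip: of_real_mult of_real_minus)
    finally show eq: "(\<integral>x. exp (- x) \<partial>law t) = exp (- (T t * q))"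
      by (simp only: of_real_eq_iff)
    show "integrable (law t) (\<lambda>x. exp (- x))"
      using eq not_integrable_integral_eq by fastforce
  qed
  have H_prob: "prob_space (H t)" for t
  proof
    have "emeasure (H t) (space (H t)) = (\<integral>\<^sup>+x. ennreal (exp (T t * q) * exp (- x)) \<partial>law t)"
      by (simp add: H_def emeasure_density)
    also have "\<dots> = ennreal (\<integral>x. exp (T t * q) * exp (- x) \<partial>law t)"
      by (intro nn_integral_eq_integral integrable_mult_right lap_1) auto
    also have "\<dots> = 1"
      unfolding integral_mult_right_zero lap_1 by (simp flip: exp_add)
    finally show "emeasure (H t) (space (H t)) = 1" .
  qed
  have law_meas [measurable]: "law \<in> borel \<rightarrow>\<^sub>M subprob_algebra borel"
    by (rule law_measurable)
  have H_nn: "(\<integral>\<^sup>+x. f x \<partial>H t) = (\<integral>\<^sup>+x. ennreal (exp (T t * q) * exp (- x)) * f x \<partial>law t)"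
    if [measurable]: "f \<in> borel_measurable borel" for f t
    unfolding H_def by (subst nn_integral_density) auto
  have H_meas: "H \<in> borel \<rightarrow>\<^sub>M subprob_algebra borel"
  proof (rule measurable_subprob_algebra)
    show "subprob_space (H t)" for t
      using H_prob by (rule prob_space_imp_subprob_space)
    show "sets (H t) = sets borel" for t by (simp add: H_def)
    show "(\<lambda>t. emeasure (H t) A) \<in> borel_measurable borel" if [measurable]: "A \<in> sets borel" for A
    proof -
      have "emeasure (H t) A = ennreal (exp (T t * q)) * (\<integral>\<^sup>+x. ennreal (exp (- x)) * indicator A x \<partial>law t)" for t
        unfolding H_def
        by (simp add: emeasure_density ennreal_mult nn_integral_cmult[symmetric] mult.assoc)
      moreover have "(\<lambda>t. \<integral>\<^sup>+x. ennreal (exp (- x)) * indicator A x \<partial>law t) \<in> borel_measurable borel"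
        by (rule measurable_compose[OF law_meas nn_integral_measurable_subprob_algebra]) simp
      moreover have [measurable]: "T \<in> borel_measurable borel" by (simp add: T_def[abs_def])
      ultimately show ?thesis by simp
    qed
  qed
  interpret E: prob_space E
    unfolding E_def by (rule prob_space_exponential_density[OF q])
  have sets_E [measurable_cong, simp]: "sets E = sets borel" by (simp add: E_def)
  have H_meas_E: "H \<in> E \<rightarrow>\<^sub>M subprob_algebra borel"
    using H_meas by simp
  have sets_P: "sets P = sets borel"
    unfolding P_def by (rule sets_bind) (auto simp: H_def E_def)
  interpret P: prob_space P
    unfolding P_def by (rule E.prob_space_bind[OF _ H_meas_E]) (use H_prob in simp)
  have real_P: "real_distribution P"
    by unfold_locales (use sets_P sets_eq_imp_space_eq[OF sets_P] in auto)
  have char_P: "char P \<tau> = of_real q / \<phi> (1 - \<i> * of_real \<tau>)" for \<tau>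
  proof -
    define z where "z = 1 - \<i> * complex_of_real \<tau>"
    have inner: "(\<integral>x. iexp (\<tau> * x) \<partial>H t) = of_real (exp (T t * q)) * exp (- of_real (T t) * \<phi> z)" for t
    proof -
      have "(\<integral>x. iexp (\<tau> * x) \<partial>H t) = (\<integral>x. (exp (T t * q) * exp (- x)) *\<^sub>R iexp (\<tau> * x) \<partial>law t)"
        unfolding H_def by (subst integral_density) auto
      also have "\<dots> = (\<integral>x. of_real (exp (T t * q)) * exp (- z * of_real x) \<partial>law t)"
        by (intro Bochner_Integration.integral_cong refl)
           (simp add: scaleR_conv_of_real z_def exp_of_real[symmetric] mult.assoc exp_add[symmetric] algebra_simps)
      also have "\<dots> = of_real (exp (T t * q)) * exp (- of_real (T t) * \<phi> z)"
        by (subst integral_mult_right_zero, subst lap_z) (simp_all add: z_def)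
      finally show ?thesis .
    qed
    have Re\<phi>: "Re (\<phi> z) \<ge> q"
    proof -
      have "exp (- Re (\<phi> z)) = norm (\<integral>x. exp (- z * of_real x) \<partial>law 1)"
        by (subst lap_z) (simp_all add: z_def T_def)
      also have "\<dots> \<le> (\<integral>x. norm (exp (- z * of_real x)) \<partial>law 1)"
        by (rule integral_norm_bound)
      also have "\<dots> = (\<integral>x. exp (- x) \<partial>law 1)"
        by (simp add: z_def)
      also have "\<dots> = exp (- q)" by (simp add: lap_1 T_def)
      finally show ?thesis by simp
    qed
    have "char P \<tau> = (\<integral>t. (\<integral>x. iexp (\<tau> * x) \<partial>H t) \<partial>E)"
      unfolding P_def by (subst char_bind[OF E.prob_space_axioms H_meas_E H_prob]) (simp add: char_def)
    also have "\<dots> = of_real q / \<phi> z"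
      unfolding E_def inner
    proof (rule exponential_integral[OF q])
      show "Re (\<phi> z) > 0" using Re\<phi> q by simp
      show "(\<lambda>t. complex_of_real (exp (T t * q)) * exp (- complex_of_real (T t) * \<phi> z)) \<in> borel_measurable borel"
        unfolding T_def by measurable
      show "of_real (exp (- (q * t))) * (of_real (exp (T t * q)) * exp (- of_real (T t) * \<phi> z)) = exp (- (\<phi> z * of_real t))"
        if "t > 0" for t
        using that T(2)[of t]
        by (simp add: mult.assoc[symmetric] mult.commute flip: of_real_mult exp_add)
    qed
    finally show ?thesis by (simp add: z_def)
  qed
  have pot: "emeasure (potential_measure M \<xi>) A = (\<integral>\<^sup>+x. ennreal (exp x / q) * indicator A x \<partial>P)"
    if A: "A \<in> sets borel" for A
  proof -
    define D where "D = density P (\<lambda>x. ennreal (exp x / q))"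
    have D: "emeasure D B = (\<integral>\<^sup>+x. ennreal (exp x / q) * indicator B x \<partial>P)" if "B \<in> sets borel" for B
      unfolding D_def using that sets_P by (subst emeasure_density) auto
    have eq: "(\<integral>\<^sup>+ t\<in>{0..}. emeasure M {\<omega> \<in> space M. \<xi> t \<omega> \<in> B} \<partial>lborel) = emeasure D B"
      if B [measurable]: "B \<in> sets borel" for B
    proof -
      have inner: "(\<integral>\<^sup>+x. ennreal (exp x / q) * indicator B x \<partial>H t) = ennreal (exp (T t * q) / q) * emeasure (law t) B" for t
      proof -
        have "(\<integral>\<^sup>+x. ennreal (exp x / q) * indicator B x \<partial>H t) =
                (\<integral>\<^sup>+x. ennreal (exp (T t * q) / q) * indicator B x \<partial>law t)"
        proof (subst H_nn)
          have "exp (T t * q) * exp (- x) * (exp x / q) = exp (T t * q) / q" for x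
            by (simp add: exp_minus)
          hence "ennreal (exp (T t * q) * exp (- x)) * ennreal (exp x / q) = ennreal (exp (T t * q) / q)" for x
            using q by (subst ennreal_mult[symmetric]) auto
          thus "(\<integral>\<^sup>+x. ennreal (exp (T t * q) * exp (- x)) * (ennreal (exp x / q) * indicator B x) \<partial>law t) =
              (\<integral>\<^sup>+x. ennreal (exp (T t * q) / q) * indicator B x \<partial>law t)"
            by (simp only: mult.assoc[symmetric])
        qed simp
        also have "\<dots> = ennreal (exp (T t * q) / q) * emeasure (law t) B"
          by (simp add: nn_integral_cmult)
        finally show ?thesis .
      qed
      have "emeasure D B = (\<integral>\<^sup>+t. \<integral>\<^sup>+x. ennreal (exp x / q) * indicator B x \<partial>H t \<partial>E)"
        unfolding D[OF B] P_def by (rule nn_integral_bind[OF _ H_meas_E]) simp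
      also have "\<dots> = (\<integral>\<^sup>+t. ennreal (exponential_density q t) * (ennreal (exp (T t * q) / q) * emeasure (law t) B) \<partial>lborel)"
        unfolding E_def inner
      proof (rule nn_integral_density)
        have "(\<lambda>t. emeasure (law t) B) \<in> borel_measurable borel"
          by (rule measurable_compose[OF law_meas measurable_emeasure_subprob_algebra[OF B]])
        thus "(\<lambda>t. ennreal (exp (T t * q) / q) * emeasure (law t) B) \<in> borel_measurable lborel"
          unfolding T_def by measurable
      qed simp
      also have "\<dots> = (\<integral>\<^sup>+ t\<in>{0..}. emeasure M {\<omega> \<in> space M. \<xi> t \<omega> \<in> B} \<partial>lborel)"
      proof (rule nn_integral_cong)
        fix t :: real
        show "ennreal (exponential_density q t) * (ennreal (exp (T t * q) / q) * emeasure (law t) B) =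
                emeasure M {\<omega> \<in> space M. \<xi> t \<omega> \<in> B} * indicator {0..} t"
        proof (cases "t \<ge> 0")
          case True
          have "emeasure (law t) B = emeasure M {\<omega> \<in> space M. \<xi> t \<omega> \<in> B}"
            unfolding law_def using True xi_measurable[of t]
            by (simp add: emeasure_distr vimage_def Int_def conj_commute)
          moreover have "exponential_density q t * (exp (T t * q) / q) = 1"
            using True q T(2)[OF True] by (simp add: exponential_density_def exp_minus)
          hence "ennreal (exponential_density q t) * ennreal (exp (T t * q) / q) = 1"
            using q by (simp flip: ennreal_mult'')
          ultimately show ?thesis using True by (simp flip: mult.assoc)
        qed (simp add: exponential_density_def)
      qed
      finally show ?thesis by simp
    qed
    have "potential_measure M \<xi> = measure_of UNIV (sets borel) (emeasure D)"
      unfolding potential_measure_def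
      by (rule measure_of_eq) (use eq sets.sigma_sets_eq[of "borel :: real measure"] in auto)
    also have "\<dots> = D"
      using measure_of_of_measure[of D] sets_P sets_eq_imp_space_eq[OF sets_P]
      by (simp add: D_def)
    finally show ?thesis using D[OF A] by simp
  qed
  show ?thesis using that[OF real_P char_P pot] .
qed

end

text \<open>
  The weight \<open>q r\<^sub>k e\<^sup>-\<^sup>x exp (s\<^sub>k x)\<close> is \<open>q r\<^sub>k / (1 - s\<^sub>k)\<close> times the exponential density of rate
  \<open>1 - s\<^sub>k\<close>. The point mass at \<open>0\<close> has index \<open>0\<close> in the mixture and the \<open>k\<close>-th exponential law has
  index \<open>k + 1\<close>; the hypothesis on the sum says that the total mass is \<open>1\<close>.
\<close>
lemma exponential_mixture:
  fixes \<eta> q :: real and r s :: "nat \<Rightarrow> real"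
  assumes \<eta>: "\<eta> \<ge> 0" and q: "q > 0" and r: "\<And>k. r k \<ge> 0" and s: "\<And>k. s k \<le> 0"
    and sums: "(\<lambda>k. r k / (1 - s k)) sums (1 / q - \<eta>)"
  obtains Q where "real_distribution Q"
    and "\<And>\<tau>. char Q \<tau> = of_real q * (of_real \<eta> + (\<Sum>k. of_real (r k) / (1 - \<i> * of_real \<tau> - of_real (s k))))"
    and "\<And>A. A \<in> sets borel \<Longrightarrow> (\<integral>\<^sup>+x. ennreal (exp x / q) * indicator A x \<partial>Q) =
           ennreal \<eta> * indicator A 0 + (\<integral>\<^sup>+x\<in>A \<inter> {0<..}. (\<Sum>k. ennreal (r k * exp (s k * x))) \<partial>lborel)"
proof -
  define p where "p = (\<lambda>k. case k of 0 \<Rightarrow> q * \<eta> | Suc j \<Rightarrow> q * (r j / (1 - s j)))"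
  define R where "R = (\<lambda>k. case k of 0 \<Rightarrow> return borel (0::real) | Suc j \<Rightarrow> density lborel (exponential_density (1 - s j)))"
  define N where "N = density (count_space UNIV) (\<lambda>k. ennreal (p k))"
  define Q where "Q = N \<bind> R"
  have s1: "1 - s k > 0" for k using s[of k] by simp
  have p_nonneg: "p k \<ge> 0" for k
    using \<eta> q r s1 by (auto simp: p_def less_imp_le split: nat.splits)
  have p_Suc: "(\<lambda>k. p (Suc k)) sums (1 - p 0)"
    using sums_mult[OF sums, of q] q by (simp add: p_def right_diff_distrib)
  hence p_sums: "p sums 1" by (simp add: sums_Suc_iff)
  have R_prob: "prob_space (R k)" for k
    using prob_space_exponential_density[OF s1] by (auto simp: R_def prob_space_return split: nat.splits)
  have sets_R [simp]: "sets (R k) = sets borel" for k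
    by (auto simp: R_def split: nat.splits)
  have sets_N [simp]: "sets N = UNIV" by (simp add: N_def)
  have space_N [simp]: "space N = UNIV" by (simp add: N_def)
  have R_meas: "R \<in> N \<rightarrow>\<^sub>M subprob_algebra borel"
    by (rule measurable_subprob_algebra) (auto intro: prob_space_imp_subprob_space R_prob simp: measurable_def)
  have prob_N: "prob_space N"
  proof
    have "emeasure N (space N) = (\<Sum>k. ennreal (p k))"
      by (simp add: N_def emeasure_density nn_integral_count_space_nat)
    also have "\<dots> = ennreal (\<Sum>k. p k)"
      using p_nonneg p_sums by (intro suminf_ennreal2) (auto simp: sums_iff)
    finally show "emeasure N (space N) = 1" using p_sums by (simp add: sums_iff)
  qed
  interpret N: prob_space N by (rule prob_N)
  have sets_Q: "sets Q = sets borel"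
    unfolding Q_def by (rule sets_bind) auto
  interpret Q: prob_space Q
    unfolding Q_def by (rule N.prob_space_bind[OF _ R_meas]) (use R_prob in simp)
  have real_Q: "real_distribution Q"
    by unfold_locales (use sets_Q sets_eq_imp_space_eq[OF sets_Q] in auto)
  have char_Q: "char Q \<tau> = of_real q * (of_real \<eta> + (\<Sum>k. of_real (r k) / (1 - \<i> * of_real \<tau> - of_real (s k))))" for \<tau>
  proof -
    define \<psi> where "\<psi> = (\<lambda>k. \<integral>x. iexp (\<tau> * x) \<partial>R k)"
    have \<psi>_bound: "cmod (\<psi> k) \<le> 1" for k
    proof -
      interpret Rk: prob_space "R k" by (rule R_prob)
      have "cmod (\<psi> k) \<le> (\<integral>x. cmod (iexp (\<tau> * x)) \<partial>R k)"
        unfolding \<psi>_def by (rule integral_norm_bound)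
      thus ?thesis by (simp add: Rk.prob_space)
    qed
    have p_sm: "summable p" using p_sums by (simp add: sums_iff)
    have sm: "summable (\<lambda>k. norm (p k *\<^sub>R \<psi> k))"
      by (rule summable_comparison_test'[OF p_sm])
         (use p_nonneg \<psi>_bound in \<open>auto intro: mult_left_le\<close>)
    have "char Q \<tau> = (\<integral>k. \<psi> k \<partial>N)"
      unfolding Q_def \<psi>_def by (subst char_bind[OF prob_N R_meas R_prob]) (simp add: char_def)
    also have "\<dots> = (\<integral>k. p k *\<^sub>R \<psi> k \<partial>count_space UNIV)"
      unfolding N_def using p_nonneg by (subst integral_density) auto
    also have "\<dots> = (\<Sum>k. p k *\<^sub>R \<psi> k)"
      using sums_integral_count_space_nat[of "\<lambda>k. p k *\<^sub>R \<psi> k"] sm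
      by (simp add: integrable_count_space_nat_iff sums_iff)
    also have "\<dots> = p 0 *\<^sub>R \<psi> 0 + (\<Sum>k. p (Suc k) *\<^sub>R \<psi> (Suc k))"
      using suminf_split_head[OF summable_norm_cancel[OF sm]] by simp
    finally have split: "char Q \<tau> = p 0 *\<^sub>R \<psi> 0 + (\<Sum>k. p (Suc k) *\<^sub>R \<psi> (Suc k))" .
    have \<psi>_0: "\<psi> 0 = 1"
      by (simp add: \<psi>_def R_def integral_return)
    have \<psi>_Suc: "p (Suc k) *\<^sub>R \<psi> (Suc k) = of_real q * (of_real (r k) / (1 - \<i> * of_real \<tau> - of_real (s k)))" for k
    proof -
      have "\<psi> (Suc k) = of_real (1 - s k) / (1 - \<i> * of_real \<tau> - of_real (s k))"
        unfolding \<psi>_def R_def nat.case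
      proof (rule exponential_integral[OF s1])
        show "Re (1 - \<i> * of_real \<tau> - of_real (s k)) > 0" using s1[of k] by simp
        show "of_real (exp (- ((1 - s k) * t))) * iexp (\<tau> * t) = exp (- ((1 - \<i> * of_real \<tau> - of_real (s k)) * of_real t))" for t
          by (simp add: exp_of_real[symmetric] exp_add[symmetric] algebra_simps)
      qed simp
      moreover have "complex_of_real (1 - s k) \<noteq> 0" using s1[of k] by (metis less_irrefl of_real_eq_0_iff)
      ultimately show ?thesis
        by (simp add: p_def scaleR_conv_of_real)
    qed
    have "(\<Sum>k. of_real q * (of_real (r k) / (1 - \<i> * of_real \<tau> - of_real (s k)))) =
                 of_real q * (\<Sum>k. of_real (r k) / (1 - \<i> * of_real \<tau> - of_real (s k)))"
    proof (rule suminf_mult)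
      have "summable (\<lambda>k. r k / (1 - s k))" using sums by (simp add: sums_iff)
      thus "summable (\<lambda>k. of_real (r k) / (1 - \<i> * of_real \<tau> - of_real (s k)))"
      proof (rule summable_comparison_test')
        fix k
        have "1 - s k \<le> cmod (1 - \<i> * of_real \<tau> - of_real (s k))"
          using complex_Re_le_cmod[of "1 - \<i> * of_real \<tau> - of_real (s k)"] by simp
        thus "norm (of_real (r k) / (1 - \<i> * of_real \<tau> - of_real (s k))) \<le> r k / (1 - s k)"
          using r[of k] s1[of k] by (auto simp: norm_divide intro!: divide_left_mono mult_pos_pos)
      qed
    qed
    thus ?thesis
      unfolding split \<psi>_0 \<psi>_Suc by (simp add: p_def scaleR_conv_of_real distrib_left)
  qed
  have nn: "(\<integral>\<^sup>+x. ennreal (exp x / q) * indicator A x \<partial>Q) =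
           ennreal \<eta> * indicator A 0 + (\<integral>\<^sup>+x\<in>A \<inter> {0<..}. (\<Sum>k. ennreal (r k * exp (s k * x))) \<partial>lborel)"
    if A [measurable]: "A \<in> sets borel" for A
  proof -
    define f where "f = (\<lambda>x. ennreal (exp x / q) * indicator A x)"
    have f [measurable]: "f \<in> borel_measurable borel" by (simp add: f_def)
    have "(\<integral>\<^sup>+x. f x \<partial>Q) = (\<integral>\<^sup>+k. \<integral>\<^sup>+x. f x \<partial>R k \<partial>N)"
      unfolding Q_def by (rule nn_integral_bind[OF f R_meas])
    also have "\<dots> = (\<integral>\<^sup>+k. ennreal (p k) * (\<integral>\<^sup>+x. f x \<partial>R k) \<partial>count_space UNIV)"
      unfolding N_def by (subst nn_integral_density) auto
    also have "\<dots> = (\<Sum>k. ennreal (p k) * (\<integral>\<^sup>+x. f x \<partial>R k))"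
      by (rule nn_integral_count_space_nat)
    also have "\<dots> = ennreal (p 0) * (\<integral>\<^sup>+x. f x \<partial>R 0) + (\<Sum>k. ennreal (p (Suc k)) * (\<integral>\<^sup>+x. f x \<partial>R (Suc k)))"
      using sums_unique[OF sums_Suc[OF summable_sums[OF summableI]], of "\<lambda>k. ennreal (p k) * (\<integral>\<^sup>+x. f x \<partial>R k)"]
      by (simp add: add.commute)
    finally have split: "(\<integral>\<^sup>+x. f x \<partial>Q) =
        ennreal (p 0) * (\<integral>\<^sup>+x. f x \<partial>R 0) + (\<Sum>k. ennreal (p (Suc k)) * (\<integral>\<^sup>+x. f x \<partial>R (Suc k)))" .
    have R_0: "ennreal (p 0) * (\<integral>\<^sup>+x. f x \<partial>R 0) = ennreal \<eta> * indicator A 0"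
      using q \<eta> by (simp add: R_def nn_integral_return f_def p_def mult.assoc[symmetric] flip: ennreal_mult)
    have R_Suc: "ennreal (p (Suc k)) * (\<integral>\<^sup>+x. f x \<partial>R (Suc k)) =
                 (\<integral>\<^sup>+x. ennreal (r k * exp (s k * x)) * indicator (A \<inter> {0<..}) x \<partial>lborel)" for k
    proof -
      have "ennreal (p (Suc k)) * (\<integral>\<^sup>+x. f x \<partial>R (Suc k)) =
              (\<integral>\<^sup>+x. ennreal (p (Suc k)) * (ennreal (exponential_density (1 - s k) x) * f x) \<partial>lborel)"
        unfolding R_def nat.case by (subst nn_integral_density) (auto simp: nn_integral_cmult)
      also have "\<dots> = (\<integral>\<^sup>+x. ennreal (r k * exp (s k * x)) * indicator (A \<inter> {0<..}) x \<partial>lborel)"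
      proof (rule nn_integral_cong_AE)
        show "AE x in lborel. ennreal (p (Suc k)) * (ennreal (exponential_density (1 - s k) x) * f x) =
                ennreal (r k * exp (s k * x)) * indicator (A \<inter> {0<..}) x"
          using AE_lborel_singleton[of 0]
        proof eventually_elim
          case (elim x)
          show ?case
          proof (cases "x > 0 \<and> x \<in> A")
            case True
            have "p (Suc k) * (exponential_density (1 - s k) x * (exp x / q)) =
                    r k * (exp (- x * (1 - s k)) * exp x)"
              using True s1[of k] q by (simp add: p_def exponential_density_def)
            also have "\<dots> = r k * exp (s k * x)"
              by (simp add: exp_add[symmetric] algebra_simps)
            finally have *: "p (Suc k) * (exponential_density (1 - s k) x * (exp x / q)) = r k * exp (s k * x)" .
            have "ennreal (p (Suc k)) * (ennreal (exponential_density (1 - s k) x) * ennreal (exp x / q)) =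
                    ennreal (p (Suc k) * (exponential_density (1 - s k) x * (exp x / q)))"
            proof -
              have "exponential_density (1 - s k) x \<ge> 0"
                using s1[of k] by (simp add: exponential_density_def)
              thus ?thesis using p_nonneg q by (simp add: ennreal_mult[symmetric])
            qed
            thus ?thesis using True * by (simp add: f_def)
          next
            case False
            thus ?thesis using elim by (auto simp: f_def exponential_density_def indicator_def)
          qed
        qed
      qed
      finally show ?thesis .
    qed
    have "(\<Sum>k. \<integral>\<^sup>+x. ennreal (r k * exp (s k * x)) * indicator (A \<inter> {0<..}) x \<partial>lborel) =
        (\<integral>\<^sup>+x. (\<Sum>k. ennreal (r k * exp (s k * x)) * indicator (A \<inter> {0<..}) x) \<partial>lborel)"
      by (rule nn_integral_suminf[symmetric]) simp
    thus ?thesis using split unfolding R_0 R_Suc by (simp add: f_def)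
  qed
  show ?thesis using that[OF real_Q char_Q nn] .
qed

section \<open>Convergence of the exponential series and the value at the origin\<close>

context positive_pole_series
begin

text \<open>
  From \<open>exp u \<ge> 1 + u\<close>: for \<open>x\<close> bounded away from \<open>0\<close> the exponential series is dominated by the
  partial fraction series at \<open>1\<close>.
\<close>
lemma exp_residue_bound:
  assumes "0 < \<delta>" "\<delta> \<le> x"
  shows "r k * exp (s k * x) \<le> r k / (1 - s k) / min 1 \<delta>"
proof -
  define m where "m = min 1 \<delta>"
  have m: "0 < m" "m \<le> 1" "m \<le> \<delta>" using assms by (auto simp: m_def)
  have "m * (1 - s k) \<le> 1 + (- s k) * \<delta>"
    using m s_nonpos[of k] mult_mono[of "- s k" "- s k" m \<delta>] by (simp add: algebra_simps)
  also have "\<dots> \<le> exp (- s k * \<delta>)"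
    by (rule exp_ge_add_one_self)
  also have "\<dots> \<le> exp (- s k * x)"
    using assms s_nonpos[of k] by (simp add: mult_left_mono_neg)
  finally have "exp (s k * x) \<le> 1 / (m * (1 - s k))"
    using m s_nonpos[of k] by (simp add: exp_minus field_simps)
  hence "r k * exp (s k * x) \<le> r k * (1 / (m * (1 - s k)))"
    using r_pos[of k] by (intro mult_left_mono) auto
  thus ?thesis by (simp add: m_def mult_ac)
qed

lemma summable_exp_residues:
  assumes "x > 0"
  shows "summable (\<lambda>k. r k * exp (s k * x))"
proof (rule summable_comparison_test'[OF summable_divide[OF summable_residues[of 1]]])
  show "norm (r k * exp (s k * x)) \<le> r k / (1 - s k) / min 1 x" for k
    using exp_residue_bound[OF assms order_refl, of k] r_pos[of k] by simp
qed simp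

lemma uniform_limit_exp_residues:
  assumes "compact K" "K \<subseteq> {0<..}"
  shows "uniform_limit K (\<lambda>n x. \<Sum>k<n. complex_of_real (r (Suc k)) * exp (of_real (s (Suc k) * x)))
           (\<lambda>x. \<Sum>k. of_real (r (Suc k)) * exp (of_real (s (Suc k) * x))) sequentially"
proof (cases "K = {}")
  case False
  then obtain \<delta> where \<delta>: "\<delta> \<in> K" "\<And>x. x \<in> K \<Longrightarrow> \<delta> \<le> x"
    using compact_attains_inf[OF assms(1)] by blast
  have "\<delta> > 0" using \<delta>(1) assms(2) by auto
  show ?thesis
  proof (rule Weierstrass_m_test)
    show "summable (\<lambda>k. r (Suc k) / (1 - s (Suc k)) / min 1 \<delta>)"
      using summable_divide[OF summable_residues[of 1]]
      by (subst summable_Suc_iff[of "\<lambda>k. r k / (1 - s k) / min 1 \<delta>"]) simp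
    fix k x assume "x \<in> K"
    hence "r (Suc k) * exp (s (Suc k) * x) \<le> r (Suc k) / (1 - s (Suc k)) / min 1 \<delta>"
      using \<delta> \<open>\<delta> > 0\<close> by (intro exp_residue_bound) auto
    moreover have "norm (complex_of_real \<rho> * exp (of_real y)) = \<rho> * exp y" if "\<rho> > 0" for \<rho> y
      using that by (simp add: norm_mult)
    ultimately show "norm (complex_of_real (r (Suc k)) * exp (of_real (s (Suc k) * x)))
            \<le> r (Suc k) / (1 - s (Suc k)) / min 1 \<delta>"
      using r_pos by presburger
  qed
qed (simp add: uniform_limit_iff)

lemma summable_residues_0: "summable (\<lambda>k. r (Suc k) / (- s (Suc k)))"
proof (rule summable_comparison_test'[OF summable_mult[where c = "1 + 1 / c 0"]])
  show "summable (\<lambda>k. r (Suc k) / (1 - s (Suc k)))"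
    using summable_residues[of 1] by (subst summable_Suc_iff[of "\<lambda>k. r k / (1 - s k)"]) simp
  fix k
  define \<rho> \<sigma> where "\<rho> = r (Suc k)" and "\<sigma> = - s (Suc k)"
  have \<rho>: "\<rho> > 0" using r_pos by (simp only: \<rho>_def)
  have "c 0 \<le> c k" using c_strict_mono by (simp add: strict_mono_less_eq)
  hence \<sigma>: "c 0 < \<sigma>" using s_upper[of k] by (simp add: \<sigma>_def)
  have c0: "c 0 > 0" by (rule c_pos)
  have "1 / \<sigma> = (1 + 1 / \<sigma>) * (1 / (1 + \<sigma>))"
    using \<sigma> c0 by (simp add: field_simps)
  also have "\<dots> \<le> (1 + 1 / c 0) * (1 / (1 + \<sigma>))"
    using \<sigma> c0 by (intro mult_right_mono add_left_mono divide_left_mono) auto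
  finally have "1 / \<sigma> \<le> (1 + 1 / c 0) * (1 / (1 + \<sigma>))" .
  hence "\<rho> * (1 / \<sigma>) \<le> \<rho> * ((1 + 1 / c 0) * (1 / (1 + \<sigma>)))"
    using \<rho> by (intro mult_left_mono) auto
  hence "norm (\<rho> / \<sigma>) \<le> (1 + 1 / c 0) * (\<rho> / (1 + \<sigma>))"
    using \<rho> \<sigma> c0 by (simp add: mult_ac)
  thus "norm (r (Suc k) / (- s (Suc k))) \<le> (1 + 1 / c 0) * (r (Suc k) / (1 - s (Suc k)))"
    by (simp only: \<rho>_def \<sigma>_def diff_conv_add_uminus)
qed

lemma summable_residues_0_complex: "summable (\<lambda>k. of_real (r (Suc k)) / complex_of_real (s (Suc k)))"
proof -
  have "summable (\<lambda>k. complex_of_real (- (r (Suc k) / (- s (Suc k)))))"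
    by (intro summable_of_real summable_minus summable_residues_0)
  thus ?thesis by simp
qed

lemma deriv_F_ext_0: "deriv F_ext 0 = of_real (F' 0)" "F' 0 > (0 :: real)"
  using F_ext_of_real(2)[OF s_not_pole[of 0]] F'_s_pos[of 0] by simp_all

lemma reciprocal_partial_fraction_split:
  assumes lim: "(\<lambda>n. 1 / F (real (Suc n))) \<longlonglongrightarrow> \<eta>" and z: "Re z > 0"
  shows "summable (\<lambda>k. of_real (r (Suc k)) / (z - of_real (s (Suc k))))"
    and "1 / F z = of_real \<eta> + 1 / (deriv F_ext 0 * z) + (\<Sum>k. of_real (r (Suc k)) / (z - of_real (s (Suc k))))"
proof -
  let ?t = "\<lambda>k. complex_of_real (r k) / (z - of_real (s k))"
  have sm: "summable ?t" by (rule summable_residues_complex[OF z])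
  thus "summable (\<lambda>k. ?t (Suc k))" by (subst summable_Suc_iff)
  have "1 / F z = of_real \<eta> + (\<Sum>k. ?t k)"
    by (rule reciprocal_partial_fraction[OF lim z])
  also have "(\<Sum>k. ?t k) = ?t 0 + (\<Sum>k. ?t (Suc k))"
    using suminf_split_head[OF sm] by simp
  also have "?t 0 = 1 / (deriv F_ext 0 * z)"
    by (simp add: deriv_F_ext_0)
  finally show "1 / F z = of_real \<eta> + 1 / (deriv F_ext 0 * z) + (\<Sum>k. ?t (Suc k))"
    by simp
qed

text \<open>
  Both sides are limits of \<open>1 / F x - 1 / (F' 0 x)\<close> as \<open>x \<down> 0\<close>: one by Taylor expansion at the
  simple zero, the other termwise, dominated by the terms at \<open>0\<close>.
\<close>
lemma expansion_at_0:
  assumes lim: "(\<lambda>n. 1 / F (real (Suc n))) \<longlonglongrightarrow> \<eta>"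
  shows "of_real \<eta> - (\<Sum>k. of_real (r (Suc k)) / complex_of_real (s (Suc k))) =
           - ((deriv ^^ 2) F_ext 0) / (2 * (deriv F_ext 0)\<^sup>2)"
proof -
  define x where "x = (\<lambda>n. 1 / real (Suc n))"
  have x: "x n > 0" "x \<longlonglongrightarrow> 0" for n
    unfolding x_def using LIMSEQ_Suc[OF lim_1_over_n] by simp_all
  let ?R = "\<lambda>n. \<Sum>k. of_real (r (Suc k)) / (of_real (x n) - complex_of_real (s (Suc k)))"
  have "((\<lambda>z. 1 / F_ext z - 1 / (deriv F_ext 0 * z)) \<longlongrightarrow> - ((deriv ^^ 2) F_ext 0) / (2 * (deriv F_ext 0)\<^sup>2)) (at 0)"
  proof (rule reciprocal_simple_zero_limit)
    show "F_ext holomorphic_on - poles" using F_ext_analytic by (rule analytic_imp_holomorphic)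
    show "open (- poles :: complex set)" by (rule open_compl_poles)
    show "0 \<in> (- poles :: complex set)" using Re_nonneg_not_pole[of 0] by simp
    show "F_ext 0 = 0" by (simp add: F_ext_def)
    show "deriv F_ext 0 \<noteq> 0" using deriv_F_ext_0 by simp
  qed
  moreover have "filterlim (\<lambda>n. complex_of_real (x n)) (at 0) sequentially"
    unfolding filterlim_at using x(1) tendsto_of_real[OF x(2), where 'a = complex]
    by (auto simp: less_imp_neq[symmetric] intro!: always_eventually)
  ultimately have "(\<lambda>n. 1 / F_ext (of_real (x n)) - 1 / (deriv F_ext 0 * of_real (x n))) \<longlonglongrightarrow>
       - ((deriv ^^ 2) F_ext 0) / (2 * (deriv F_ext 0)\<^sup>2)"
    by (rule filterlim_compose)
  moreover have "1 / F_ext (of_real (x n)) - 1 / (deriv F_ext 0 * of_real (x n)) = of_real \<eta> + ?R n" for n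
  proof -
    have pos: "Re (complex_of_real (x n)) > 0" using x(1) by simp
    hence "F_ext (of_real (x n)) = F (complex_of_real (x n))"
      using Re_nonneg_not_pole[of "complex_of_real (x n)"] by (simp add: F_ext_def)
    thus ?thesis using reciprocal_partial_fraction_split(2)[OF lim pos] by simp
  qed
  moreover have "(\<lambda>n. of_real \<eta> + ?R n) \<longlonglongrightarrow> of_real \<eta> + (\<Sum>k. of_real (r (Suc k)) / (0 - complex_of_real (s (Suc k))))"
  proof (intro tendsto_add tendsto_const tannery[OF _ _ summable_residues_0])
    show "(\<lambda>n. of_real (r (Suc k)) / (of_real (x n) - complex_of_real (s (Suc k)))) \<longlonglongrightarrow>
            of_real (r (Suc k)) / (0 - complex_of_real (s (Suc k)))" for k
      using s_neg[of k] tendsto_of_real[OF x(2), where 'a = complex] by (intro tendsto_intros) auto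
    show "\<forall>\<^sub>F n in sequentially. \<forall>k. norm (of_real (r (Suc k)) / (of_real (x n) - complex_of_real (s (Suc k))))
            \<le> r (Suc k) / (- s (Suc k))"
    proof (intro always_eventually allI)
      fix n k
      have "norm (of_real (r (Suc k)) / (of_real (x n) - complex_of_real (s (Suc k)))) = r (Suc k) / (x n - s (Suc k))"
        by (rule norm_residue_term[OF x(1)])
      also have "\<dots> \<le> r (Suc k) / (- s (Suc k))"
      proof (rule divide_left_mono)
        show "0 < (x n - s (Suc k)) * - s (Suc k)"
          using x(1)[of n] s_neg[of k] by (intro mult_pos_pos) auto
        show "0 \<le> r (Suc k)" using r_pos[of "Suc k"] by (rule less_imp_le)
      qed (use x(1)[of n] in simp)
      finally show "norm (of_real (r (Suc k)) / (of_real (x n) - complex_of_real (s (Suc k)))) \<le> r (Suc k) / (- s (Suc k))" .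
    qed
  qed simp
  ultimately have "- ((deriv ^^ 2) F_ext 0) / (2 * (deriv F_ext 0)\<^sup>2) =
      of_real \<eta> + (\<Sum>k. of_real (r (Suc k)) / (0 - complex_of_real (s (Suc k))))"
    using LIMSEQ_unique by simp
  also have "(\<Sum>k. of_real (r (Suc k)) / (0 - complex_of_real (s (Suc k)))) =
      (\<Sum>k. - (of_real (r (Suc k)) / complex_of_real (s (Suc k))))"
    by (intro suminf_cong) simp
  also have "\<dots> = - (\<Sum>k. of_real (r (Suc k)) / complex_of_real (s (Suc k)))"
    by (rule suminf_minus) (rule summable_residues_0_complex)
  finally show ?thesis by simp
qed

end

section \<open>The potential measure of the subordinator\<close>

context beta_kernel
begin

lemma eta_nonneg: "eta \<beta> \<ge> 0"
proof (rule LIMSEQ_le_const[OF reciprocal_limit])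
  have "0 \<le> 1 / (F (real (Suc n)) :: real)" for n
    using F_pos[of "real (Suc n)"] by simp
  thus "\<exists>N. \<forall>n\<ge>N. 0 \<le> 1 / (F (real (Suc n)) :: real)" by blast
qed

lemma phi_res_eq: "phi_res \<beta> k = of_real (r k)"
  using F_ext_of_real(2)[OF s_not_pole] by (simp add: phi_res_def phi_ext_eq phi_zero_eq)

lemma mu_eq: "mu \<beta> = deriv F_ext 0"
  by (simp add: mu_def phi_ext_eq)

lemma Re_potential_density:
  assumes "x > 0"
  shows "ennreal (Re (potential_density \<beta> x)) = (\<Sum>k. ennreal (r k * exp (s k * x)))"
proof -
  have sm: "summable (\<lambda>k. r k * exp (s k * x))" by (rule summable_exp_residues[OF assms])
  hence sm': "summable (\<lambda>k. r (Suc k) * exp (s (Suc k) * x))"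
    by (subst summable_Suc_iff[of "\<lambda>k. r k * exp (s k * x)"])
  have "potential_density \<beta> x = of_real (r 0) + (\<Sum>k. of_real (r (Suc k) * exp (s (Suc k) * x)))"
    by (simp add: potential_density_def phi_res_eq phi_zero_eq mu_eq deriv_F_ext_0 flip: exp_of_real)
  also have "\<dots> = of_real (r 0 + (\<Sum>k. r (Suc k) * exp (s (Suc k) * x)))"
    using suminf_of_real[OF sm', where 'a = complex] by simp
  also have "r 0 + (\<Sum>k. r (Suc k) * exp (s (Suc k) * x)) = (\<Sum>k. r k * exp (s k * x))"
    using suminf_split_head[OF sm] by simp
  finally have "Re (potential_density \<beta> x) = (\<Sum>k. r k * exp (s k * x))" by simp
  thus ?thesis
    using sm r_pos by (simp add: suminf_ennreal2 less_imp_le)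
qed

lemma emeasure_potential_measure:
  assumes "subordinator M \<xi>" and lap: "has_laplace_exponent M \<xi> (phi \<beta>)" and A: "A \<in> sets borel"
  shows "emeasure (potential_measure M \<xi>) A = ennreal (eta \<beta>) * indicator A 0 +
          (\<integral>\<^sup>+ x\<in>A \<inter> {0<..}. ennreal (Re (potential_density \<beta> x)) \<partial>lborel)"
proof -
  interpret subordinator M \<xi> by fact
  define q where "q = (F 1 :: real)"
  have q: "q > 0" using F_pos[of 1] by (simp add: q_def)
  have phi1: "phi \<beta> 1 = of_real q"
    using phi_eq_pole_sum[of 1] pole_sum_of_real(1)[OF nonneg_not_pole[of 1], where 'b = complex]
    by (simp add: q_def)
  obtain P where P: "real_distribution P" "\<And>\<tau>. char P \<tau> = of_real q / phi \<beta> (1 - \<i> * of_real \<tau>)"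
      "\<And>A. A \<in> sets borel \<Longrightarrow> emeasure (potential_measure M \<xi>) A = (\<integral>\<^sup>+x. ennreal (exp x / q) * indicator A x \<partial>P)"
    using tilted_potential_measure[OF lap phi1 q] by blast
  have sums: "(\<lambda>k. r k / (1 - s k)) sums (1 / q - eta \<beta>)"
  proof -
    have sm: "summable (\<lambda>k. r k / (1 - s k))" by (rule summable_residues) simp
    have "complex_of_real (1 / q) = of_real (eta \<beta>) + (\<Sum>k. of_real (r k) / (1 - of_real (s k)))"
      using reciprocal_partial_fraction[OF reciprocal_limit, of 1] phi1 phi_eq_pole_sum[of 1] by simp
    also have "(\<Sum>k. of_real (r k) / (1 - complex_of_real (s k))) = of_real (\<Sum>k. r k / (1 - s k))"
      using suminf_of_real[OF sm, where 'a = complex] by simp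
    finally have "complex_of_real (1 / q) = of_real (eta \<beta> + (\<Sum>k. r k / (1 - s k)))"
      by simp
    hence "1 / q = eta \<beta> + (\<Sum>k. r k / (1 - s k))"
      by (simp only: of_real_eq_iff)
    thus ?thesis using summable_sums[OF sm] by simp
  qed
  obtain Q where Q: "real_distribution Q"
      "\<And>\<tau>. char Q \<tau> = of_real q * (of_real (eta \<beta>) + (\<Sum>k. of_real (r k) / (1 - \<i> * of_real \<tau> - of_real (s k))))"
      "\<And>A. A \<in> sets borel \<Longrightarrow> (\<integral>\<^sup>+x. ennreal (exp x / q) * indicator A x \<partial>Q) =
         ennreal (eta \<beta>) * indicator A 0 + (\<integral>\<^sup>+x\<in>A \<inter> {0<..}. (\<Sum>k. ennreal (r k * exp (s k * x))) \<partial>lborel)"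
    using exponential_mixture[OF eta_nonneg q less_imp_le[OF r_pos] s_nonpos sums] by blast
  have "char P = char Q"
  proof
    fix \<tau>
    have Re: "Re (1 - \<i> * of_real \<tau>) > 0" by simp
    have "char P \<tau> = of_real q * (1 / F (1 - \<i> * of_real \<tau>))"
      using phi_eq_pole_sum[of "1 - \<i> * of_real \<tau>"] by (simp add: P(2))
    also have "\<dots> = char Q \<tau>"
      unfolding reciprocal_partial_fraction[OF reciprocal_limit Re] Q(2) ..
    finally show "char P \<tau> = char Q \<tau>" .
  qed
  hence "P = Q" using Levy_uniqueness P(1) Q(1) by blast
  hence "emeasure (potential_measure M \<xi>) A =
      ennreal (eta \<beta>) * indicator A 0 + (\<integral>\<^sup>+x\<in>A \<inter> {0<..}. (\<Sum>k. ennreal (r k * exp (s k * x))) \<partial>lborel)"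
    using P(3)[OF A] Q(3)[OF A] by simp
  also have "(\<integral>\<^sup>+x\<in>A \<inter> {0<..}. (\<Sum>k. ennreal (r k * exp (s k * x))) \<partial>lborel) =
      (\<integral>\<^sup>+ x\<in>A \<inter> {0<..}. ennreal (Re (potential_density \<beta> x)) \<partial>lborel)"
    by (intro nn_integral_cong) (auto simp: Re_potential_density indicator_def)
  finally show ?thesis .
qed

end

theorem theorem2p4:
  fixes \<beta> :: real
  assumes "-2 < \<beta>" "\<beta> < 0"
  shows
    "(\<forall>(M :: 'a measure) \<xi>. subordinator M \<xi> \<longrightarrow> has_laplace_exponent M \<xi> (phi \<beta>) \<longrightarrow>
       (\<forall>A\<in>sets borel. emeasure (potential_measure M \<xi>) A =
          ennreal (eta \<beta>) * indicator A 0 +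
          (\<integral>\<^sup>+ x\<in>A \<inter> {0<..}. ennreal (Re (potential_density \<beta> x)) \<partial>lborel))) \<and>
     (\<forall>k. residue (\<lambda>z. 1 / phi_ext \<beta> z) (of_real (phi_zero \<beta> k)) = phi_res \<beta> k \<and>
           phi_res \<beta> k \<in> \<real> \<and> Re (phi_res \<beta> k) > 0) \<and>
     (\<forall>K. compact K \<and> K \<subseteq> {0<..} \<longrightarrow>
           uniform_limit K
             (\<lambda>n x. \<Sum>k<n. phi_res \<beta> (Suc k) * exp (of_real (phi_zero \<beta> (Suc k) * x)))
             (\<lambda>x. \<Sum>k. phi_res \<beta> (Suc k) * exp (of_real (phi_zero \<beta> (Suc k) * x)))
             sequentially) \<and>
     (\<forall>z. Re z > 0 \<longrightarrow>
           summable (\<lambda>k. phi_res \<beta> (Suc k) / (z - of_real (phi_zero \<beta> (Suc k)))) \<and>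
           1 / phi \<beta> z = of_real (eta \<beta>) + 1 / (mu \<beta> * z) +
             (\<Sum>k. phi_res \<beta> (Suc k) / (z - of_real (phi_zero \<beta> (Suc k))))) \<and>
     summable (\<lambda>k. phi_res \<beta> (Suc k) / of_real (phi_zero \<beta> (Suc k))) \<and>
     of_real (eta \<beta>) - (\<Sum>k. phi_res \<beta> (Suc k) / of_real (phi_zero \<beta> (Suc k))) =
           - ((deriv ^^ 2) (phi_ext \<beta>) 0) / (2 * (mu \<beta>)\<^sup>2)"
proof -
  interpret beta_kernel \<beta> using assms by unfold_locales
  show ?thesis
  proof (intro conjI allI impI ballI)
    fix M :: "'a measure" and \<xi> and A :: "real set"
    assume "subordinator M \<xi>" "has_laplace_exponent M \<xi> (phi \<beta>)" "A \<in> sets borel"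
    thus "emeasure (potential_measure M \<xi>) A = ennreal (eta \<beta>) * indicator A 0 +
            (\<integral>\<^sup>+ x\<in>A \<inter> {0<..}. ennreal (Re (potential_density \<beta> x)) \<partial>lborel)"
      by (rule emeasure_potential_measure)
  next
    fix k
    show "residue (\<lambda>z. 1 / phi_ext \<beta> z) (of_real (phi_zero \<beta> k)) = phi_res \<beta> k"
      unfolding phi_ext_eq phi_zero_eq phi_res_eq by (rule residue_reciprocal)
    show "phi_res \<beta> k \<in> \<real>" "Re (phi_res \<beta> k) > 0"
      using r_pos[of k] by (simp_all add: phi_res_eq)
  next
    fix K :: "real set"
    assume "compact K \<and> K \<subseteq> {0<..}"
    thus "uniform_limit K
            (\<lambda>n x. \<Sum>k<n. phi_res \<beta> (Suc k) * exp (of_real (phi_zero \<beta> (Suc k) * x)))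
            (\<lambda>x. \<Sum>k. phi_res \<beta> (Suc k) * exp (of_real (phi_zero \<beta> (Suc k) * x))) sequentially"
      unfolding phi_zero_eq phi_res_eq using uniform_limit_exp_residues by blast
  next
    fix z :: complex assume z: "Re z > 0"
    show "summable (\<lambda>k. phi_res \<beta> (Suc k) / (z - of_real (phi_zero \<beta> (Suc k))))"
      unfolding phi_zero_eq phi_res_eq by (rule reciprocal_partial_fraction_split(1)[OF reciprocal_limit z])
    show "1 / phi \<beta> z = of_real (eta \<beta>) + 1 / (mu \<beta> * z) +
            (\<Sum>k. phi_res \<beta> (Suc k) / (z - of_real (phi_zero \<beta> (Suc k))))"
      unfolding phi_zero_eq phi_res_eq mu_eq phi_eq_pole_sum[OF less_imp_le[OF z]]
      by (rule reciprocal_partial_fraction_split(2)[OF reciprocal_limit z])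
  next
    show "summable (\<lambda>k. phi_res \<beta> (Suc k) / of_real (phi_zero \<beta> (Suc k)))"
      unfolding phi_zero_eq phi_res_eq by (rule summable_residues_0_complex)
    show "of_real (eta \<beta>) - (\<Sum>k. phi_res \<beta> (Suc k) / of_real (phi_zero \<beta> (Suc k))) =
            - ((deriv ^^ 2) (phi_ext \<beta>) 0) / (2 * (mu \<beta>)\<^sup>2)"
      unfolding phi_zero_eq phi_res_eq mu_eq phi_ext_eq by (rule expansion_at_0[OF reciprocal_limit])
  qed
qed

end
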